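(* Let $a(x)$, $x=1,2,\dots$, be a lacunary sequence of integers, i.e. $\liminf_{x\to\infty}\frac{a(x+1)}{a(x)}>1$. There is a set of real numbers $\alpha$ of full Lebesgue measure such that for every $\alpha$ in this set, for all integers $k\ge2$ and all test functions $f\in C_c^\infty(\mathbf{R}^{k-1})$, $$\lim_{N\to\infty}R_k(f,N)(\alpha)=\int_{\mathbf{R}^{k-1}}f(x)\,dx .$$
   Context: For an integer $k\ge 2$ and $x=(x_1,\dots,x_k)$ a vector of positive integers, put $\Delta(x)=(a(x_1)-a(x_2),\dots,a(x_{k-1})-a(x_k))\in\mathbf{Z}^{k-1}$. For a smooth compactly supported real-valued function $f\in C_c^\infty(\mathbf{R}^{k-1})$ and an integer $N\ge1$, put $F_N(y)=\sum_{m\in\mathbf{Z}^{k-1}}f(N(m+y))$ for $y\in\mathbf{R}^{k-1}$. The $k$-level correlation sum is $$R_k(f,N)(\alpha)=\frac1N\sum^{*}_{1\le x_1,\dots,x_k\le N}F_N(\alpha\Delta(x)),$$ where $\sum^*$ denotes the sum over integer vectors $x=(x_1,\dots,x_k)$ with distinct components ($x_i\ne x_j$ for $i\ne j$). *)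

theory Defs
  imports "HOL-Analysis.Analysis"
begin

text \<open>
  The dimension is quantified after \<open>\<alpha>\<close> is chosen, so it cannot be a type parameter. The space
  \<open>\<R>\<^sup>n\<close> is therefore modelled by the functions \<open>nat \<Rightarrow> real\<close> that are \<open>undefined\<close> outside
  \<open>{1..n}\<close>, which is also the underlying space of the product measure \<open>\<Pi>\<^sub>M i\<in>{1..n}. lborel\<close>.
  As a subspace of \<open>nat \<Rightarrow> real\<close> with the product topology it carries the Euclidean topology, and
  it is closed. Functions on \<open>\<R>\<^sup>n\<close> have type \<open>(nat \<Rightarrow> real) \<Rightarrow> real\<close>; only their values on
  \<open>Rn n\<close> matter.
\<close>

definition Rn :: "nat \<Rightarrow> (nat \<Rightarrow> real) set" where
  "Rn n = {1..n} \<rightarrow>\<^sub>E UNIV"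

definition Zn :: "nat \<Rightarrow> (nat \<Rightarrow> int) set" where
  "Zn n = {1..n} \<rightarrow>\<^sub>E UNIV"

definition lborel_Rn :: "nat \<Rightarrow> (nat \<Rightarrow> real) measure" where
  "lborel_Rn n = (\<Pi>\<^sub>M i\<in>{1..n}. lborel)"

definition partial_deriv :: "nat \<Rightarrow> ((nat \<Rightarrow> real) \<Rightarrow> real) \<Rightarrow> (nat \<Rightarrow> real) \<Rightarrow> real" where
  "partial_deriv i f x = deriv (\<lambda>t. f (x(i := t))) (x i)"

text \<open>
  \<open>C_k r n f\<close>: all iterated partial derivatives of \<open>f\<close> of order at most \<open>r\<close> exist and are
  continuous on \<open>\<R>\<^sup>n\<close>. Existence has to be required separately, since \<open>deriv\<close> is total.
\<close>

primrec C_k :: "nat \<Rightarrow> nat \<Rightarrow> ((nat \<Rightarrow> real) \<Rightarrow> real) \<Rightarrow> bool" where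
  "C_k 0 n f \<longleftrightarrow> continuous_on (Rn n) f"
| "C_k (Suc r) n f \<longleftrightarrow> continuous_on (Rn n) f \<and>
     (\<forall>i\<in>{1..n}. (\<forall>x\<in>Rn n. (\<lambda>t. f (x(i := t))) field_differentiable (at (x i))) \<and>
                 C_k r n (partial_deriv i f))"

definition smooth :: "nat \<Rightarrow> ((nat \<Rightarrow> real) \<Rightarrow> real) \<Rightarrow> bool" where
  "smooth n f \<longleftrightarrow> (\<forall>r. C_k r n f)"

definition compactly_supported :: "nat \<Rightarrow> ((nat \<Rightarrow> real) \<Rightarrow> real) \<Rightarrow> bool" where
  "compactly_supported n f \<longleftrightarrow> compact (closure {x \<in> Rn n. f x \<noteq> 0})"

definition test_functions :: "nat \<Rightarrow> ((nat \<Rightarrow> real) \<Rightarrow> real) set" where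
  "test_functions n = {f. smooth n f \<and> compactly_supported n f}"

text \<open>A sequence \<open>a(1), a(2), \<dots>\<close> is given as a function on \<open>nat\<close> whose value at \<open>0\<close> is never used.
  The lower limit is taken in the extended reals, so it may be infinite; since \<open>x / 0 = 0\<close>, the
  condition forces \<open>a\<close> to be eventually nonzero.\<close>

definition lacunary :: "(nat \<Rightarrow> int) \<Rightarrow> bool" where
  "lacunary a \<longleftrightarrow> liminf (\<lambda>x. ereal (real_of_int (a (x + 1)) / real_of_int (a x))) > 1"

definition Delta :: "(nat \<Rightarrow> int) \<Rightarrow> nat \<Rightarrow> (nat \<Rightarrow> nat) \<Rightarrow> (nat \<Rightarrow> int)" where
  "Delta a k x = (\<lambda>i\<in>{1..k-1}. a (x i) - a (x (i + 1)))"

text \<open>For compactly supported \<open>f\<close> only finitely many terms of this sum are nonzero.\<close>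

definition periodization ::
  "nat \<Rightarrow> ((nat \<Rightarrow> real) \<Rightarrow> real) \<Rightarrow> nat \<Rightarrow> (nat \<Rightarrow> real) \<Rightarrow> real" where
  "periodization n f N y =
     (\<Sum>\<^sub>\<infinity>m\<in>Zn n. f (\<lambda>i\<in>{1..n}. real N * (real_of_int (m i) + y i)))"

definition distinct_tuples :: "nat \<Rightarrow> nat \<Rightarrow> (nat \<Rightarrow> nat) set" where
  "distinct_tuples k N = {x \<in> {1..k} \<rightarrow>\<^sub>E {1..N}. inj_on x {1..k}}"

definition correlation_sum ::
  "(nat \<Rightarrow> int) \<Rightarrow> nat \<Rightarrow> ((nat \<Rightarrow> real) \<Rightarrow> real) \<Rightarrow> nat \<Rightarrow> real \<Rightarrow> real" where
  "correlation_sum a k f N \<alpha> =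
     (1 / real N) * (\<Sum>x\<in>distinct_tuples k N.
        periodization (k - 1) f N (\<lambda>i\<in>{1..k-1}. \<alpha> * real_of_int (Delta a k x i)))"

end

theory Submission
  imports Defs "HOL-Real_Asymp.Real_Asymp"
begin

text \<open>
  Along \<open>N = s ^ (4 * k)\<close> the indicator of an interval of length of order \<open>1 / N\<close> modulo 1 is
  replaced, up to a negligible error, by a trigonometric polynomial of degree of order
  \<open>D = s ^ (4 * k + 1)\<close>, obtained by convolution with a high power of a Fejer kernel. The variance in
  \<open>\<alpha>\<close> of the resulting correlation sum is controlled by the number of relations
  \<open>\<Sum>i. g i * a (z i) = 0\<close> among \<open>2 * k\<close> terms whose coefficients \<open>g i\<close> are bounded by a multiple of
  \<open>D\<close> and sum to zero over each half. In decreasing order of the \<open>z i\<close>, either the next index is close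
  to the current one, or the current coefficient is determined by the earlier ones, since all later
  terms are too small to matter. The two sum conditions save one further factor, so that the variance
  is at most of order \<open>1 / s\<^sup>2\<close>, and the Borel-Cantelli argument gives convergence for almost every
  \<open>\<alpha>\<close> and all boxes with rational corners. Monotonicity in the box and in \<open>N\<close> passes to all \<open>N\<close>, as
  consecutive terms of the subsequence have ratio tending to 1, and step functions pass to test
  functions.
\<close>

section \<open>Counting solutions of lacunary linear relations\<close>

text \<open>The exponents come from one balance. The coefficients in the variance have size of order
  \<open>1 / N ^ k\<close>, so the number of relations must stay below \<open>N ^ (2 * k)\<close>.
  One step of the descending enumeration costs about \<open>D * G\<close>, where \<open>G\<close> is
  the gap that separates close from far arguments; \<open>G = s\<close> suffices, since
  \<open>\<rho> ^ s\<close> outgrows every power of \<open>s\<close>. As \<open>D\<close> is of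
  order \<open>N * s\<close>, a count with all \<open>2 * k\<close> factors would have order
  \<open>(N * s ^ 2) ^ (2 * k)\<close>, which is too large: the saving of one full factor is
  indispensable. With \<open>2 * k - 1\<close> factors the quotient is
  \<open>s ^ (4 * k - 2) / N\<close>, and \<open>4 * k\<close> is the least exponent of
  \<open>N\<close> that makes it as small as \<open>1 / s ^ 2\<close>. The extra \<open>s\<close> in
  \<open>D\<close> is the price of smoothing. Its error is incurred at each of up to
  \<open>N ^ k\<close> tuples, without any averaging, so it has to beat a power of \<open>N\<close>.
  A kernel concentrated at scale \<open>1 / (s * N)\<close> gains only powers of \<open>s\<close>; a
  power of the Fejer kernel with exponent of order \<open>k ^ 2\<close> gains enough of them, a
  single Fejer kernel does not.\<close>

locale lacunary_tail =
  fixes a :: "nat \<Rightarrow> int" and x0 :: nat and \<rho> :: real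
  assumes rho: "\<rho> > 1"
    and step: "\<And>x. x \<ge> x0 \<Longrightarrow> \<rho> * \<bar>real_of_int (a x)\<bar> \<le> \<bar>real_of_int (a (Suc x))\<bar>"
    and nonzero: "\<And>x. x \<ge> x0 \<Longrightarrow> a x \<noteq> 0"
begin

abbreviation mag :: "nat \<Rightarrow> real" where
  "mag x \<equiv> \<bar>real_of_int (a x)\<bar>"

lemma growth: "x \<ge> x0 \<Longrightarrow> \<rho> ^ d * mag x \<le> mag (x + d)"
proof (induction d)
  case (Suc d)
  have "\<rho> ^ Suc d * mag x = \<rho> * (\<rho> ^ d * mag x)" by simp
  also have "\<dots> \<le> \<rho> * mag (x + d)"
    using Suc rho by (intro mult_left_mono) auto
  also have "\<dots> \<le> mag (x + Suc d)" using step[of "x + d"] Suc.prems by simp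
  finally show ?case .
qed simp

lemma abs_pos: "x \<ge> x0 \<Longrightarrow> mag x > 0"
  using nonzero by simp

lemma abs_mono: "x0 \<le> x \<Longrightarrow> x \<le> y \<Longrightarrow> mag x \<le> mag y"
proof -
  assume *: "x0 \<le> x" "x \<le> y"
  have "1 * mag x \<le> \<rho> ^ (y - x) * mag x"
    using rho by (intro mult_right_mono one_le_power) auto
  also have "\<dots> \<le> mag y" using growth[of x "y - x"] * by simp
  finally show ?thesis by simp
qed

lemma values_distinct: assumes "x0 \<le> x" "x < y" shows "a x \<noteq> a y"
proof -
  have "1 * mag x < \<rho> * mag x"
    using rho abs_pos[OF assms(1)] by (intro mult_strict_right_mono) auto
  also have "\<dots> \<le> mag (Suc x)" using step assms by simp
  also have "\<dots> \<le> mag y" using abs_mono[of "Suc x" y] assms by simp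
  finally show ?thesis by auto
qed

end

text \<open>\<open>grp\<close> separates the two halves of the index set, one for each of the two
  tuples compared in the variance. The factor 4 in the gap condition makes up to
  \<open>card I\<close> terms with coefficients at most \<open>B\<close> and arguments more than
  \<open>G\<close> below \<open>z\<close> together smaller than a quarter of
  \<open>mag z\<close>.\<close>

locale counting = lacunary_tail +
  fixes I :: "nat set" and grp :: "nat \<Rightarrow> bool" and N B G :: nat
  assumes finite_index: "finite I" and index_nonempty: "I \<noteq> {}"
    and NB: "1 \<le> N" "N \<le> B"
    and gap: "\<rho> ^ G > 4 * real (card I) * real B"
begin

text \<open>A list of triples (index, argument, coefficient) in decreasing order of the arguments;
  \<open>S\<close>, \<open>T\<close>, \<open>F\<close> carry the parts of the relation and of the two sum conditions that are already fixed.\<close>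

fun solution :: "int \<Rightarrow> int \<Rightarrow> int \<Rightarrow> (nat \<times> nat \<times> int) list \<Rightarrow> bool" where
  "solution S T F [] \<longleftrightarrow> S = 0 \<and> T = 0 \<and> F = 0"
| "solution S T F ((i, z, g) # l) \<longleftrightarrow> i \<in> I \<and> x0 < z \<and> z \<le> N \<and> g \<noteq> 0 \<and> \<bar>g\<bar> \<le> int B \<and>
     (\<forall>(i', z', g') \<in> set l. z' \<le> z \<and> (grp i = grp i' \<longrightarrow> z' < z)) \<and>
     solution (S + g * a z) (if grp i then T + g else T) (if grp i then F else F + g) l"

lemma card_index: "card I \<ge> 1" using finite_index index_nonempty by (simp add: Suc_leI card_gt_0_iff)

text \<open>The fixed part \<open>S\<close> has to be cancelled by the remaining terms, so it cannot
  exceed their total size. This pins down a coefficient once all later arguments are small.\<close>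

lemma solution_bound:
  assumes "solution S T F l" "\<And>i z g. (i, z, g) \<in> set l \<Longrightarrow> z \<le> y" "x0 \<le> y"
  shows "\<bar>real_of_int S\<bar> \<le> real (length l) * real B * mag y"
  using assms(1,2)
proof (induction l arbitrary: S T F)
  case (Cons e l)
  obtain i z g where e: "e = (i, z, g)" by (cases e)
  have z: "z \<le> y" "x0 < z" and g: "\<bar>g\<bar> \<le> int B" using Cons.prems e by auto
  have *: "solution (S + g * a z) (if grp i then T + g else T) (if grp i then F else F + g) l"
    using Cons.prems(1) e by simp
  have 1: "\<bar>real_of_int (S + g * a z)\<bar> \<le> real (length l) * real B * mag y"
    by (rule Cons.IH[OF *]) (use Cons.prems(2) in auto)
  have g': "\<bar>real_of_int g\<bar> \<le> real B" using g by linarith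
  have "\<bar>real_of_int (g * a z)\<bar> = \<bar>real_of_int g\<bar> * mag z" by (simp add: abs_mult)
  also have "\<dots> \<le> real B * mag y"
    using g' abs_mono[of z y] z by (intro mult_mono) auto
  finally have 2: "\<bar>real_of_int (g * a z)\<bar> \<le> real B * mag y" .
  have "\<bar>real_of_int S\<bar> \<le> \<bar>real_of_int (S + g * a z)\<bar> + \<bar>real_of_int (g * a z)\<bar>" by simp
  also have "\<dots> \<le> real (length (e # l)) * real B * mag y"
    using 1 2 by (simp add: algebra_simps)
  finally show ?case .
qed simp

text \<open>The head is fixed up to its coefficient. The recursion then pays in one step for this
  coefficient and the next argument together, and these two costs trade against each other.\<close>

definition solutions_from :: "nat \<Rightarrow> nat \<Rightarrow> nat \<Rightarrow> int \<Rightarrow> int \<Rightarrow> int \<Rightarrow> (nat \<times> nat \<times> int) list set" where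
  "solutions_from m i z S T F = {l. length l = m \<and> solution S T F l \<and> (\<exists>g l'. l = (i, z, g) # l')}"

definition solutions :: "nat \<Rightarrow> int \<Rightarrow> int \<Rightarrow> int \<Rightarrow> (nat \<times> nat \<times> int) list set" where
  "solutions m S T F = {l. length l = m \<and> solution S T F l}"

lemma solution_set: "solution S T F l \<Longrightarrow> set l \<subseteq> I \<times> {1..N} \<times> {- int B..int B}"
proof (induction S T F l rule: solution.induct)
  case (2 S T F i z g l)
  have "set l \<subseteq> I \<times> {1..N} \<times> {- int B..int B}"
    by (rule "2.IH") (use "2.prems" in simp)
  moreover have "i \<in> I" "z \<in> {1..N}" "g \<in> {- int B..int B}" using "2.prems" by auto
  ultimately show ?case by simp
qed simp

lemma finite_solutions: "finite (solutions m S T F)"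
proof -
  have "solutions m S T F \<subseteq> {l. set l \<subseteq> I \<times> {1..N} \<times> {- int B..int B} \<and> length l = m}"
    unfolding solutions_def using solution_set by blast
  moreover have "finite \<dots>" by (rule finite_lists_length_eq) (use finite_index in auto)
  ultimately show ?thesis by (rule finite_subset)
qed

lemma finite_solutions_from: "finite (solutions_from m i z S T F)"
  by (rule finite_subset[OF _ finite_solutions[of m S T F]]) (unfold solutions_from_def solutions_def, blast)

text \<open>If the next index is far below \<open>z\<close>, the leading coefficient is the nearest integer to
  \<open>- S / a z\<close>.\<close>

lemma far_unique:
  assumes "solution S T F ((i, z, g) # (i', z', g') # l)" "z' + G < z"
    and "solution S T' F' ((j, z, h) # (j', w', h') # l')" "w' + G < z"
    and len: "length l + 2 \<le> card I" "length l' + 2 \<le> card I"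
  shows "g = h"
proof -
  have z: "x0 < z" using assms by simp
  have small: "\<bar>real_of_int (S + g * a z)\<bar> < mag z / 4"
    if solution: "solution S T F ((i, z, g) # (i', z', g') # l)" and far: "z' + G < z"
      and len: "length l + 2 \<le> card I"
    for T F i i' g g' z' and l :: "(nat \<times> nat \<times> int) list"
  proof -
    have z': "x0 < z'" using solution by simp
    have solution': "solution (S + g * a z) (if grp i then T + g else T) (if grp i then F else F + g) ((i', z', g') # l)"
      using solution unfolding solution.simps(2)[of S T F i z g] by blast
    have "\<bar>real_of_int (S + g * a z)\<bar> \<le> real (length ((i', z', g') # l)) * real B * mag z'"
    proof (rule solution_bound[OF solution'])
      have "\<forall>(j, w, h) \<in> set l. w \<le> z'" using solution by auto
      thus "w \<le> z'" if "(j, w, h) \<in> set ((i', z', g') # l)" for j w h using that by auto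
      show "x0 \<le> z'" using z' by simp
    qed
    also have "\<dots> \<le> (real (card I) * real B) * mag z'"
      using len by (intro mult_right_mono) auto
    also have "\<dots> < (\<rho> ^ G / 4) * mag z'"
      using gap abs_pos[of z'] z' by (intro mult_strict_right_mono) auto
    also have "\<dots> = \<rho> ^ G * mag z' / 4" by simp
    also have "\<dots> \<le> mag (z' + G) / 4" using growth[of z' G] z' by simp
    also have "\<dots> \<le> mag z / 4" using abs_mono[of "z' + G" z] far z' by simp
    finally show ?thesis .
  qed
  \<comment> \<open>Either candidate brings the partial sum within \<open>mag z / 4\<close> of zero,
    so the two sums differ by a multiple of \<open>a z\<close> that is smaller than
    \<open>mag z\<close>.\<close>
  have "\<bar>real_of_int (S + g * a z) - real_of_int (S + h * a z)\<bar> < mag z"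
    using small[OF assms(1,2) len(1)] small[OF assms(3,4) len(2)] abs_pos[of z] z by linarith
  hence "\<bar>real_of_int (g - h)\<bar> * mag z < 1 * mag z"
    by (simp add: abs_mult[symmetric] algebra_simps)
  hence "\<bar>real_of_int (g - h)\<bar> < 1" by (rule mult_less_cancel_right_pos[THEN iffD1, rotated]) (use abs_pos z in auto)
  thus ?thesis by linarith
qed

lemma card_close:
  fixes Z :: "nat set"
  assumes "finite Z" "\<And>x y. x \<in> Z \<Longrightarrow> y \<in> Z \<Longrightarrow> x \<le> y + G"
  shows "card Z \<le> G + 1"
proof (cases "Z = {}")
  case False
  have "Z \<subseteq> {Min Z..Min Z + G}" using assms(1) assms(2)[OF _ Min_in[OF assms(1) False]] by auto
  hence "card Z \<le> card {Min Z..Min Z + G}" by (intro card_mono) auto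
  thus ?thesis by simp
qed simp

text \<open>The last two entries give the extra saving. If the arguments are close, both coefficients follow
  from the relation and the sum conditions. If they are far apart, the first coefficient is determined
  by size, and then the last term has a prescribed size, which leaves few last arguments.\<close>

lemma solutions_from_two:
  assumes "2 \<le> card I"
  shows "card (solutions_from 2 i z S T F) \<le> 2 * card I * (G + 1)"
proof -
  define near where "near = {l \<in> solutions_from 2 i z S T F. \<exists>g i' z' g'. l = [(i, z, g), (i', z', g')] \<and> z \<le> z' + G}"
  define far where "far = {l \<in> solutions_from 2 i z S T F. \<exists>g i' z' g'. l = [(i, z, g), (i', z', g')] \<and> z' + G < z}"
  \<comment> \<open>Only the index and the argument of the second entry are recorded; on each of the
    two parts they determine both coefficients.\<close>
  define snd2 where "snd2 = (\<lambda>l :: (nat \<times> nat \<times> int) list. (fst (l ! 1), fst (snd (l ! 1))))"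
  have fin: "finite near" "finite far" unfolding near_def far_def using finite_solutions_from by auto
  have "l \<in> near \<union> far" if "l \<in> solutions_from 2 i z S T F" for l
  proof -
    from that obtain g l' where l: "l = (i, z, g) # l'" "length l' = 1" by (auto simp: solutions_from_def)
    then obtain e where "l' = [e]" by (cases l') auto
    then obtain i' z' g' where "l = [(i, z, g), (i', z', g')]" using l by (cases e) auto
    thus ?thesis using that unfolding near_def far_def by (cases "z \<le> z' + G") auto
  qed
  hence solutions_from: "solutions_from 2 i z S T F = near \<union> far" unfolding near_def far_def by blast
  have "inj_on snd2 near"
  proof (rule inj_onI)
    fix l l' assume l: "l \<in> near" "l' \<in> near" and eq: "snd2 l = snd2 l'"
    obtain g i' z' g' where 1: "l = [(i, z, g), (i', z', g')]" using l unfolding near_def by blast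
    obtain h j' w' h' where 2: "l' = [(i, z, h), (j', w', h')]" using l unfolding near_def by blast
    have e: "j' = i'" "w' = z'" using eq 1 2 by (auto simp: snd2_def)
    have solution: "solution S T F [(i, z, g), (i', z', g')]" "solution S T F [(i, z, h), (i', z', h')]"
      using l 1 2 e by (auto simp: near_def solutions_from_def)
    have "g = h \<and> g' = h'"
    \<comment> \<open>In the same half, the sum condition and the relation form a linear system
      whose determinant is a difference of two distinct values of \<open>a\<close>. In different
      halves, each sum condition contains just one of the two coefficients.\<close>
    proof (cases "grp i = grp i'")
      case True
      hence "z' < z" "x0 < z'" using solution by auto
      hence ne: "a z \<noteq> a z'" using values_distinct[of z' z] by auto
      have s: "g + g' = h + h'" using solution True by (auto split: if_splits)
      have "g * a z + g' * a z' = h * a z + h' * a z'" using solution by (auto split: if_splits)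
      hence "(g - h) * a z = (h' - g') * a z'" by (simp add: algebra_simps)
      moreover have "h' - g' = g - h" using s by simp
      ultimately have "(g - h) * (a z - a z') = 0" by (simp add: algebra_simps)
      thus ?thesis using ne s by auto
    next
      case False
      thus ?thesis using solution by (auto split: if_splits)
    qed
    thus "l = l'" using 1 2 e by simp
  qed
  hence "card near = card (snd2 ` near)" by (simp add: card_image)
  also have "\<dots> \<le> card (I \<times> {z - G..z})"
    by (rule card_mono) (use finite_index in \<open>auto simp: near_def snd2_def solutions_from_def\<close>)
  also have "\<dots> \<le> card I * (G + 1)"
    unfolding card_cartesian_product by (intro mult_left_mono) auto
  finally have c1: "card near \<le> card I * (G + 1)" .
  define Z where "Z = (snd \<circ> snd2) ` far"
  have finZ: "finite Z" unfolding Z_def using fin by simp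
  have key: "z1 \<le> z2 + G \<and> g1 = g2 \<and> (z1 = z2 \<longrightarrow> h1 = h2)"
    if l: "[(i, z, g1), (i1, z1, h1)] \<in> far" "[(i, z, g2), (i2, z2, h2)] \<in> far"
    for g1 g2 i1 i2 z1 z2 h1 h2
  proof -
    have solution: "solution S T F [(i, z, g1), (i1, z1, h1)]" "solution S T F [(i, z, g2), (i2, z2, h2)]"
      and f: "z1 + G < z" "z2 + G < z"
      using l by (auto simp: far_def solutions_from_def)
    have g: "g1 = g2" by (rule far_unique[OF solution(1) f(1) solution(2) f(2)]) (use assms in auto)
    have z12: "x0 < z1" "x0 < z2" and h: "h1 \<noteq> 0" "\<bar>h2\<bar> \<le> int B" using solution by (auto split: if_splits)
    have eq: "h1 * a z1 = h2 * a z2" using solution g by (auto split: if_splits)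
    \<comment> \<open>Both last terms cancel the same number. Their coefficients have absolute value
      between 1 and \<open>B\<close>, and \<open>B < \<rho> ^ G\<close>, so growth forbids arguments
      more than \<open>G\<close> apart.\<close>
    have "z1 \<le> z2 + G"
    proof (rule ccontr)
      assume "\<not> z1 \<le> z2 + G"
      hence "\<rho> ^ G * mag z2 \<le> mag z1"
        using growth[of z2 G] abs_mono[of "z2 + G" z1] z12 by simp
      also have "\<dots> = 1 * mag z1" by simp
      also have "\<dots> \<le> \<bar>real_of_int h1\<bar> * mag z1"
        using h by (intro mult_right_mono) auto
      also have "\<dots> = \<bar>real_of_int h2\<bar> * mag z2"
        using eq by (metis abs_mult of_int_mult)
      finally have "\<rho> ^ G \<le> \<bar>real_of_int h2\<bar>"
        using abs_pos[of z2] z12 by simp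
      also have "\<dots> \<le> real B" using h by linarith
      also have "\<dots> \<le> (4 * real (card I)) * real B"
        using card_index mult_right_mono[of 1 "4 * real (card I)" "real B"] by simp
      finally show False using gap by simp
    qed
    moreover have "z1 = z2 \<longrightarrow> h1 = h2" using eq nonzero[of z2] z12 by auto
    ultimately show ?thesis using g by simp
  qed
  have shape: "\<exists>g i' z' g'. l = [(i, z, g), (i', z', g')]" if "l \<in> far" for l
    using that unfolding far_def by blast
  have "card Z \<le> G + 1"
  proof (rule card_close[OF finZ])
    fix x y assume "x \<in> Z" "y \<in> Z"
    then obtain l1 l2 where l: "l1 \<in> far" "l2 \<in> far" "x = snd (snd2 l1)" "y = snd (snd2 l2)"
      unfolding Z_def by auto
    obtain g1 i1 z1 h1 where 1: "l1 = [(i, z, g1), (i1, z1, h1)]" using shape[OF l(1)] by blast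
    obtain g2 i2 z2 h2 where 2: "l2 = [(i, z, g2), (i2, z2, h2)]" using shape[OF l(2)] by blast
    show "x \<le> y + G" using key[of g1 i1 z1 h1 g2 i2 z2 h2] l 1 2 by (simp add: snd2_def)
  qed
  have "inj_on snd2 far"
  proof (rule inj_onI)
    fix l l' assume l: "l \<in> far" "l' \<in> far" and eq: "snd2 l = snd2 l'"
    obtain g1 i1 z1 h1 where 1: "l = [(i, z, g1), (i1, z1, h1)]" using shape[OF l(1)] by blast
    obtain g2 i2 z2 h2 where 2: "l' = [(i, z, g2), (i2, z2, h2)]" using shape[OF l(2)] by blast
    show "l = l'" using key[of g1 i1 z1 h1 g2 i2 z2 h2] l 1 2 eq by (simp add: snd2_def)
  qed
  hence "card far = card (snd2 ` far)" by (simp add: card_image)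
  also have "\<dots> \<le> card (I \<times> Z)"
  proof (rule card_mono)
    show "finite (I \<times> Z)" using finite_index finZ by simp
    show "snd2 ` far \<subseteq> I \<times> Z"
    proof
      fix p assume "p \<in> snd2 ` far"
      then obtain l where l: "l \<in> far" "p = snd2 l" by auto
      obtain g1 i1 z1 h1 where 1: "l = [(i, z, g1), (i1, z1, h1)]" using shape[OF l(1)] by blast
      have "i1 \<in> I" using l 1 by (auto simp: far_def solutions_from_def)
      moreover have "z1 \<in> Z" unfolding Z_def using l 1 by (force simp: snd2_def)
      ultimately show "p \<in> I \<times> Z" using l 1 by (simp add: snd2_def)
    qed
  qed
  also have "\<dots> \<le> card I * (G + 1)"
    unfolding card_cartesian_product using \<open>card Z \<le> G + 1\<close> by (rule mult_left_mono) simp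
  finally have c2: "card far \<le> card I * (G + 1)" .
  show ?thesis using card_Un_le[of near far] c1 c2 solutions_from by simp
qed

text \<open>A close next argument leaves \<open>G + 1\<close> positions and a free leading
  coefficient; a far one has up to \<open>N\<close> positions but only one possible leading
  coefficient. A step therefore costs of order \<open>B * G\<close> instead of \<open>N * B\<close>,
  the far alternative being absorbed through \<open>N \<le> B\<close>.\<close>

lemma solutions_from_step:
  assumes bd: "\<And>i z S T F. card (solutions_from m i z S T F) \<le> C" and m: "m \<ge> 1" "Suc m \<le> card I"
  shows "card (solutions_from (Suc m) i z S T F) \<le> (4 * B * (G + 1) * card I) * C"
proof -
  let ?near = "{- int B..int B} \<times> I \<times> {z - G..z}" and ?all = "I \<times> {1..N}"
  define V where "V = (\<lambda>i' z' g. (#) (i, z, g) ` solutions_from m i' z' (S + g * a z)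
     (if grp i then T + g else T) (if grp i then F else F + g))"
  define far where "far = {l \<in> solutions_from (Suc m) i z S T F. \<exists>g i' z' g' r. l = (i, z, g) # (i', z', g') # r \<and> z' + G < z}"
  \<comment> \<open>The common leading coefficient of all far solutions, which by
    \<open>far_unique\<close> depends only on the head and the carried sums; arbitrary if there is
    no far solution.\<close>
  define g0 where "g0 = (SOME g. \<exists>i' z' g' r. (i, z, g) # (i', z', g') # r \<in> far)"
  have cV: "card (V i' z' g) \<le> C" and fV: "finite (V i' z' g)" for i' z' g
  proof -
    show "finite (V i' z' g)" unfolding V_def using finite_solutions_from by simp
    show "card (V i' z' g) \<le> C" unfolding V_def by (rule order_trans[OF card_image_le[OF finite_solutions_from] bd])
  qed
  have sub: "solutions_from (Suc m) i z S T F \<subseteq>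
     (\<Union>(g, i', z') \<in> ?near. V i' z' g) \<union>
     (\<Union>(i', z') \<in> ?all. V i' z' g0)"
  proof
    fix l assume l: "l \<in> solutions_from (Suc m) i z S T F"
    then obtain g l' where 1: "l = (i, z, g) # l'" "length l' = m" by (auto simp: solutions_from_def)
    then obtain i' z' g' r where l': "l' = (i', z', g') # r" using m by (cases l') auto
    have solution: "solution S T F ((i, z, g) # (i', z', g') # r)" using l 1 l' by (simp add: solutions_from_def)
    have lV: "l \<in> V i' z' g" using l 1 l' by (auto simp: V_def solutions_from_def simp del: solution.simps(2) simp: solution.simps(2)[of _ _ _ i])
    have i': "i' \<in> I" "z' \<in> {1..N}" "z' \<le> z" "g \<in> {- int B..int B}" using solution by auto
    show "l \<in> (\<Union>(g, i', z') \<in> ?near. V i' z' g) \<union>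
     (\<Union>(i', z') \<in> ?all. V i' z' g0)"
    proof (cases "z' + G < z")
      case False
      thus ?thesis using lV i' by (intro UnI1) force
    next
      case True
      have "l \<in> far" using l 1 l' True unfolding far_def by blast
      hence ex: "\<exists>g i' z' g' r. (i, z, g) # (i', z', g') # r \<in> far" using 1 l' by blast
      have "\<exists>i' z' g' r. (i, z, g0) # (i', z', g') # r \<in> far"
        unfolding g0_def by (rule someI_ex[OF ex])
      then obtain j' w' h' r' where f0: "(i, z, g0) # (j', w', h') # r' \<in> far" by blast
      hence 0: "solution S T F ((i, z, g0) # (j', w', h') # r')" "w' + G < z" "length r' + 2 = Suc m"
        unfolding far_def solutions_from_def by auto
      have "g = g0" by (rule far_unique[OF solution True 0(1,2)]) (use 0 1 l' m in auto)
      thus ?thesis using lV i' by (intro UnI2) force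
    qed
  qed
  have "card (solutions_from (Suc m) i z S T F) \<le> card ((\<Union>(g, i', z') \<in> ?near. V i' z' g) \<union>
     (\<Union>(i', z') \<in> ?all. V i' z' g0))"
    by (rule card_mono[OF _ sub]) (use finite_index fV in auto)
  also have "\<dots> \<le> card (\<Union>(g, i', z') \<in> ?near. V i' z' g) +
     card (\<Union>(i', z') \<in> ?all. V i' z' g0)" by (rule card_Un_le)
  also have "\<dots> \<le> card (?near) * C + card (?all) * C"
  proof (rule add_mono)
    have "card (\<Union>p \<in> ?near. case p of (g, i', z') \<Rightarrow> V i' z' g)
      \<le> (\<Sum>p \<in> ?near. card (case p of (g, i', z') \<Rightarrow> V i' z' g))"
      by (rule card_UN_le) (use finite_index in auto)
    also have "\<dots> \<le> (\<Sum>p \<in> ?near. C)"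
      by (rule sum_mono) (use cV in auto)
    finally show "card (\<Union>(g, i', z') \<in> ?near. V i' z' g) \<le> card (?near) * C" by simp
    have "card (\<Union>p \<in> ?all. case p of (i', z') \<Rightarrow> V i' z' g0)
      \<le> (\<Sum>p \<in> ?all. card (case p of (i', z') \<Rightarrow> V i' z' g0))"
      by (rule card_UN_le) (use finite_index in auto)
    also have "\<dots> \<le> (\<Sum>p \<in> ?all. C)"
      by (rule sum_mono) (use cV in auto)
    finally show "card (\<Union>(i', z') \<in> ?all. V i' z' g0) \<le> card (?all) * C" by simp
  qed
  also have "\<dots> = (card {- int B..int B} * (card I * card {z - G..z}) + card I * N) * C"
    by (simp add: card_cartesian_product algebra_simps)
  also have "\<dots> \<le> (4 * B * (G + 1) * card I) * C"
  proof (rule mult_right_mono)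
    have "card {- int B..int B} \<le> 3 * B" using NB by simp
    hence "card {- int B..int B} * (card I * card {z - G..z}) \<le> 3 * B * (card I * (G + 1))"
      by (intro mult_mono) auto
    moreover have "card I * N \<le> card I * (B * (G + 1))" using NB by (intro mult_left_mono) (auto intro: order_trans)
    ultimately show "card {- int B..int B} * (card I * card {z - G..z}) + card I * N \<le> 4 * B * (G + 1) * card I"
      by (simp add: algebra_simps)
  qed simp
  finally show ?thesis .
qed

lemma card_solutions_from:
  assumes "m + 2 \<le> card I"
  shows "card (solutions_from (m + 2) i z S T F) \<le> (4 * B * (G + 1) * card I) ^ m * (2 * card I * (G + 1))"
  using assms
proof (induction m arbitrary: i z S T F)
  case 0
  thus ?case using solutions_from_two[of i z S T F] by (simp add: numeral_2_eq_2)
next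
  case (Suc m)
  have "card (solutions_from (Suc (m + 2)) i z S T F)
    \<le> (4 * B * (G + 1) * card I) * ((4 * B * (G + 1) * card I) ^ m * (2 * card I * (G + 1)))"
    by (rule solutions_from_step) (use Suc in auto)
  thus ?case by (simp add: mult.assoc)
qed

text \<open>The exponent is \<open>m - 1\<close> and not \<open>m\<close>: the first argument costs
  \<open>N \<le> B\<close>, each of the \<open>m - 2\<close> recursive steps one full factor, and
  the final pair no power of \<open>B\<close>. For \<open>m = 1\<close> a sum condition gives the
  coefficient and the relation then gives the argument.\<close>

lemma card_solutions:
  assumes "1 \<le> m" "m \<le> card I"
  shows "card (solutions m S T F) \<le> card I * (4 * B * (G + 1) * card I) ^ (m - 1)"
proof (cases "m = 1")
  case True
  have shape: "\<exists>i z g. l = [(i, z, g)]" if "l \<in> solutions m S T F" for l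
    using that True by (cases l) (auto simp: solutions_def)
  have "inj_on (\<lambda>l. fst (hd l)) (solutions m S T F)"
  proof (rule inj_onI)
    fix l l' assume l: "l \<in> solutions m S T F" "l' \<in> solutions m S T F" and eq: "fst (hd l) = fst (hd l')"
    obtain i z g where 1: "l = [(i, z, g)]" using shape[OF l(1)] by blast
    obtain i' z' g' where 2: "l' = [(i', z', g')]" using shape[OF l(2)] by blast
    have solution: "solution S T F [(i, z, g)]" "solution S T F [(i, z', g')]" using l 1 2 eq by (auto simp: solutions_def)
    have g: "g = g'" and z: "x0 < z" "x0 < z'" and g0: "g \<noteq> 0" using solution by (auto split: if_splits)
    have "S + g * a z = 0" "S + g * a z' = 0" using solution g by simp_all
    hence "g * a z = g * a z'" by linarith
    hence "z = z'" using g0 values_distinct[of z z'] values_distinct[of z' z] z by (cases z z' rule: linorder_cases) auto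
    thus "l = l'" using 1 2 g eq by simp
  qed
  hence "card (solutions m S T F) = card ((\<lambda>l. fst (hd l)) ` solutions m S T F)" by (simp add: card_image)
  also have "\<dots> \<le> card I"
  proof (rule card_mono[OF finite_index], rule image_subsetI)
    fix l assume l: "l \<in> solutions m S T F"
    obtain i z g where "l = [(i, z, g)]" using shape[OF l] by blast
    thus "fst (hd l) \<in> I" using l by (auto simp: solutions_def)
  qed
  finally show ?thesis using True by simp
next
  case False
  define m' where "m' = m - 2"
  have m': "m = m' + 2" using False assms by (simp add: m'_def)
  have "solutions m S T F \<subseteq> (\<Union>(i, z) \<in> I \<times> {1..N}. solutions_from m i z S T F)"
  proof
    fix l assume l: "l \<in> solutions m S T F"
    then obtain e l' where "l = e # l'" using assms by (cases l) (auto simp: solutions_def)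
    then obtain i z g where 1: "l = (i, z, g) # l'" by (cases e) auto
    have "i \<in> I" "z \<in> {1..N}" using l 1 by (auto simp: solutions_def)
    moreover have "l \<in> solutions_from m i z S T F" using l 1 by (auto simp: solutions_def solutions_from_def)
    ultimately show "l \<in> (\<Union>(i, z) \<in> I \<times> {1..N}. solutions_from m i z S T F)" by force
  qed
  hence "card (solutions m S T F) \<le> card (\<Union>p \<in> I \<times> {1..N}. case p of (i, z) \<Rightarrow> solutions_from m i z S T F)"
    by (intro card_mono) (use finite_index finite_solutions_from in auto)
  also have "\<dots> \<le> (\<Sum>p \<in> I \<times> {1..N}. card (case p of (i, z) \<Rightarrow> solutions_from m i z S T F))"
    by (rule card_UN_le) (use finite_index in auto)
  also have "\<dots> \<le> (\<Sum>p \<in> I \<times> {1..N}. (4 * B * (G + 1) * card I) ^ m' * (2 * card I * (G + 1)))"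
    by (rule sum_mono) (use card_solutions_from[of m'] m' assms in auto)
  also have "\<dots> = card I * (4 * B * (G + 1) * card I) ^ m' * (N * (2 * card I * (G + 1)))"
    by (simp add: card_cartesian_product algebra_simps)
  also have "\<dots> \<le> card I * (4 * B * (G + 1) * card I) ^ m' * (4 * B * (G + 1) * card I)"
  proof (rule mult_left_mono)
    have "N * (2 * card I * (G + 1)) \<le> (2 * B) * (2 * card I * (G + 1))"
      using NB by (intro mult_right_mono) auto
    thus "N * (2 * card I * (G + 1)) \<le> 4 * B * (G + 1) * card I" by (simp add: algebra_simps)
  qed simp
  also have "\<dots> = card I * (4 * B * (G + 1) * card I) ^ (m - 1)" using m' by simp
  finally show ?thesis .
qed


section \<open>From ordered lists to relations indexed by \<open>I\<close>\<close>

lemma solutionI: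
  assumes "distinct (map fst l)" "sorted_wrt (\<lambda>e e'. fst (snd e') \<le> fst (snd e)) l"
    and "\<And>i z g. (i, z, g) \<in> set l \<Longrightarrow> i \<in> I \<and> x0 < z \<and> z \<le> N \<and> g \<noteq> 0 \<and> \<bar>g\<bar> \<le> int B"
    and "\<And>i z g i' z' g'. (i, z, g) \<in> set l \<Longrightarrow> (i', z', g') \<in> set l \<Longrightarrow> i \<noteq> i' \<Longrightarrow> grp i = grp i' \<Longrightarrow> z \<noteq> z'"
    and "S + (\<Sum>(i, z, g)\<leftarrow>l. g * a z) = 0"
    and "T + (\<Sum>(i, z, g)\<leftarrow>l. if grp i then g else 0) = 0"
    and "F + (\<Sum>(i, z, g)\<leftarrow>l. if grp i then 0 else g) = 0"
  shows "solution S T F l"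
  using assms
proof (induction l arbitrary: S T F)
  case (Cons e l)
  obtain i z g where e: "e = (i, z, g)" by (cases e)
  have "solution (S + g * a z) (if grp i then T + g else T) (if grp i then F else F + g) l"
  proof (rule Cons.IH)
    show "i' \<in> I \<and> x0 < z' \<and> z' \<le> N \<and> g' \<noteq> 0 \<and> \<bar>g'\<bar> \<le> int B" if "(i', z', g') \<in> set l" for i' z' g'
      by (rule Cons.prems(3)) (use that in simp)
    show "z \<noteq> z'" if "(i, z, g) \<in> set l" "(i', z', g') \<in> set l" "i \<noteq> i'" "grp i = grp i'" for i z g i' z' g'
      by (rule Cons.prems(4)[of i z g i' z' g']) (use that in simp_all)
    show "distinct (map fst l)" "sorted_wrt (\<lambda>e e'. fst (snd e') \<le> fst (snd e)) l"
      using Cons.prems(1,2) by auto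
  qed (use Cons.prems(5-7) e in \<open>simp_all add: add.assoc split: if_splits\<close>)
  moreover have "z' \<le> z \<and> (grp i = grp i' \<longrightarrow> z' < z)" if "(i', z', g') \<in> set l" for i' z' g'
  proof -
    have "z' \<le> z" using Cons.prems(2) that e by auto
    moreover have "i' \<noteq> i" using Cons.prems(1) that e by force
    moreover have "i \<noteq> i' \<Longrightarrow> grp i = grp i' \<Longrightarrow> z \<noteq> z'"
      by (rule Cons.prems(4)[of i z g i' z' g']) (use that e in simp_all)
    ultimately show ?thesis by force
  qed
  moreover have "i \<in> I \<and> x0 < z \<and> z \<le> N \<and> g \<noteq> 0 \<and> \<bar>g\<bar> \<le> int B"
    by (rule Cons.prems(3)) (simp add: e)
  ultimately show ?case unfolding e solution.simps(2) by blast
qed simp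

text \<open>In contrast to \<open>solution\<close>, single coefficients may vanish and arguments may
  lie below the lacunary range. Arguments may coincide across the two halves, because the two tuples
  are independent of each other.\<close>

definition relations :: "(nat \<Rightarrow> nat \<times> int) set" where
  "relations = {w \<in> I \<rightarrow>\<^sub>E {1..N} \<times> {- int B..int B}.
     (\<forall>i\<in>I. \<forall>j\<in>I. i \<noteq> j \<longrightarrow> grp i = grp j \<longrightarrow> fst (w i) \<noteq> fst (w j)) \<and>
     (\<Sum>i\<in>I. snd (w i) * a (fst (w i))) = 0 \<and>
     (\<Sum>i\<in>I. if grp i then snd (w i) else 0) = 0 \<and>
     (\<Sum>i\<in>I. if grp i then 0 else snd (w i)) = 0 \<and>
     (\<exists>i\<in>I. snd (w i) \<noteq> 0)}"

lemma finite_relations: "finite relations"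
proof (rule finite_subset)
  show "relations \<subseteq> I \<rightarrow>\<^sub>E {1..N} \<times> {- int B..int B}" unfolding relations_def by blast
  show "finite (I \<rightarrow>\<^sub>E {1..N} \<times> {- int B..int B})" using finite_index by (intro finite_PiE) auto
qed

text \<open>Indices with zero coefficient, or with an argument below the range where \<open>a\<close> is lacunary, are
  fixed first. They have only about \<open>N + x0 * B\<close> possible pairs, instead of \<open>N * B\<close>.\<close>

definition live :: "(nat \<Rightarrow> nat \<times> int) \<Rightarrow> nat set" where
  "live w = {i \<in> I. snd (w i) \<noteq> 0 \<and> x0 < fst (w i)}"

definition dead_pairs :: "(nat \<times> int) set" where
  "dead_pairs = {p \<in> {1..N} \<times> {- int B..int B}. snd p = 0 \<or> fst p \<le> x0}"

text \<open>A common price per index: it dominates both a step of the list recursion and the number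
  of pairs open to a dead index, so mixed configurations are bounded by one power.\<close>

definition branching :: nat where "branching = 4 * B * (G + 1) * card I * (x0 + 1)"

lemma finite_dead_pairs: "finite dead_pairs"
  by (rule finite_subset[of _ "{1..N} \<times> {- int B..int B}"]) (auto simp: dead_pairs_def)

lemma card_dead_pairs: "card dead_pairs \<le> branching"
proof -
  have "dead_pairs \<subseteq> {1..N} \<times> {0} \<union> {1..x0} \<times> {- int B..int B}"
    unfolding dead_pairs_def by auto
  hence "card dead_pairs \<le> card ({1..N} \<times> {0 :: int} \<union> {1..x0} \<times> {- int B..int B})"
    by (intro card_mono) auto
  also have "\<dots> \<le> card ({1..N} \<times> {0 :: int}) + card ({1..x0} \<times> {- int B..int B})"
    by (rule card_Un_le)
  also have "\<dots> = N + x0 * card {- int B..int B}" by (simp add: card_cartesian_product)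
  also have "\<dots> \<le> B + x0 * (3 * B)"
    by (intro add_mono mult_left_mono) (use NB in auto)
  also have "\<dots> \<le> 4 * B * (x0 + 1)" by simp
  also have "\<dots> \<le> 4 * B * (x0 + 1) * ((G + 1) * card I)" using card_index by simp
  also have "\<dots> = branching" by (simp add: branching_def algebra_simps)
  finally show ?thesis .
qed

text \<open>The dead entries are chosen freely and contribute constants to the three sums; the live
  ones, sorted by decreasing argument, then solve an inhomogeneous problem. This is why
  \<open>card_solutions\<close> has to be uniform in the carried sums.\<close>

lemma card_relations_live:
  assumes L: "L \<subseteq> I" "L \<noteq> {}"
  shows "card {w \<in> relations. live w = L} \<le> card I * branching ^ (card I - 1)"
proof -
  define m where "m = card L"
  have finL: "finite L" using L finite_index finite_subset by blast
  have m: "1 \<le> m" "m \<le> card I" unfolding m_def using L finL finite_index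
    by (auto simp: Suc_le_eq card_gt_0_iff intro: card_mono)
  define xs where "xs = (\<lambda>w :: nat \<Rightarrow> nat \<times> int. rev (sort_key (fst \<circ> w) (sorted_list_of_set L)))"
  define lst where "lst = (\<lambda>w :: nat \<Rightarrow> nat \<times> int. map (\<lambda>i. (i, w i)) (xs w))"
  define S T F where "S = (\<lambda>d :: nat \<Rightarrow> nat \<times> int. \<Sum>i\<in>I - L. snd (d i) * a (fst (d i)))"
    and "T = (\<lambda>d :: nat \<Rightarrow> nat \<times> int. \<Sum>i\<in>I - L. if grp i then snd (d i) else 0)"
    and "F = (\<lambda>d :: nat \<Rightarrow> nat \<times> int. \<Sum>i\<in>I - L. if grp i then 0 else snd (d i))"
  \<comment> \<open>Each list entry stores its index, so nothing is lost by sorting.\<close>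
  define code where "code = (\<lambda>w. (restrict w (I - L), lst w))"
  let ?X = "SIGMA d : (I - L) \<rightarrow>\<^sub>E dead_pairs. solutions m (S d) (T d) (F d)"
  have xs: "distinct (xs w)" "set (xs w) = L" for w unfolding xs_def using finL by auto
  have setl: "set (lst w) = (\<lambda>i. (i, w i)) ` L" for w unfolding lst_def using xs by simp
  have suml: "(\<Sum>e\<leftarrow>lst w. h e) = (\<Sum>i\<in>L. h (i, w i))" for w and h :: "nat \<times> nat \<times> int \<Rightarrow> int"
    unfolding lst_def using sum_list_distinct_conv_sum_set[OF xs(1)[of w]] xs(2)[of w] by (simp add: comp_def)
  have "inj_on code {w \<in> relations. live w = L}"
  proof (rule inj_onI)
    fix w w' assume w: "w \<in> {w \<in> relations. live w = L}" "w' \<in> {w \<in> relations. live w = L}" and eq: "code w = code w'"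
    have "w i = w' i" if "i \<in> I" for i
    proof (cases "i \<in> L")
      case True
      hence "(i, w i) \<in> set (lst w')" using eq setl[of w] by (auto simp: code_def)
      thus ?thesis using setl[of w'] by auto
    next
      case False
      have "restrict w (I - L) i = restrict w' (I - L) i" using eq by (simp add: code_def)
      thus ?thesis using False that by simp
    qed
    moreover have "w \<in> extensional I" "w' \<in> extensional I" using w by (auto simp: relations_def PiE_def)
    ultimately show "w = w'" by (intro extensionalityI)
  qed
  hence "card {w \<in> relations. live w = L} = card (code ` {w \<in> relations. live w = L})" by (simp add: card_image)
  also have "\<dots> \<le> card ?X"
  proof (rule card_mono)
    show "finite ?X" by (intro finite_SigmaI finite_PiE finite_solutions) (use finite_index finite_dead_pairs in auto)
    show "code ` {w \<in> relations. live w = L} \<subseteq> ?X"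
    proof (rule image_subsetI)
      fix w assume "w \<in> {w \<in> relations. live w = L}"
      hence w: "w \<in> relations" "live w = L" by auto
      have mem: "w i \<in> {1..N} \<times> {- int B..int B}" if "i \<in> I" for i
        using w(1) that by (auto simp: relations_def)
      have dead: "w i \<in> dead_pairs" if "i \<in> I - L" for i
        using w(2) mem[of i] that by (auto simp: dead_pairs_def live_def)
      have d: "restrict w (I - L) \<in> (I - L) \<rightarrow>\<^sub>E dead_pairs" using dead by auto
      have split: "(\<Sum>i\<in>I. h i) = (\<Sum>i\<in>I - L. h i) + (\<Sum>i\<in>L. h i)" for h :: "nat \<Rightarrow> int"
        using sum.subset_diff[OF L(1) finite_index] .
      have rs: "S (restrict w (I - L)) = S w" "T (restrict w (I - L)) = T w" "F (restrict w (I - L)) = F w"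
        unfolding S_def T_def F_def by (auto intro!: sum.cong)
      have S: "S (restrict w (I - L)) + (\<Sum>i\<in>L. snd (w i) * a (fst (w i))) = 0"
        using w(1) split[of "\<lambda>i. snd (w i) * a (fst (w i))"] unfolding rs by (simp add: relations_def S_def)
      have T: "T (restrict w (I - L)) + (\<Sum>i\<in>L. if grp i then snd (w i) else 0) = 0"
        using w(1) split[of "\<lambda>i. if grp i then snd (w i) else 0"] unfolding rs by (simp add: relations_def T_def)
      have F: "F (restrict w (I - L)) + (\<Sum>i\<in>L. if grp i then 0 else snd (w i)) = 0"
        using w(1) split[of "\<lambda>i. if grp i then 0 else snd (w i)"] unfolding rs by (simp add: relations_def F_def)
      have "solution (S (restrict w (I - L))) (T (restrict w (I - L))) (F (restrict w (I - L))) (lst w)"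
      proof (rule solutionI)
        show "distinct (map fst (lst w))" unfolding lst_def using xs by (simp add: comp_def)
        have "sorted (map (fst \<circ> w) (sort_key (fst \<circ> w) (sorted_list_of_set L)))" by (rule sorted_sort_key)
        hence "sorted_wrt (\<lambda>i j. fst (w i) \<le> fst (w j)) (rev (xs w))"
          unfolding xs_def by (simp add: sorted_map)
        hence "sorted_wrt (\<lambda>i j. fst (w j) \<le> fst (w i)) (xs w)" by (simp add: sorted_wrt_rev)
        thus "sorted_wrt (\<lambda>e e'. fst (snd e') \<le> fst (snd e)) (lst w)"
          unfolding lst_def by (simp add: sorted_wrt_map)
        show "i \<in> I \<and> x0 < z \<and> z \<le> N \<and> g \<noteq> 0 \<and> \<bar>g\<bar> \<le> int B" if "(i, z, g) \<in> set (lst w)" for i z g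
        proof -
          have i: "i \<in> L" "w i = (z, g)" using that setl[of w] by auto
          hence "i \<in> I" "snd (w i) \<noteq> 0" "x0 < fst (w i)" using w(2) by (auto simp: live_def)
          thus ?thesis using mem[of i] i by auto
        qed
        show "z \<noteq> z'" if "(i, z, g) \<in> set (lst w)" "(i', z', g') \<in> set (lst w)" "i \<noteq> i'" "grp i = grp i'"
          for i z g i' z' g'
        proof -
          have i: "i \<in> L" "w i = (z, g)" "i' \<in> L" "w i' = (z', g')" using that setl[of w] by auto
          have "\<forall>i\<in>I. \<forall>j\<in>I. i \<noteq> j \<longrightarrow> grp i = grp j \<longrightarrow> fst (w i) \<noteq> fst (w j)"
            using w(1) by (simp add: relations_def)
          hence "fst (w i) \<noteq> fst (w i')" using i(1,3) L(1) that(3,4) by blast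
          thus ?thesis using i by simp
        qed
      qed (use S T F suml[of _ w] in \<open>simp_all add: case_prod_beta\<close>)
      moreover have "length (lst w) = m" unfolding lst_def m_def using xs[of w] distinct_card[of "xs w"] by simp
      ultimately show "code w \<in> ?X" unfolding code_def solutions_def using d by simp
    qed
  qed
  also have "\<dots> = (\<Sum>d\<in>(I - L) \<rightarrow>\<^sub>E dead_pairs. card (solutions m (S d) (T d) (F d)))"
    by (subst card_SigmaI) (use finite_index finite_dead_pairs finite_solutions in \<open>auto intro!: finite_PiE\<close>)
  also have "\<dots> \<le> (\<Sum>d\<in>(I - L) \<rightarrow>\<^sub>E dead_pairs. card I * branching ^ (m - 1))"
  proof (rule sum_mono)
    fix d
    have "card (solutions m (S d) (T d) (F d)) \<le> card I * (4 * B * (G + 1) * card I) ^ (m - 1)"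
      by (rule card_solutions[OF m])
    also have "\<dots> \<le> card I * branching ^ (m - 1)"
      unfolding branching_def by (intro mult_left_mono power_mono) auto
    finally show "card (solutions m (S d) (T d) (F d)) \<le> card I * branching ^ (m - 1)" .
  qed
  also have "\<dots> = card dead_pairs ^ card (I - L) * (card I * branching ^ (m - 1))"
    using finite_index by (simp add: card_PiE)
  also have "\<dots> \<le> branching ^ card (I - L) * (card I * branching ^ (m - 1))"
    by (intro mult_right_mono power_mono card_dead_pairs) auto
  also have "\<dots> = card I * branching ^ (card (I - L) + (m - 1))" by (simp add: power_add)
  also have "card (I - L) + (m - 1) = card I - 1"
    using m L finite_index by (simp add: card_Diff_subset finL m_def)
  finally show ?thesis .
qed

text \<open>Without live indices, growth gives nothing. But a nonzero coefficient at a dead index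
  forces its argument into \<open>{1..x0}\<close>, and the sum condition of its half recovers this
  coefficient from the others, so a full factor is saved here as well.\<close>

lemma card_relations_dead: "card {w \<in> relations. live w = {}} \<le> card I * x0 * branching ^ (card I - 1)"
proof -
  define H where "H = (\<lambda>i. {w \<in> relations. live w = {} \<and> snd (w i) \<noteq> 0})"
  have Hi: "card (H i) \<le> x0 * branching ^ (card I - 1)" if i: "i \<in> I" for i
  proof -
    define code where "code = (\<lambda>w :: nat \<Rightarrow> nat \<times> int. (fst (w i), restrict w (I - {i})))"
    have "inj_on code (H i)"
    proof (rule inj_onI)
      fix w w' assume w: "w \<in> H i" "w' \<in> H i" and eq: "code w = code w'"
      have r: "w j = w' j" if "j \<in> I - {i}" for j
      proof -
        have "restrict w (I - {i}) j = restrict w' (I - {i}) j" using eq by (simp add: code_def)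
        thus ?thesis using that by simp
      qed
      have sp: "(\<Sum>j\<in>I. h j) = h i + (\<Sum>j\<in>I - {i}. h j)" for h :: "nat \<Rightarrow> int"
        by (rule sum.remove[OF finite_index i])
      have "snd (w i) = snd (w' i)"
      proof (cases "grp i")
        case True
        have "(\<Sum>j\<in>I - {i}. if grp j then snd (w j) else 0) = (\<Sum>j\<in>I - {i}. if grp j then snd (w' j) else 0)"
          by (rule sum.cong) (use r in auto)
        thus ?thesis using w True sp[of "\<lambda>i. if grp i then snd (w i) else 0"]
            sp[of "\<lambda>i. if grp i then snd (w' i) else 0"] by (simp add: H_def relations_def)
      next
        case False
        have "(\<Sum>j\<in>I - {i}. if grp j then 0 else snd (w j)) = (\<Sum>j\<in>I - {i}. if grp j then 0 else snd (w' j))"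
          by (rule sum.cong) (use r in auto)
        thus ?thesis using w False sp[of "\<lambda>i. if grp i then 0 else snd (w i)"]
            sp[of "\<lambda>i. if grp i then 0 else snd (w' i)"] by (simp add: H_def relations_def)
      qed
      hence "w i = w' i" using eq by (simp add: code_def prod_eq_iff)
      hence "w j = w' j" if "j \<in> I" for j using r[of j] that by (cases "j = i") auto
      moreover have "w \<in> extensional I" "w' \<in> extensional I" using w by (auto simp: H_def relations_def PiE_def)
      ultimately show "w = w'" by (intro extensionalityI)
    qed
    hence "card (H i) = card (code ` H i)" by (simp add: card_image)
    also have "\<dots> \<le> card ({1..x0} \<times> ((I - {i}) \<rightarrow>\<^sub>E dead_pairs))"
    proof (rule card_mono)
      show "finite ({1..x0} \<times> ((I - {i}) \<rightarrow>\<^sub>E dead_pairs))"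
        using finite_index finite_dead_pairs by (auto intro!: finite_PiE)
      show "code ` H i \<subseteq> {1..x0} \<times> ((I - {i}) \<rightarrow>\<^sub>E dead_pairs)"
      proof (rule image_subsetI)
        fix w assume w: "w \<in> H i"
        have mem: "w j \<in> {1..N} \<times> {- int B..int B}" if "j \<in> I" for j
          using w that by (auto simp: H_def relations_def)
        have dead: "w j \<in> dead_pairs" if "j \<in> I" for j
          using w mem[of j] that by (auto simp: dead_pairs_def live_def H_def)
        have "fst (w i) \<in> {1..x0}" using w dead[OF i] by (auto simp: H_def dead_pairs_def)
        thus "code w \<in> {1..x0} \<times> ((I - {i}) \<rightarrow>\<^sub>E dead_pairs)" using dead by (auto simp: code_def)
      qed
    qed
    also have "\<dots> = x0 * card dead_pairs ^ (card I - 1)"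
      using finite_index i by (simp add: card_cartesian_product card_PiE)
    also have "\<dots> \<le> x0 * branching ^ (card I - 1)"
      by (intro mult_left_mono power_mono card_dead_pairs) auto
    finally show ?thesis .
  qed
  have "{w \<in> relations. live w = {}} \<subseteq> (\<Union>i\<in>I. H i)" unfolding H_def by (auto simp: relations_def)
  hence "card {w \<in> relations. live w = {}} \<le> card (\<Union>i\<in>I. H i)"
    by (intro card_mono) (use finite_index finite_relations in \<open>auto simp: H_def\<close>)
  also have "\<dots> \<le> (\<Sum>i\<in>I. card (H i))" by (rule card_UN_le[OF finite_index])
  also have "\<dots> \<le> (\<Sum>i\<in>I. x0 * branching ^ (card I - 1))" by (intro sum_mono Hi)
  finally show ?thesis by (simp add: mult.assoc)
qed

lemma card_relations: "card relations \<le> card I * (2 ^ card I + x0) * branching ^ (card I - 1)"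
proof -
  have "relations \<subseteq> {w \<in> relations. live w = {}} \<union> (\<Union>L\<in>Pow I - {{}}. {w \<in> relations. live w = L})"
  proof
    fix w assume "w \<in> relations"
    moreover have "live w \<in> Pow I" by (auto simp: live_def)
    ultimately show "w \<in> {w \<in> relations. live w = {}} \<union> (\<Union>L\<in>Pow I - {{}}. {w \<in> relations. live w = L})"
      by (cases "live w = {}") blast+
  qed
  hence "card relations \<le> card ({w \<in> relations. live w = {}} \<union> (\<Union>L\<in>Pow I - {{}}. {w \<in> relations. live w = L}))"
    by (intro card_mono) (use finite_index finite_relations in auto)
  also have "\<dots> \<le> card {w \<in> relations. live w = {}} + card (\<Union>L\<in>Pow I - {{}}. {w \<in> relations. live w = L})"
    by (rule card_Un_le)
  also have "\<dots> \<le> card I * x0 * branching ^ (card I - 1) + (\<Sum>L\<in>Pow I - {{}}. card I * branching ^ (card I - 1))"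
    by (intro add_mono card_relations_dead order_trans[OF card_UN_le] sum_mono card_relations_live) (use finite_index in auto)
  also have "\<dots> \<le> card I * x0 * branching ^ (card I - 1) + 2 ^ card I * (card I * branching ^ (card I - 1))"
    using finite_index by (auto simp: card_Pow intro!: mult_right_mono order_trans[OF card_Diff1_le])
  finally show ?thesis by (simp add: algebra_simps)
qed

end

section \<open>Trigonometric approximation of indicator functions\<close>

definition ee :: "real \<Rightarrow> complex" where "ee t = cis (2 * pi * t)"

lemma ee_add: "ee (s + t) = ee s * ee t"
  by (simp add: ee_def cis_mult algebra_simps)

lemma norm_ee [simp]: "norm (ee t) = 1" by (simp add: ee_def)

lemma ee_0 [simp]: "ee 0 = 1" by (simp add: ee_def)

lemma ee_int [simp]: "ee (of_int n) = 1"
  by (simp add: ee_def cis_multiple_2pi)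

lemma cnj_ee: "cnj (ee t) = ee (- t)" by (simp add: ee_def cis_cnj)

lemma continuous_ee [continuous_intros]:
  "continuous_on A f \<Longrightarrow> continuous_on A (\<lambda>x. ee (f x))"
  unfolding ee_def cis_conv_exp by (intro continuous_intros)

lemma has_integral_ee:
  "((\<lambda>u. ee (of_int n * u)) has_integral (if n = 0 then 1 else 0)) {t..t + 1}"
proof (cases "n = 0")
  case True
  thus ?thesis using has_integral_const_real[of "1 :: complex" t "t + 1"] by simp
next
  case False
  define c where "c = 2 * of_real pi * \<i> * of_int n"
  have c: "c \<noteq> 0" using False by (simp add: c_def)
  have ee: "ee (of_int n * u) = exp (c * of_real u)" for u
    by (simp add: ee_def cis_conv_exp c_def mult_ac)
  have "((\<lambda>u. exp (c * of_real u)) has_integral exp (c * of_real (t + 1)) / c - exp (c * of_real t) / c) {t..t + 1}"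
  proof (rule fundamental_theorem_of_calculus)
    fix x assume "x \<in> {t..t + 1}"
    have "((\<lambda>z. exp (c * z) / c) has_field_derivative exp (c * of_real x)) (at (of_real x))"
      using c by (auto intro!: derivative_eq_intros)
    thus "((\<lambda>u. exp (c * of_real u) / c) has_vector_derivative exp (c * of_real x)) (at x within {t..t + 1})"
      by (rule has_vector_derivative_real_field)
  qed simp
  moreover have "exp (c * of_real (t + 1)) = exp (c * of_real t)"
    using ee_add[of "of_int n * t" "of_int n"] unfolding ee[symmetric] by (simp add: distrib_left)
  ultimately show ?thesis using False unfolding ee by simp
qed

definition trig_poly :: "nat \<Rightarrow> (int \<Rightarrow> complex) \<Rightarrow> real \<Rightarrow> complex" where
  "trig_poly D c u = (\<Sum>n\<in>{- int D..int D}. c n * ee (of_int n * u))"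

lemma continuous_trig_poly [continuous_intros]:
  "continuous_on A f \<Longrightarrow> continuous_on A (\<lambda>x. trig_poly D c (f x))"
  unfolding trig_poly_def by (intro continuous_intros)

lemma trig_poly_coeff:
  assumes "\<bar>m\<bar> \<le> int D"
  shows "((\<lambda>u. trig_poly D c u * ee (- of_int m * u)) has_integral c m) {t..t + 1}"
proof -
  have "((\<lambda>u. \<Sum>n\<in>{- int D..int D}. c n * ee (of_int (n - m) * u)) has_integral
     (\<Sum>n\<in>{- int D..int D}. c n * (if n - m = 0 then 1 else 0))) {t..t + 1}"
    by (intro has_integral_sum has_integral_mult_right has_integral_ee) auto
  moreover have "(\<Sum>n\<in>{- int D..int D}. c n * (if n - m = 0 then 1 else 0)) = c m"
    using assms by (auto simp: if_distrib cong: if_cong)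
  moreover have "(\<Sum>n\<in>{- int D..int D}. c n * ee (of_int (n - m) * u)) = trig_poly D c u * ee (- of_int m * u)" for u
    unfolding trig_poly_def sum_distrib_right
    by (intro sum.cong refl) (simp add: ee_add[symmetric] algebra_simps)
  ultimately show ?thesis by simp
qed

definition is_trig_poly :: "nat \<Rightarrow> (real \<Rightarrow> complex) \<Rightarrow> bool" where
  "is_trig_poly D f \<longleftrightarrow> (\<exists>c. \<forall>u. f u = trig_poly D c u)"

lemma is_trig_poly_sum:
  assumes "finite A" "\<And>i. i \<in> A \<Longrightarrow> is_trig_poly D (f i)"
  shows "is_trig_poly D (\<lambda>u. \<Sum>i\<in>A. f i u)"
proof -
  obtain c where c: "\<And>i u. i \<in> A \<Longrightarrow> f i u = trig_poly D (c i) u"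
    using assms(2) unfolding is_trig_poly_def by metis
  have "(\<Sum>i\<in>A. f i u) = trig_poly D (\<lambda>n. \<Sum>i\<in>A. c i n) u" for u
  proof -
    have "(\<Sum>i\<in>A. f i u) = (\<Sum>i\<in>A. \<Sum>n\<in>{- int D..int D}. c i n * ee (of_int n * u))"
      using c by (simp add: trig_poly_def)
    also have "\<dots> = (\<Sum>n\<in>{- int D..int D}. \<Sum>i\<in>A. c i n * ee (of_int n * u))" by (rule sum.swap)
    finally show ?thesis by (simp add: trig_poly_def sum_distrib_right)
  qed
  thus ?thesis unfolding is_trig_poly_def by blast
qed

lemma is_trig_poly_monom:
  assumes "\<bar>m\<bar> \<le> int D" shows "is_trig_poly D (\<lambda>u. b * ee (of_int m * u))"
  unfolding is_trig_poly_def
proof (intro exI allI)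
  fix u
  have "trig_poly D (\<lambda>n. if n = m then b else 0) u
    = (\<Sum>n\<in>{- int D..int D}. if n = m then b * ee (of_int n * u) else 0)"
    unfolding trig_poly_def by (intro sum.cong) auto
  also have "\<dots> = b * ee (of_int m * u)" using assms by (subst sum.delta) auto
  finally show "b * ee (of_int m * u) = trig_poly D (\<lambda>n. if n = m then b else 0) u" by simp
qed

lemma is_trig_poly_mult:
  assumes "is_trig_poly D f" "is_trig_poly D' g" shows "is_trig_poly (D + D') (\<lambda>u. f u * g u)"
proof -
  obtain c c' where c: "\<And>u. f u = trig_poly D c u" "\<And>u. g u = trig_poly D' c' u"
    using assms unfolding is_trig_poly_def by metis
  have "f u * g u = (\<Sum>n\<in>{- int D..int D}. \<Sum>n'\<in>{- int D'..int D'}. (c n * c' n') * ee (of_int (n + n') * u))" for u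
    unfolding c trig_poly_def sum_product by (intro sum.cong refl) (simp add: distrib_right ee_add)
  moreover have "is_trig_poly (D + D') (\<lambda>u. \<Sum>n\<in>{- int D..int D}. \<Sum>n'\<in>{- int D'..int D'}. (c n * c' n') * ee (of_int (n + n') * u))"
    by (intro is_trig_poly_sum is_trig_poly_monom) auto
  ultimately show ?thesis by simp
qed

section \<open>Powers of the Fejer kernel\<close>

definition dirichlet :: "nat \<Rightarrow> real \<Rightarrow> complex" where
  "dirichlet M u = (\<Sum>j<M. ee (real j * u))"

text \<open>Up to normalisation the \<open>r\<close>-th power of the Fejer kernel, a kernel of
  Jackson type: nonnegative, of degree linear in \<open>M\<close>, and with tails that improve with
  \<open>r\<close>.\<close>

definition jackson :: "nat \<Rightarrow> nat \<Rightarrow> real \<Rightarrow> real" where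
  "jackson M r u = norm (dirichlet M u) ^ (2 * r)"

lemma is_trig_poly_jackson: "is_trig_poly (r * (2 * M)) (\<lambda>u. of_real (jackson M r u))"
proof (induction r)
  case 0
  show ?case using is_trig_poly_monom[of 0 0 1] by (simp add: jackson_def)
next
  case (Suc r)
  have "is_trig_poly M (dirichlet M)"
    unfolding dirichlet_def using is_trig_poly_monom[of "int _" M 1] by (intro is_trig_poly_sum) auto
  moreover have "is_trig_poly M (\<lambda>u. cnj (dirichlet M u))"
    unfolding dirichlet_def cnj_sum cnj_ee using is_trig_poly_monom[of "- int _" M 1] by (intro is_trig_poly_sum) auto
  ultimately have "is_trig_poly (M + M + r * (2 * M))
      (\<lambda>u. dirichlet M u * cnj (dirichlet M u) * of_real (jackson M r u))"
    by (intro is_trig_poly_mult Suc)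
  moreover have "dirichlet M u * cnj (dirichlet M u) * of_real (jackson M r u) = of_real (jackson M (Suc r) u)" for u
    by (simp add: jackson_def complex_norm_square[symmetric] power_add power2_eq_square)
  ultimately show ?case by (simp add: mult_2)
qed

text \<open>A weak form of Jordan's inequality. Up to \<open>pi / 3\<close> the cosine is at least
  one half; beyond that point the sine is at least 4/5, which exceeds \<open>pi / 4\<close>.\<close>

lemma sin_ge_half: assumes "0 \<le> x" "x \<le> pi / 2" shows "x / 2 \<le> sin x"
proof (cases "x \<le> pi / 3")
  case True
  show ?thesis
  proof (cases "x = 0")
    case False
    hence "0 < x" using assms by simp
    then obtain z where z: "0 < z" "z < x" "sin x - sin 0 = (x - 0) * cos z"
      using MVT2[of 0 x sin cos] by (auto intro: DERIV_sin)
    have "cos (pi / 3) \<le> cos z" using z True by (intro cos_monotone_0_pi_le) auto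
    thus ?thesis using z mult_left_mono[of "1/2" "cos z" x] assms by (simp add: cos_60)
  qed simp
next
  case False
  have "sin (pi / 3) \<le> sin x" using False assms by (intro sin_monotone_2pi_le) auto
  moreover have "sin (pi / 3) \<ge> 4 / 5"
    unfolding sin_60 using real_le_rsqrt[of "8 / 5" 3] by (simp add: power2_eq_square)
  moreover have "pi \<le> 16 / 5" using pi_approx by simp
  ultimately show ?thesis using assms by linarith
qed

text \<open>After subtraction of the nearest integer, with remainder \<open>v\<close>, the chord has
  length \<open>2 * sin (pi * \<bar>v\<bar>)\<close>, which is at least
  \<open>pi * \<bar>v\<bar>\<close>.\<close>

lemma norm_ee_minus_one:
  assumes "\<delta> \<ge> 0" "\<And>m :: int. \<delta> \<le> \<bar>u - of_int m\<bar>"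
  shows "2 * \<delta> \<le> norm (ee u - 1)"
proof -
  define v where "v = u - of_int (round u)"
  have v: "\<delta> \<le> \<bar>v\<bar>" "\<bar>v\<bar> \<le> 1 / 2"
    using assms of_int_round_abs_le[of u] by (auto simp: v_def abs_minus_commute)
  have "ee u = ee v * ee (of_int (round u))" unfolding ee_add[symmetric] v_def by simp
  hence eq: "ee u = ee v" by simp
  have "norm (ee u - 1) = norm (ee (v / 2) * ee (v / 2) - ee (v / 2) * ee (- v / 2))"
    unfolding eq ee_add[symmetric] by simp
  also have "\<dots> = norm (ee (v / 2)) * norm (ee (v / 2) - cnj (ee (v / 2)))"
    unfolding cnj_ee by (simp only: right_diff_distrib[symmetric] norm_mult) simp
  also have "\<dots> = 2 * \<bar>sin (pi * v)\<bar>"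
    by (simp add: ee_def cmod_def real_sqrt_mult)
  also have "\<bar>sin (pi * v)\<bar> = sin (pi * \<bar>v\<bar>)"
  proof -
    have "0 \<le> sin (pi * \<bar>v\<bar>)" using v by (intro sin_ge_zero) auto
    thus ?thesis by (cases "v \<ge> 0") auto
  qed
  finally have "norm (ee u - 1) = 2 * sin (pi * \<bar>v\<bar>)" .
  moreover have "pi * \<bar>v\<bar> / 2 \<le> sin (pi * \<bar>v\<bar>)" using v by (intro sin_ge_half) auto
  moreover have "3 * \<bar>v\<bar> \<le> pi * \<bar>v\<bar>" using pi_gt3 by (intro mult_right_mono) auto
  ultimately show ?thesis using v by linarith
qed

lemma norm_dirichlet_le:
  assumes "\<delta> > 0" "\<And>m :: int. \<delta> \<le> \<bar>u - of_int m\<bar>"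
  shows "norm (dirichlet M u) \<le> 1 / \<delta>"
proof -
  have "(ee u - 1) * dirichlet M u = ee u ^ M - 1"
  proof -
    have "ee (real j * u) = ee u ^ j" for j
      by (induction j) (auto simp: distrib_right ee_add)
    thus ?thesis unfolding dirichlet_def using power_diff_1_eq[of "ee u" M] by simp
  qed
  hence "norm (ee u - 1) * norm (dirichlet M u) = norm (ee u ^ M - 1)" by (metis norm_mult)
  also have "\<dots> \<le> norm (ee u ^ M) + norm (1 :: complex)" by (rule norm_triangle_ineq4)
  also have "\<dots> = 2" by (simp add: norm_power)
  finally have "norm (ee u - 1) * norm (dirichlet M u) \<le> 2" .
  moreover have "(2 * \<delta>) * norm (dirichlet M u) \<le> norm (ee u - 1) * norm (dirichlet M u)"
    by (intro mult_right_mono norm_ee_minus_one) (use assms in auto)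
  ultimately show ?thesis using assms by (simp add: field_simps)
qed


lemma jackson_nonneg [simp]: "0 \<le> jackson M r u" by (simp add: jackson_def)

text \<open>The pointwise bound \<open>(1 / \<delta>) ^ (2 * r)\<close> divided by the lower bound
  \<open>real M ^ (2 * r) / (4 * r * M + 1)\<close> for the mean of
  \<open>jackson M r\<close>.\<close>

definition jackson_tail :: "nat \<Rightarrow> nat \<Rightarrow> real \<Rightarrow> real" where
  "jackson_tail M r \<delta> = (1 / \<delta>) ^ (2 * r) * (4 * r * M + 1) / real M ^ (2 * r)"

text \<open>Normalising requires a lower bound for the mean. No Fourier coefficient of a nonnegative
  function exceeds its mean in absolute value, so the value \<open>M ^ (2 * r)\<close> at 0 is at
  most the mean times the number \<open>4 * r * M + 1\<close> of frequencies.\<close>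

lemma jackson_kernel:
  assumes "M \<ge> 1"
  shows "\<exists>q Q. (\<forall>u. of_real (Q u) = trig_poly (r * (2 * M)) q u) \<and> (\<forall>u. 0 \<le> Q u) \<and> q 0 = 1 \<and>
    (\<forall>n. \<bar>n\<bar> \<le> int (r * (2 * M)) \<longrightarrow> norm (q n) \<le> 1) \<and>
    (\<forall>\<delta>>0. \<forall>u. (\<forall>m :: int. \<delta> \<le> \<bar>u - of_int m\<bar>) \<longrightarrow> Q u \<le> jackson_tail M r \<delta>)"
proof -
  define D where "D = r * (2 * M)"
  obtain c where c: "\<And>u. of_real (jackson M r u) = trig_poly D c u"
    using is_trig_poly_jackson[of r M] unfolding is_trig_poly_def D_def by blast
  have c0: "(jackson M r has_integral Re (c 0)) {0..1}" "Im (c 0) = 0"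
  proof -
    have *: "((\<lambda>u. complex_of_real (jackson M r u)) has_integral c 0) {0..1}"
      using trig_poly_coeff[of 0 D c 0] unfolding c by simp
    show "(jackson M r has_integral Re (c 0)) {0..1}" using has_integral_Re[OF *] by simp
    have "((\<lambda>u. 0) has_integral Im (c 0)) {0..1::real}" using has_integral_Im[OF *] by simp
    thus "Im (c 0) = 0" using has_integral_unique[OF has_integral_0] by metis
  qed
  have cn: "norm (c n) \<le> Re (c 0)" if "\<bar>n\<bar> \<le> int D" for n
  proof -
    have I: "((\<lambda>u. trig_poly D c u * ee (- of_int n * u)) has_integral c n) {0..1}"
      using trig_poly_coeff[OF that, of c 0] by simp
    have "norm (integral {0..1} (\<lambda>u. trig_poly D c u * ee (- of_int n * u))) \<le> integral {0..1} (jackson M r)"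
    proof (rule integral_norm_bound_integral)
      show "(\<lambda>u. trig_poly D c u * ee (- of_int n * u)) integrable_on {0..1}" using I by blast
      show "jackson M r integrable_on {0..1}" using c0(1) by blast
      show "norm (trig_poly D c u * ee (- of_int n * u)) \<le> jackson M r u" for u
        unfolding c[symmetric] norm_mult by simp
    qed
    thus ?thesis using I c0(1) by (simp add: integral_unique)
  qed
  have "real M ^ (2 * r) = jackson M r 0" by (simp add: jackson_def dirichlet_def)
  also have "\<dots> = norm (trig_poly D c 0)" unfolding c[symmetric] by simp
  also have "\<dots> \<le> (\<Sum>n\<in>{- int D..int D}. norm (c n))"
    unfolding trig_poly_def by (intro order_trans[OF norm_sum]) simp
  also have "\<dots> \<le> (\<Sum>n\<in>{- int D..int D}. Re (c 0))" by (intro sum_mono cn) auto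
  also have "\<dots> = (4 * r * M + 1) * Re (c 0)" by (simp add: D_def algebra_simps)
  finally have lower: "real M ^ (2 * r) \<le> (4 * r * M + 1) * Re (c 0)" .
  have "0 < real M ^ (2 * r)" using assms by simp
  hence pos: "Re (c 0) > 0" using lower
    by (meson less_le_trans mult_nonneg_nonpos not_le of_nat_0_le_iff)
  have cc: "c 0 = of_real (Re (c 0))" using c0(2) by (simp add: complex_eq_iff)
  show ?thesis
  proof (intro exI conjI allI impI)
    show "of_real (jackson M r u / Re (c 0)) = trig_poly (r * (2 * M)) (\<lambda>n. c n / c 0) u" for u
    proof -
      have "of_real (jackson M r u / Re (c 0)) = trig_poly D c u / c 0" unfolding of_real_divide c using cc by simp
      thus ?thesis unfolding trig_poly_def D_def by (simp add: sum_divide_distrib)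
    qed
    show "0 \<le> jackson M r u / Re (c 0)" for u using pos by simp
    show "c 0 / c 0 = 1" using pos by auto
    show "norm (c n / c 0) \<le> 1" if "\<bar>n\<bar> \<le> int (r * (2 * M))" for n
    proof -
      have "norm (c 0) = Re (c 0)" using pos by (subst cc) simp
      thus ?thesis using cn[of n] that pos unfolding D_def norm_divide by simp
    qed
    show "jackson M r u / Re (c 0) \<le> jackson_tail M r \<delta>"
      if "\<delta> > 0" "\<forall>m :: int. \<delta> \<le> \<bar>u - of_int m\<bar>" for \<delta> u
    proof -
      have "jackson M r u \<le> (1 / \<delta>) ^ (2 * r)"
        unfolding jackson_def using that by (intro power_mono norm_dirichlet_le) auto
      moreover have "1 / Re (c 0) \<le> (4 * r * M + 1) / real M ^ (2 * r)"
        using lower pos assms by (simp add: field_simps)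
      ultimately have "jackson M r u * (1 / Re (c 0)) \<le> (1 / \<delta>) ^ (2 * r) * ((4 * r * M + 1) / real M ^ (2 * r))"
        using pos that(1) by (intro mult_mono) auto
      thus ?thesis by (simp add: jackson_tail_def)
    qed
  qed
qed

text \<open>The mean is exactly the length of the interval, so smoothing does not disturb the main
  term. Accuracy is demanded only at distance \<delta> from the end points; what happens near them
  is dealt with by comparison with slightly smaller and larger intervals.\<close>

definition approx_indicator ::
    "nat \<Rightarrow> real \<Rightarrow> real \<Rightarrow> (real \<Rightarrow> real) \<Rightarrow> (int \<Rightarrow> complex) \<Rightarrow> (real \<Rightarrow> real) \<Rightarrow> bool" where
  "approx_indicator D lo hi \<eta> c S \<longleftrightarrow>
     (\<forall>y. of_real (S y) = trig_poly D c y) \<and>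
     (\<forall>n. \<bar>n\<bar> \<le> int D \<longrightarrow> norm (c n) \<le> hi - lo) \<and> c 0 = of_real (hi - lo) \<and>
     (\<forall>y. 0 \<le> S y \<and> S y \<le> 1) \<and>
     (\<forall>\<delta>>0. \<forall>y. (\<forall>m :: int. y + of_int m \<le> lo - \<delta> \<or> hi + \<delta> \<le> y + of_int m) \<longrightarrow> S y \<le> \<eta> \<delta>) \<and>
     (\<forall>\<delta>>0. \<forall>y. \<forall>m :: int. lo + \<delta> \<le> y + of_int m \<and> y + of_int m \<le> hi - \<delta> \<longrightarrow> 1 - S y \<le> \<eta> \<delta>)"

text \<open>\<open>S\<close> is the convolution of the interval with the kernel. The kernel has
  integral 1 over a period, so \<open>1 - S y\<close> is its integral over the complementary arc
  \<open>{hi..lo + 1}\<close>. Both arcs are intervals of length at most 1, and one tail estimate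
  serves for both.\<close>

lemma smoothed_indicator:
  assumes "M \<ge> 1" "lo < hi" "hi - lo < 1"
  shows "\<exists>c S. approx_indicator (r * (2 * M)) lo hi (jackson_tail M r) c S"
proof -
  define D where "D = r * (2 * M)"
  define eta where "eta = jackson_tail M r"
  obtain q Q where q: "\<And>u. of_real (Q u) = trig_poly D q u" "\<And>u. 0 \<le> Q u" "q 0 = 1"
    "\<And>n. \<bar>n\<bar> \<le> int D \<Longrightarrow> norm (q n) \<le> 1"
    "\<And>\<delta> u. \<delta> > 0 \<Longrightarrow> (\<And>m :: int. \<delta> \<le> \<bar>u - of_int m\<bar>) \<Longrightarrow> Q u \<le> eta \<delta>"
    using jackson_kernel[OF assms(1), of r, folded D_def eta_def] by metis
  have eta_pos: "\<delta> > 0 \<Longrightarrow> eta \<delta> \<ge> 0" for \<delta> by (simp add: eta_def jackson_tail_def)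
  have contQ: "continuous_on A Q" for A
  proof -
    have "continuous_on A (\<lambda>u. Re (trig_poly D q u))" by (intro continuous_intros)
    thus ?thesis unfolding q(1)[symmetric] by simp
  qed
  have contQ': "continuous_on A (\<lambda>u. Q (y - u))" for A y
    by (rule continuous_on_compose2[OF contQ[of UNIV]]) (auto intro!: continuous_intros)
  have intQ: "(\<lambda>u. Q (y - u)) integrable_on {s..t}" for s t y
    by (intro integrable_continuous_real contQ')
  have inte: "(\<lambda>u. ee (- of_int n * u)) integrable_on {s..t}" for n s t
    by (intro integrable_continuous_real continuous_intros)
  define J where "J = (\<lambda>n :: int. integral {lo..hi} (\<lambda>u. ee (- of_int n * u)))"
  define S where "S = (\<lambda>y. integral {lo..hi} (\<lambda>u. Q (y - u)))"
  have expand: "complex_of_real (Q (y - u)) = (\<Sum>n\<in>{- int D..int D}. q n * ee (of_int n * y) * ee (- of_int n * u))" for y u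
    unfolding q(1) trig_poly_def by (intro sum.cong) (auto simp: ee_add[symmetric] algebra_simps)
  have Sc: "of_real (S y) = trig_poly D (\<lambda>n. q n * J n) y" for y
  proof -
    have "((\<lambda>u. Q (y - u)) has_integral S y) {lo..hi}" unfolding S_def using intQ by (rule integrable_integral)
    hence "((\<lambda>u. complex_of_real (Q (y - u))) has_integral of_real (S y)) {lo..hi}"
      by (rule has_integral_of_real)
    moreover have "((\<lambda>u. complex_of_real (Q (y - u))) has_integral (\<Sum>n\<in>{- int D..int D}. q n * ee (of_int n * y) * J n)) {lo..hi}"
      unfolding expand J_def by (intro has_integral_sum has_integral_mult_right integrable_integral inte) auto
    ultimately have "of_real (S y) = (\<Sum>n\<in>{- int D..int D}. q n * ee (of_int n * y) * J n)"
      by (rule has_integral_unique)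
    thus ?thesis unfolding trig_poly_def by (simp add: mult_ac)
  qed
  have period: "integral {lo..lo + 1} (\<lambda>u. Q (y - u)) = 1" for y
  proof -
    have "((\<lambda>u. complex_of_real (Q (y - u))) has_integral
        (\<Sum>n\<in>{- int D..int D}. q n * ee (of_int n * y) * (if - n = 0 then 1 else 0))) {lo..lo + 1}"
      unfolding expand
    proof (intro has_integral_sum has_integral_mult_right)
      show "((\<lambda>u. ee (- of_int n * u)) has_integral (if - n = 0 then 1 else 0)) {lo..lo + 1}" for n
        using has_integral_ee[of "- n" lo] by simp
    qed simp
    also have "(\<Sum>n\<in>{- int D..int D}. q n * ee (of_int n * y) * (if - n = 0 then 1 else 0)) = 1"
      using q(3) by (simp add: if_distrib cong: if_cong)
    finally have "((\<lambda>u. Re (complex_of_real (Q (y - u)))) has_integral Re 1) {lo..lo + 1}"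
      by (rule has_integral_Re)
    thus ?thesis by (simp add: integral_unique)
  qed
  have compl: "1 - S y = integral {hi..lo + 1} (\<lambda>u. Q (y - u))" for y
  proof -
    have "integral {lo..hi} (\<lambda>u. Q (y - u)) + integral {hi..lo + 1} (\<lambda>u. Q (y - u)) = integral {lo..lo + 1} (\<lambda>u. Q (y - u))"
      by (rule Henstock_Kurzweil_Integration.integral_combine[OF _ _ intQ]) (use assms in auto)
    thus ?thesis unfolding S_def period by linarith
  qed
  have bound: "integral {s..t} (\<lambda>u. Q (y - u)) \<le> eta \<delta>"
    if "\<delta> > 0" "s \<le> t" "t - s \<le> 1" "\<And>u m. u \<in> {s..t} \<Longrightarrow> \<delta> \<le> \<bar>y - u - of_int m\<bar>" for s t y \<delta>
  proof -
    have "integral {s..t} (\<lambda>u. Q (y - u)) \<le> integral {s..t} (\<lambda>u. eta \<delta>)"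
    proof (rule integral_le[OF intQ])
      show "(\<lambda>u. eta \<delta>) integrable_on {s..t}" by (intro integrable_continuous_real continuous_intros)
      show "Q (y - u) \<le> eta \<delta>" if "u \<in> {s..t}" for u
        by (rule q(5)) (use \<open>\<delta> > 0\<close> \<open>\<And>u m. u \<in> {s..t} \<Longrightarrow> \<delta> \<le> \<bar>y - u - of_int m\<bar>\<close> that in auto)
    qed
    also have "\<dots> = (t - s) * eta \<delta>" using that(2) by simp
    also have "\<dots> \<le> 1 * eta \<delta>" using that(1,3) eta_pos by (intro mult_right_mono) auto
    finally show ?thesis by simp
  qed
  show ?thesis
    unfolding approx_indicator_def
  proof (intro exI conjI allI impI)
    show "of_real (S y) = trig_poly (r * (2 * M)) (\<lambda>n. q n * J n) y" for y using Sc unfolding D_def .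
    show "norm (q n * J n) \<le> hi - lo" if "\<bar>n\<bar> \<le> int (r * (2 * M))" for n
    proof -
      have "norm (J n) \<le> integral {lo..hi} (\<lambda>u. 1)"
        unfolding J_def by (rule integral_norm_bound_integral[OF inte]) auto
      hence "norm (J n) \<le> hi - lo" using assms by simp
      hence "norm (q n) * norm (J n) \<le> 1 * (hi - lo)"
        using q(4)[of n] that assms by (intro mult_mono) (auto simp: D_def)
      thus ?thesis by (simp add: norm_mult)
    qed
    show "q 0 * J 0 = of_real (hi - lo)" using assms by (simp add: J_def q(3) scaleR_conv_of_real)
    show "0 \<le> S y" for y unfolding S_def by (intro integral_nonneg intQ) (rule q(2))
    show "S y \<le> 1" for y
    proof -
      have "0 \<le> integral {hi..lo + 1} (\<lambda>u. Q (y - u))" by (intro integral_nonneg intQ q(2))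
      thus ?thesis using compl[of y] by linarith
    qed
    show "S y \<le> jackson_tail M r \<delta>"
      if "\<delta> > 0" "\<forall>m :: int. y + of_int m \<le> lo - \<delta> \<or> hi + \<delta> \<le> y + of_int m" for y \<delta>
      unfolding eta_def[symmetric] S_def
    proof (rule bound)
      fix u and m :: int assume "u \<in> {lo..hi}"
      thus "\<delta> \<le> \<bar>y - u - of_int m\<bar>" using that(2)[THEN spec, of "- m"] by auto
    qed (use that(1) assms(2,3) in auto)
    show "1 - S y \<le> jackson_tail M r \<delta>"
      if "\<delta> > 0" "lo + \<delta> \<le> y + of_int m \<and> y + of_int m \<le> hi - \<delta>" for y \<delta> m
      unfolding eta_def[symmetric] compl
    proof (rule bound)
      fix u and j :: int assume u: "u \<in> {hi..lo + 1}"
      \<comment> \<open>This keeps \<open>y - u\<close> at distance at least \<delta> from two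
        consecutive integers on either side of it, hence from all integers.\<close>
      have 1: "y - u + of_int m \<le> - \<delta>" "\<delta> - 1 \<le> y - u + of_int m" using that(2) u by auto
      show "\<delta> \<le> \<bar>y - u - of_int j\<bar>"
      proof (cases "- m \<le> j")
        case True
        hence "- real_of_int m \<le> of_int j" by linarith
        thus ?thesis using 1 by linarith
      next
        case False
        hence "j + 1 \<le> - m" by simp
        hence "real_of_int j + 1 \<le> - of_int m" by linarith
        thus ?thesis using 1 by linarith
      qed
    qed (use that(1) assms(2,3) in auto)
  qed
qed

section \<open>The variance of smoothed correlation sums\<close>

text \<open>Parseval's identity with repeated frequencies: orthogonality leaves exactly the pairs
  with equal frequency, so the bound is an additive energy.\<close>

lemma mean_square_bound:
  fixes v :: "'a \<Rightarrow> int" and c :: "'a \<Rightarrow> complex"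
  assumes fin: "finite A" and c: "\<And>w. w \<in> A \<Longrightarrow> norm (c w) \<le> K" and K: "K \<ge> 0"
  shows "integral {t..t + 1} (\<lambda>\<alpha>. (norm (\<Sum>w\<in>A. c w * ee (of_int (v w) * \<alpha>)))\<^sup>2)
    \<le> K\<^sup>2 * real (card {(w, w') \<in> A \<times> A. v w = v w'})"
proof -
  let ?f = "\<lambda>\<alpha>. \<Sum>w\<in>A. c w * ee (of_int (v w) * \<alpha>)"
  let ?I = "\<Sum>(w, w')\<in>A \<times> A. if v w = v w' then c w * cnj (c w') else 0"
  have sq: "complex_of_real ((norm (?f \<alpha>))\<^sup>2)
    = (\<Sum>(w, w')\<in>A \<times> A. (c w * cnj (c w')) * ee (of_int (v w - v w') * \<alpha>))" for \<alpha>
  proof -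
    have "complex_of_real ((norm (?f \<alpha>))\<^sup>2) = ?f \<alpha> * cnj (?f \<alpha>)" by (rule complex_norm_square)
    also have "\<dots> = (\<Sum>w\<in>A. \<Sum>w'\<in>A. (c w * cnj (c w')) * (ee (of_int (v w) * \<alpha>) * ee (- (of_int (v w') * \<alpha>))))"
      unfolding cnj_sum sum_product by (intro sum.cong refl) (simp add: cnj_ee mult_ac)
    also have "\<dots> = (\<Sum>w\<in>A. \<Sum>w'\<in>A. (c w * cnj (c w')) * ee (of_int (v w - v w') * \<alpha>))"
      unfolding ee_add[symmetric] by (simp add: left_diff_distrib)
    finally show ?thesis by (simp add: sum.cartesian_product)
  qed
  have "((\<lambda>\<alpha>. \<Sum>(w, w')\<in>A \<times> A. (c w * cnj (c w')) * ee (of_int (v w - v w') * \<alpha>)) has_integral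
     (\<Sum>p\<in>A \<times> A. case p of (w, w') \<Rightarrow> (c w * cnj (c w')) * (if v w - v w' = 0 then 1 else 0))) {t..t + 1}"
  proof (rule has_integral_sum)
    show "finite (A \<times> A)" using fin by simp
    fix p assume "p \<in> A \<times> A"
    obtain w w' where p: "p = (w, w')" by (cases p)
    show "((\<lambda>\<alpha>. case p of (w, w') \<Rightarrow> (c w * cnj (c w')) * ee (of_int (v w - v w') * \<alpha>)) has_integral
      (case p of (w, w') \<Rightarrow> (c w * cnj (c w')) * (if v w - v w' = 0 then 1 else 0))) {t..t + 1}"
      unfolding p prod.case by (intro has_integral_mult_right has_integral_ee)
  qed
  also have "(\<Sum>p\<in>A \<times> A. case p of (w, w') \<Rightarrow> (c w * cnj (c w')) * (if v w - v w' = 0 then 1 else 0)) = ?I"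
    by (intro sum.cong) auto
  finally have "((\<lambda>\<alpha>. complex_of_real ((norm (?f \<alpha>))\<^sup>2)) has_integral ?I) {t..t + 1}"
    unfolding sq .
  from has_integral_Re[OF this] have "((\<lambda>\<alpha>. (norm (?f \<alpha>))\<^sup>2) has_integral Re ?I) {t..t + 1}" by simp
  hence "integral {t..t + 1} (\<lambda>\<alpha>. (norm (?f \<alpha>))\<^sup>2) = Re ?I" by (rule integral_unique)
  also have "\<dots> \<le> norm ?I" by (rule complex_Re_le_cmod)
  also have "\<dots> \<le> (\<Sum>p\<in>A \<times> A. if v (fst p) = v (snd p) then K\<^sup>2 else 0)"
    using c by (intro sum_norm_le) (auto simp: norm_mult power2_eq_square intro!: mult_mono K)
  also have "\<dots> = K\<^sup>2 * real (card {(w, w') \<in> A \<times> A. v w = v w'})"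
  proof -
    have "{p \<in> A \<times> A. v (fst p) = v (snd p)} = {(w, w') \<in> A \<times> A. v w = v w'}" by auto
    moreover have "(\<Sum>p\<in>A \<times> A. if v (fst p) = v (snd p) then K\<^sup>2 else 0) = (\<Sum>p\<in>{p \<in> A \<times> A. v (fst p) = v (snd p)}. K\<^sup>2)"
      by (rule sum.inter_filter[symmetric]) (use fin in simp)
    ultimately show ?thesis by simp
  qed
  finally show ?thesis .
qed

text \<open>The conditionals put 0 for the boundary values \<open>n 0\<close> and
  \<open>n k\<close>, which are \<open>undefined\<close> when \<open>n\<close> is extensional on
  \<open>{1..k - 1}\<close>.\<close>

definition beta :: "nat \<Rightarrow> (nat \<Rightarrow> int) \<Rightarrow> nat \<Rightarrow> int" where
  "beta k n i = (if i < k then n i else 0) - (if 2 \<le> i then n (i - 1) else 0)"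

text \<open>Summation by parts turns frequencies of the differences \<open>a (x i) - a (x (i + 1))\<close> into
  frequencies of the \<open>a (x i)\<close> of total sum zero.\<close>

lemma sum_beta:
  assumes "k \<ge> 1"
  shows "(\<Sum>i\<in>{1..k}. beta k n i * b i) = (\<Sum>i\<in>{1..k - 1}. n i * (b i - b (i + 1)))"
proof -
  obtain l where k: "k = Suc l" using assms by (cases k) auto
  have "(\<Sum>i\<in>{1..k}. beta k n i * b i) = (\<Sum>i\<in>{1..k}. (if i < k then n i else 0) * b i) - (\<Sum>i\<in>{1..k}. (if 2 \<le> i then n (i - 1) else 0) * b i)"
    by (simp add: beta_def left_diff_distrib sum_subtractf)
  also have "(\<Sum>i\<in>{1..k}. (if i < k then n i else 0) * b i) = (\<Sum>i\<in>{1..l}. n i * b i)"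
    unfolding k by (simp add: sum.cl_ivl_Suc)
  also have "(\<Sum>i\<in>{1..k}. (if 2 \<le> i then n (i - 1) else 0) * b i) = (\<Sum>i\<in>{Suc 1..Suc l}. n (i - 1) * b i)"
    unfolding k by (subst sum.atLeast_Suc_atMost) (auto intro!: sum.cong)
  also have "\<dots> = (\<Sum>i\<in>{1..l}. n i * b (i + 1))"
    by (subst sum.shift_bounds_cl_Suc_ivl) simp
  finally show ?thesis unfolding k by (simp add: right_diff_distrib sum_subtractf)
qed

lemma beta_sum_zero: "k \<ge> 1 \<Longrightarrow> (\<Sum>i\<in>{1..k}. beta k n i) = 0"
  using sum_beta[of k n "\<lambda>_. 1"] by simp

text \<open>\<open>beta\<close> is a sequence of successive differences starting from 0, so
  \<open>n\<close> is recovered by partial summation.\<close>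

lemma beta_determines:
  assumes "\<And>i. i \<in> {1..k} \<Longrightarrow> beta k n i = beta k n' i" "j \<in> {1..k - 1}"
  shows "n j = n' j"
  using assms(2)
proof (induction j)
  case (Suc j)
  have *: "beta k n (Suc j) = beta k n' (Suc j)" using Suc.prems by (intro assms(1)) auto
  show ?case
  proof (cases "j = 0")
    case True
    moreover have "Suc 0 < k" using Suc.prems by auto
    ultimately show ?thesis using * by (auto simp: beta_def)
  next
    case False
    hence "n j = n' j" using Suc by auto
    thus ?thesis using * Suc.prems False by (auto simp: beta_def split: if_splits)
  qed
qed simp

text \<open>The zero vector is left out because it produces the main term. By
  \<open>beta_determines\<close>, every other \<open>n\<close> leads to a relation with a nonzero
  coefficient.\<close>

definition frequencies :: "nat \<Rightarrow> nat \<Rightarrow> nat \<Rightarrow> ((nat \<Rightarrow> nat) \<times> (nat \<Rightarrow> int)) set" where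
  "frequencies k N D = {(x, n). x \<in> distinct_tuples k N \<and>
     n \<in> {1..k - 1} \<rightarrow>\<^sub>E {- int D..int D} \<and> (\<exists>i\<in>{1..k - 1}. n i \<noteq> 0)}"

definition phase :: "(nat \<Rightarrow> int) \<Rightarrow> nat \<Rightarrow> (nat \<Rightarrow> nat) \<times> (nat \<Rightarrow> int) \<Rightarrow> int" where
  "phase a k = (\<lambda>(x, n). \<Sum>i\<in>{1..k - 1}. n i * Delta a k x i)"

lemma phase_beta: "k \<ge> 1 \<Longrightarrow> phase a k (x, n) = (\<Sum>i\<in>{1..k}. beta k n i * a (x i))"
  unfolding phase_def prod.case sum_beta by (intro sum.cong) (auto simp: Delta_def)

lemma finite_distinct_tuples: "finite (distinct_tuples k N)"
  by (rule finite_subset[of _ "{1..k} \<rightarrow>\<^sub>E {1..N}"]) (auto simp: distinct_tuples_def intro!: finite_PiE)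

lemma finite_frequencies: "finite (frequencies k N D)"
  by (rule finite_subset[of _ "distinct_tuples k N \<times> ({1..k - 1} \<rightarrow>\<^sub>E {- int D..int D})"])
    (auto simp: frequencies_def intro!: finite_PiE finite_distinct_tuples)

text \<open>Equality of two phases is one relation in \<open>2 * k\<close> terms: the second tuple
  is appended with negated coefficients, and each half sums to zero by \<open>beta_sum_zero\<close>.
  The coefficients are differences of two frequencies, hence \<open>B = 2 * D\<close>; together with
  \<open>card I = 2 * k\<close> this turns the constant 4 of the counting argument into 16, both in
  the gap condition and in the bound.\<close>

lemma (in lacunary_tail) energy_bound:
  assumes k: "k \<ge> 2" and N: "1 \<le> N" "N \<le> 2 * D" and G: "\<rho> ^ G > 16 * real k * real D"
  shows "card {(w, w') \<in> frequencies k N D \<times> frequencies k N D. phase a k w = phase a k w'}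
    \<le> 2 * k * (4 ^ k + x0) * (16 * D * (G + 1) * k * (x0 + 1)) ^ (2 * k - 1)"
proof -
  interpret counting a x0 \<rho> "{1..2 * k}" "\<lambda>i. i \<le> k" N "2 * D" G
    by unfold_locales (use k N G in auto)
  let ?P = "{(w, w') \<in> frequencies k N D \<times> frequencies k N D. phase a k w = phase a k w'}"
  define \<Phi> where "\<Phi> = (\<lambda>((x :: nat \<Rightarrow> nat, n), (x', n')). \<lambda>i\<in>{1..2 * k}.
    if i \<le> k then (x i, beta k n i) else (x' (i - k), - beta k n' (i - k)))"
  have split: "(\<Sum>i\<in>{1..2 * k}. h i) = (\<Sum>i\<in>{1..k}. h i) + (\<Sum>i\<in>{1..k}. h (i + k))" for h :: "nat \<Rightarrow> int"
  proof -
    have "(\<Sum>i\<in>{1..k + k}. h i) = (\<Sum>i\<in>{1..k}. h i) + (\<Sum>i\<in>{k + 1..k + k}. h i)"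
      by (rule sum.ub_add_nat) simp
    also have "(\<Sum>i\<in>{k + 1..k + k}. h i) = (\<Sum>i\<in>{1..k}. h (i + k))"
      using sum.shift_bounds_cl_nat_ivl[of h 1 k k] by (simp add: add.commute)
    finally show ?thesis by (simp add: mult_2)
  qed
  have beta_bd: "\<bar>beta k n i\<bar> \<le> 2 * int D"
    if "n \<in> {1..k - 1} \<rightarrow>\<^sub>E {- int D..int D}" "i \<in> {1..k}" for n i
  proof -
    have "\<bar>n j\<bar> \<le> int D" if "j \<in> {1..k - 1}" for j
      using PiE_mem[OF \<open>n \<in> _\<close> that] by auto
    moreover have "i < k \<Longrightarrow> i \<in> {1..k - 1}" "2 \<le> i \<Longrightarrow> i - 1 \<in> {1..k - 1}" using that(2) by auto
    ultimately have "\<bar>if i < k then n i else 0\<bar> \<le> int D" "\<bar>if 2 \<le> i then n (i - 1) else 0\<bar> \<le> int D"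
      by simp_all
    thus ?thesis unfolding beta_def by linarith
  qed
  have "inj_on \<Phi> ?P"
  proof (rule inj_onI)
    fix p q assume pq: "p \<in> ?P" "q \<in> ?P" and eq: "\<Phi> p = \<Phi> q"
    obtain x n x' n' where p: "p = ((x, n), (x', n'))" by (metis surj_pair)
    obtain y m y' m' where q: "q = ((y, m), (y', m'))" by (metis surj_pair)
    have lo: "x i = y i \<and> beta k n i = beta k m i" if "i \<in> {1..k}" for i
      using fun_cong[OF eq, of i] that unfolding p q \<Phi>_def by auto
    have hi: "x' i = y' i \<and> beta k n' i = beta k m' i" if "i \<in> {1..k}" for i
      using fun_cong[OF eq, of "i + k"] that unfolding p q \<Phi>_def by auto
    have ext: "z \<in> extensional {1..k} \<and> l \<in> extensional {1..k - 1}" if "(z, l) \<in> frequencies k N D" for z l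
      using that by (auto simp: frequencies_def distinct_tuples_def PiE_def)
    have "x = y"
    proof (rule extensionalityI)
      show "x \<in> extensional {1..k}" "y \<in> extensional {1..k}" using ext pq unfolding p q by blast+
    qed (use lo in blast)
    moreover have "x' = y'"
    proof (rule extensionalityI)
      show "x' \<in> extensional {1..k}" "y' \<in> extensional {1..k}" using ext pq unfolding p q by blast+
    qed (use hi in blast)
    moreover have "n = m"
    proof (rule extensionalityI)
      show "n \<in> extensional {1..k - 1}" "m \<in> extensional {1..k - 1}" using ext pq unfolding p q by blast+
      show "n i = m i" if "i \<in> {1..k - 1}" for i by (rule beta_determines[OF _ that]) (use lo in blast)
    qed
    moreover have "n' = m'"
    proof (rule extensionalityI)
      show "n' \<in> extensional {1..k - 1}" "m' \<in> extensional {1..k - 1}" using ext pq unfolding p q by blast+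
      show "n' i = m' i" if "i \<in> {1..k - 1}" for i by (rule beta_determines[OF _ that]) (use hi in blast)
    qed
    ultimately show "p = q" by (simp add: p q)
  qed
  hence "card ?P = card (\<Phi> ` ?P)" by (simp add: card_image)
  also have "\<dots> \<le> card relations"
  proof (rule card_mono)
    show "finite relations" by (rule finite_relations)
    show "\<Phi> ` ?P \<subseteq> relations"
    proof (rule image_subsetI)
      fix p assume P: "p \<in> ?P"
      obtain x n x' n' where p: "p = ((x, n), (x', n'))" by (metis surj_pair)
      have f: "(x, n) \<in> frequencies k N D" "(x', n') \<in> frequencies k N D"
        and ph: "phase a k (x, n) = phase a k (x', n')" using P p by auto
      have x: "x i \<in> {1..N}" "x' i \<in> {1..N}" if "i \<in> {1..k}" for i
      proof -
        have "x \<in> {1..k} \<rightarrow>\<^sub>E {1..N}" "x' \<in> {1..k} \<rightarrow>\<^sub>E {1..N}"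
          using f by (auto simp: frequencies_def distinct_tuples_def)
        thus "x i \<in> {1..N}" "x' i \<in> {1..N}" using that by (blast intro: PiE_mem)+
      qed
      have inj: "inj_on x {1..k}" "inj_on x' {1..k}" using f by (auto simp: frequencies_def distinct_tuples_def)
      have n: "n \<in> {1..k - 1} \<rightarrow>\<^sub>E {- int D..int D}" "n' \<in> {1..k - 1} \<rightarrow>\<^sub>E {- int D..int D}"
        using f by (auto simp: frequencies_def)
      have lo: "\<Phi> p i = (x i, beta k n i)" if "i \<in> {1..k}" for i using that unfolding p \<Phi>_def by auto
      have hi: "\<Phi> p (i + k) = (x' i, - beta k n' i)" if "i \<in> {1..k}" for i using that unfolding p \<Phi>_def by auto
      have cs: "i \<in> {1..k} \<or> (\<exists>j\<in>{1..k}. i = j + k)" if "i \<in> {1..2 * k}" for i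
      proof (cases "i \<le> k")
        case False
        hence "i - k \<in> {1..k}" "i = (i - k) + k" using that by auto
        thus ?thesis by blast
      qed (use that in auto)
      have "\<Phi> p \<in> {1..2 * k} \<rightarrow>\<^sub>E {1..N} \<times> {- int (2 * D)..int (2 * D)}"
      proof (rule PiE_I)
        fix i assume "i \<in> {1..2 * k}"
        from cs[OF this] show "\<Phi> p i \<in> {1..N} \<times> {- int (2 * D)..int (2 * D)}"
        proof
          assume i: "i \<in> {1..k}"
          show ?thesis unfolding lo[OF i] using x(1)[OF i] beta_bd[OF n(1) i] by auto
        next
          assume "\<exists>j\<in>{1..k}. i = j + k"
          then obtain j where j: "j \<in> {1..k}" "i = j + k" by blast
          show ?thesis unfolding j(2) hi[OF j(1)] using x(2)[OF j(1)] beta_bd[OF n(2) j(1)] by auto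
        qed
      next
        fix i assume "i \<notin> {1..2 * k}"
        thus "\<Phi> p i = undefined" unfolding p \<Phi>_def by auto
      qed
      moreover have "fst (\<Phi> p i) \<noteq> fst (\<Phi> p j)"
        if ij: "i \<in> {1..2 * k}" "j \<in> {1..2 * k}" "i \<noteq> j" "(i \<le> k) = (j \<le> k)" for i j
      proof (cases "i \<le> k")
        case True
        hence "i \<in> {1..k}" "j \<in> {1..k}" using ij by auto
        thus ?thesis using lo inj_onD[OF inj(1)] ij(3) by force
      next
        case False
        then obtain i' j' where "i' \<in> {1..k}" "i = i' + k" "j' \<in> {1..k}" "j = j' + k"
          using cs[OF ij(1)] cs[OF ij(2)] ij(4) by auto
        thus ?thesis using hi inj_onD[OF inj(2)] ij(3) by force
      qed
      moreover have "(\<Sum>i\<in>{1..2 * k}. snd (\<Phi> p i) * a (fst (\<Phi> p i))) = 0"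
      proof -
        have "(\<Sum>i\<in>{1..2 * k}. snd (\<Phi> p i) * a (fst (\<Phi> p i)))
          = (\<Sum>i\<in>{1..k}. beta k n i * a (x i)) + (\<Sum>i\<in>{1..k}. - beta k n' i * a (x' i))"
          unfolding split using lo hi by simp
        also have "\<dots> = phase a k (x, n) - phase a k (x', n')"
          using k by (simp add: phase_beta sum_negf)
        finally show ?thesis using ph by simp
      qed
      moreover have "(\<Sum>i\<in>{1..2 * k}. if i \<le> k then snd (\<Phi> p i) else 0) = 0"
      proof -
        have "(\<Sum>i\<in>{1..2 * k}. if i \<le> k then snd (\<Phi> p i) else 0) = (\<Sum>i\<in>{1..k}. beta k n i)"
          unfolding split using lo by simp
        thus ?thesis using beta_sum_zero[of k n] k by simp
      qed
      moreover have "(\<Sum>i\<in>{1..2 * k}. if i \<le> k then 0 else snd (\<Phi> p i)) = 0"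
      proof -
        have "(\<Sum>i\<in>{1..2 * k}. if i \<le> k then 0 else snd (\<Phi> p i)) = (\<Sum>i\<in>{1..k}. - beta k n' i)"
          unfolding split using hi by (simp add: sum.neutral)
        thus ?thesis using beta_sum_zero[of k n'] k by (simp add: sum_negf)
      qed
      moreover have "\<exists>i\<in>{1..2 * k}. snd (\<Phi> p i) \<noteq> 0"
      proof (rule ccontr)
        assume "\<not> (\<exists>i\<in>{1..2 * k}. snd (\<Phi> p i) \<noteq> 0)"
        moreover have "i \<in> {1..2 * k}" if "i \<in> {1..k}" for i using that by auto
        ultimately have s0: "snd (\<Phi> p i) = 0" if "i \<in> {1..k}" for i using that by blast
        hence z: "beta k n i = beta k (\<lambda>_. 0) i" if "i \<in> {1..k}" for i
          using s0[OF that] unfolding lo[OF that] snd_conv by (simp add: beta_def[of k "\<lambda>_. 0"])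
        have "n j = 0" if "j \<in> {1..k - 1}" for j using beta_determines[OF z that] by simp
        thus False using f by (auto simp: frequencies_def)
      qed
      ultimately show "\<Phi> p \<in> relations" unfolding relations_def by blast
    qed
  qed
  also have "\<dots> \<le> card {1..2 * k} * (2 ^ card {1..2 * k} + x0) * branching ^ (card {1..2 * k} - 1)"
    by (rule card_relations)
  also have "\<dots> = 2 * k * (4 ^ k + x0) * (16 * D * (G + 1) * k * (x0 + 1)) ^ (2 * k - 1)"
  proof -
    have "branching = 16 * D * (G + 1) * k * (x0 + 1)" unfolding branching_def by (simp add: mult_ac)
    moreover have "(2 :: nat) ^ (2 * k) = 4 ^ k" by (simp add: power_mult)
    moreover have "card {1..2 * k} = 2 * k" by simp
    ultimately show ?thesis by presburger
  qed
  finally show ?thesis .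
qed


text \<open>The factors are arbitrary so that smoothed and sharp indicators can be inserted into the
  same expression and compared.\<close>

definition product_correlation ::
    "(nat \<Rightarrow> int) \<Rightarrow> nat \<Rightarrow> nat \<Rightarrow> (nat \<Rightarrow> real \<Rightarrow> real) \<Rightarrow> real \<Rightarrow> real" where
  "product_correlation a k N S \<alpha> = (1 / real N) * (\<Sum>x\<in>distinct_tuples k N.
     \<Prod>i\<in>{1..k - 1}. S i (\<alpha> * real_of_int (Delta a k x i)))"

lemma product_correlation_expand:
  assumes S: "\<And>i y. i \<in> {1..k - 1} \<Longrightarrow> of_real (S i y) = trig_poly D (c i) y"
    and c0: "\<And>i. i \<in> {1..k - 1} \<Longrightarrow> c i 0 = of_real (l i)"
  shows "complex_of_real (product_correlation a k N S \<alpha>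
      - (1 / real N) * real (card (distinct_tuples k N)) * (\<Prod>i\<in>{1..k - 1}. l i))
    = (\<Sum>w\<in>frequencies k N D. ((1 / of_nat N) * (\<Prod>i\<in>{1..k - 1}. c i (snd w i))) * ee (of_int (phase a k w) * \<alpha>))"
proof -
  let ?I = "{1..k - 1}"
  let ?X = "distinct_tuples k N"
  let ?P = "?I \<rightarrow>\<^sub>E {- int D..int D}"
  let ?z = "\<lambda>i\<in>?I. 0 :: int"
  let ?g = "\<lambda>x n. (\<Prod>i\<in>?I. c i (n i)) * ee (of_int (phase a k (x, n)) * \<alpha>)"
  have finP: "finite ?P" by (intro finite_PiE) auto
  have zP: "?z \<in> ?P" by auto
  have ee_sum: "ee (\<Sum>i\<in>A. f i) = (\<Prod>i\<in>A. ee (f i))" for A :: "nat set" and f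
    by (induction A rule: infinite_finite_induct) (auto simp: ee_add)
  have one: "complex_of_real (\<Prod>i\<in>?I. S i (\<alpha> * of_int (Delta a k x i))) = (\<Sum>n\<in>?P. ?g x n)" for x
  proof -
    have "complex_of_real (\<Prod>i\<in>?I. S i (\<alpha> * of_int (Delta a k x i)))
      = (\<Prod>i\<in>?I. \<Sum>m\<in>{- int D..int D}. c i m * ee (of_int m * (\<alpha> * of_int (Delta a k x i))))"
      using S by (simp add: trig_poly_def)
    also have "\<dots> = (\<Sum>n\<in>?P. \<Prod>i\<in>?I. c i (n i) * ee (of_int (n i) * (\<alpha> * of_int (Delta a k x i))))"
      by (rule prod_sum_PiE) auto
    also have "\<dots> = (\<Sum>n\<in>?P. ?g x n)"
    proof (rule sum.cong[OF refl])
      fix n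
      have "ee (of_int (phase a k (x, n)) * \<alpha>) = (\<Prod>i\<in>?I. ee (of_int (n i) * (\<alpha> * of_int (Delta a k x i))))"
        unfolding ee_sum[symmetric] phase_def by (simp add: sum_distrib_right mult_ac del: sum_distrib_left) (simp add: sum_distrib_left mult_ac)
      thus "(\<Prod>i\<in>?I. c i (n i) * ee (of_int (n i) * (\<alpha> * of_int (Delta a k x i)))) = ?g x n"
        by (simp add: prod.distrib)
    qed
    finally show ?thesis .
  qed
  have two: "(\<Sum>n\<in>?P. ?g x n) = (\<Prod>i\<in>?I. c i 0) + (\<Sum>n\<in>{n \<in> ?P. \<exists>i\<in>?I. n i \<noteq> 0}. ?g x n)" for x
  proof -
    have "{n \<in> ?P. \<exists>i\<in>?I. n i \<noteq> 0} = ?P - {?z}"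
    proof (intro equalityI subsetI)
      fix n assume n: "n \<in> ?P - {?z}"
      have "\<exists>i\<in>?I. n i \<noteq> 0"
      proof (rule ccontr)
        assume "\<not> (\<exists>i\<in>?I. n i \<noteq> 0)"
        hence "n = ?z" using n by (intro extensionalityI[of n ?I]) (auto simp: PiE_def)
        thus False using n by simp
      qed
      thus "n \<in> {n \<in> ?P. \<exists>i\<in>?I. n i \<noteq> 0}" using n by simp
    qed auto
    moreover have "?g x ?z = (\<Prod>i\<in>?I. c i 0)" by (simp add: phase_def)
    ultimately show ?thesis using sum.remove[OF finP zP, of "?g x"] by simp
  qed
  have "complex_of_real (product_correlation a k N S \<alpha>) = (1 / of_nat N) * (\<Sum>x\<in>?X. \<Sum>n\<in>?P. ?g x n)"
    unfolding product_correlation_def by (simp only: of_real_mult of_real_divide of_real_1 of_real_of_nat_eq of_real_sum one)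
  also have "(\<Sum>x\<in>?X. \<Sum>n\<in>?P. ?g x n) = of_nat (card ?X) * (\<Prod>i\<in>?I. c i 0)
      + (\<Sum>x\<in>?X. \<Sum>n\<in>{n \<in> ?P. \<exists>i\<in>?I. n i \<noteq> 0}. ?g x n)"
    unfolding two sum.distrib by simp
  also have "(\<Sum>x\<in>?X. \<Sum>n\<in>{n \<in> ?P. \<exists>i\<in>?I. n i \<noteq> 0}. ?g x n)
    = (\<Sum>w\<in>frequencies k N D. (\<Prod>i\<in>?I. c i (snd w i)) * ee (of_int (phase a k w) * \<alpha>))"
  proof -
    have "frequencies k N D = ?X \<times> {n \<in> ?P. \<exists>i\<in>?I. n i \<noteq> 0}" by (auto simp: frequencies_def)
    thus ?thesis by (simp add: sum.cartesian_product case_prod_beta)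
  qed
  also have "(\<Prod>i\<in>?I. c i 0) = of_real (\<Prod>i\<in>?I. l i)" using c0 by simp
  finally show ?thesis
    by (simp add: distrib_left sum_distrib_left mult.assoc del: of_real_prod)
qed

lemma (in lacunary_tail) product_correlation_variance:
  assumes k: "k \<ge> 2" and N: "1 \<le> N" "N \<le> 2 * D" and G: "\<rho> ^ G > 16 * real k * real D"
    and S: "\<And>i. i \<in> {1..k - 1} \<Longrightarrow> approx_indicator D (lo i) (hi i) \<eta> (c i) (S i)"
    and lohi: "\<And>i. i \<in> {1..k - 1} \<Longrightarrow> lo i \<le> hi i"
  shows "integral {t..t + 1} (\<lambda>\<alpha>. (product_correlation a k N S \<alpha>
      - (1 / real N) * real (card (distinct_tuples k N)) * (\<Prod>i\<in>{1..k - 1}. hi i - lo i))\<^sup>2)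
    \<le> ((1 / real N) * (\<Prod>i\<in>{1..k - 1}. hi i - lo i))\<^sup>2 *
      real (2 * k * (4 ^ k + x0) * (16 * D * (G + 1) * k * (x0 + 1)) ^ (2 * k - 1))"
proof -
  let ?I = "{1..k - 1}"
  let ?c = "\<lambda>w. (1 / of_nat N) * (\<Prod>i\<in>?I. c i (snd w i))"
  let ?K = "(1 / real N) * (\<Prod>i\<in>?I. hi i - lo i)"
  have Sc: "of_real (S i y) = trig_poly D (c i) y" if "i \<in> ?I" for i y using S[OF that] by (simp add: approx_indicator_def)
  have c0: "c i 0 = of_real (hi i - lo i)" if "i \<in> ?I" for i using S[OF that] by (simp add: approx_indicator_def)
  have cn: "norm (c i n) \<le> hi i - lo i" if "i \<in> ?I" "\<bar>n\<bar> \<le> int D" for i n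
    using S[OF that(1)] that(2) by (auto simp: approx_indicator_def)
  have F: "complex_of_real (product_correlation a k N S \<alpha>
      - (1 / real N) * real (card (distinct_tuples k N)) * (\<Prod>i\<in>?I. hi i - lo i))
    = (\<Sum>w\<in>frequencies k N D. ?c w * ee (of_int (phase a k w) * \<alpha>))" for \<alpha>
    by (rule product_correlation_expand) (simp_all add: Sc c0)
  have "norm (\<Sum>w\<in>frequencies k N D. ?c w * ee (of_int (phase a k w) * \<alpha>))
    = \<bar>product_correlation a k N S \<alpha>
      - (1 / real N) * real (card (distinct_tuples k N)) * (\<Prod>i\<in>?I. hi i - lo i)\<bar>" for \<alpha>
    by (simp only: F[symmetric] norm_of_real)
  hence eq: "(product_correlation a k N S \<alpha>
      - (1 / real N) * real (card (distinct_tuples k N)) * (\<Prod>i\<in>?I. hi i - lo i))\<^sup>2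
    = (norm (\<Sum>w\<in>frequencies k N D. ?c w * ee (of_int (phase a k w) * \<alpha>)))\<^sup>2" for \<alpha>
    by simp
  have K: "?K \<ge> 0" by (intro mult_nonneg_nonneg prod_nonneg) (use lohi in simp_all)
  have "integral {t..t + 1} (\<lambda>\<alpha>. (norm (\<Sum>w\<in>frequencies k N D. ?c w * ee (of_int (phase a k w) * \<alpha>)))\<^sup>2)
    \<le> ?K\<^sup>2 * real (card {(w, w') \<in> frequencies k N D \<times> frequencies k N D. phase a k w = phase a k w'})"
  proof (rule mean_square_bound[OF finite_frequencies _ K])
    fix w assume w: "w \<in> frequencies k N D"
    have "norm (\<Prod>i\<in>?I. c i (snd w i)) \<le> (\<Prod>i\<in>?I. hi i - lo i)"
      unfolding prod_norm[symmetric]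
    proof (rule prod_mono)
      fix i assume i: "i \<in> ?I"
      have "snd w \<in> ?I \<rightarrow>\<^sub>E {- int D..int D}" using w by (auto simp: frequencies_def)
      hence "snd w i \<in> {- int D..int D}" using i by (rule PiE_mem)
      thus "0 \<le> norm (c i (snd w i)) \<and> norm (c i (snd w i)) \<le> hi i - lo i" using cn[OF i] by auto
    qed
    thus "norm (?c w) \<le> ?K" by (simp add: norm_mult norm_divide divide_right_mono)
  qed
  also have "\<dots> \<le> ?K\<^sup>2 * real (2 * k * (4 ^ k + x0) * (16 * D * (G + 1) * k * (x0 + 1)) ^ (2 * k - 1))"
    by (intro mult_left_mono of_nat_mono energy_bound k N G) simp
  finally show ?thesis unfolding eq .
qed

section \<open>Almost everywhere convergence along a subsequence\<close>

text \<open>Borel-Cantelli in integral form. As \<open>1 / s ^ 2\<close> is summable, the sum of the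
  squares is integrable over each unit interval, hence finite almost everywhere there, and its terms
  tend to 0. Countably many unit intervals cover the line.\<close>

lemma AE_tendsto_0_of_mean_square:
  fixes g :: "nat \<Rightarrow> real \<Rightarrow> real"
  assumes cont: "\<And>s. continuous_on UNIV (g s)"
    and bd: "eventually (\<lambda>s. \<forall>t. integral {t..t + 1} (\<lambda>\<alpha>. (g s \<alpha>)\<^sup>2) \<le> C / real s ^ 2) sequentially"
  shows "AE \<alpha> in lborel. (\<lambda>s. g s \<alpha>) \<longlonglongrightarrow> 0"
proof -
  obtain s0 where s0: "\<And>s t. s \<ge> s0 \<Longrightarrow> integral {t..t + 1} (\<lambda>\<alpha>. (g s \<alpha>)\<^sup>2) \<le> C / real s ^ 2"
    using bd unfolding eventually_sequentially by blast
  have one: "AE \<alpha> in lborel. \<alpha> \<in> {t..t + 1} \<longrightarrow> (\<lambda>s. g s \<alpha>) \<longlonglongrightarrow> 0" for t :: real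
  proof -
    define h where "h = (\<lambda>s \<alpha>. (if \<alpha> \<in> {t..t + 1} then (g (s + s0) \<alpha>)\<^sup>2 else 0))"
    have [measurable]: "g s \<in> borel_measurable borel" for s
      using cont by (rule borel_measurable_continuous_onI)
    have meas: "h s \<in> borel_measurable borel" for s unfolding h_def by measurable
    have int: "(\<integral>\<^sup>+ \<alpha>. ennreal (h s \<alpha>) \<partial>lborel) \<le> ennreal (C / real (s + s0) ^ 2)" for s
    proof -
      have "(\<lambda>\<alpha>. (g (s + s0) \<alpha>)\<^sup>2) integrable_on {t..t + 1}"
        by (intro integrable_continuous_real continuous_intros continuous_on_subset[OF cont]) auto
      hence "((\<lambda>\<alpha>. (g (s + s0) \<alpha>)\<^sup>2) has_integral integral {t..t + 1} (\<lambda>\<alpha>. (g (s + s0) \<alpha>)\<^sup>2)) {t..t + 1}"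
        by (rule integrable_integral)
      hence "(h s has_integral integral {t..t + 1} (\<lambda>\<alpha>. (g (s + s0) \<alpha>)\<^sup>2)) UNIV"
        unfolding h_def by (subst has_integral_restrict_UNIV)
      hence "(\<integral>\<^sup>+ \<alpha>. ennreal (h s \<alpha>) \<partial>lborel) = ennreal (integral {t..t + 1} (\<lambda>\<alpha>. (g (s + s0) \<alpha>)\<^sup>2))"
        by (intro nn_integral_has_integral_lborel meas) (auto simp: h_def)
      also have "\<dots> \<le> ennreal (C / real (s + s0) ^ 2)" by (intro ennreal_leI s0) simp
      finally show ?thesis .
    qed
    have C: "C \<ge> 0"
    proof -
      have "0 \<le> integral {0..0 + 1} (\<lambda>\<alpha>. (g (Suc s0) \<alpha>)\<^sup>2)"
        by (intro integral_nonneg integrable_continuous_real continuous_intros continuous_on_subset[OF cont]) auto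
      also have "\<dots> \<le> C / real (Suc s0) ^ 2" by (rule s0) simp
      finally show ?thesis by (simp add: field_simps)
    qed
    have summ: "summable (\<lambda>s. C / real (s + s0) ^ 2)"
      using summable_mult[OF summable_ignore_initial_segment[OF inverse_power_summable[of 2, where 'a = real]], of C s0]
      by (simp add: divide_inverse)
    have "(\<integral>\<^sup>+ \<alpha>. (\<Sum>s. ennreal (h s \<alpha>)) \<partial>lborel) = (\<Sum>s. \<integral>\<^sup>+ \<alpha>. ennreal (h s \<alpha>) \<partial>lborel)"
      by (intro nn_integral_suminf) (use meas in auto)
    also have "\<dots> \<le> (\<Sum>s. ennreal (C / real (s + s0) ^ 2))" by (intro suminf_le int) auto
    also have "\<dots> = ennreal (\<Sum>s. C / real (s + s0) ^ 2)" using C by (intro suminf_ennreal2 summ) auto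
    finally have "(\<integral>\<^sup>+ \<alpha>. (\<Sum>s. ennreal (h s \<alpha>)) \<partial>lborel) \<noteq> \<infinity>" by (auto simp: top_unique)
    hence "AE \<alpha> in lborel. (\<Sum>s. ennreal (h s \<alpha>)) \<noteq> \<infinity>"
      by (intro nn_integral_PInf_AE) (use meas in auto)
    thus ?thesis
    proof eventually_elim
      case (elim \<alpha>)
      show ?case
      proof
        assume \<alpha>: "\<alpha> \<in> {t..t + 1}"
        have "summable (\<lambda>s. h s \<alpha>)"
          by (rule summable_suminf_not_top) (use elim in \<open>auto simp: h_def\<close>)
        hence "(\<lambda>s. h s \<alpha>) \<longlonglongrightarrow> 0" by (rule summable_LIMSEQ_zero)
        hence "(\<lambda>s. (g (s + s0) \<alpha>)\<^sup>2) \<longlonglongrightarrow> 0" using \<alpha> by (simp add: h_def)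
        hence "(\<lambda>s. sqrt ((g (s + s0) \<alpha>)\<^sup>2)) \<longlonglongrightarrow> sqrt 0" by (rule tendsto_real_sqrt)
        hence "(\<lambda>s. g (s + s0) \<alpha>) \<longlonglongrightarrow> 0" by (simp add: tendsto_rabs_zero_iff)
        thus "(\<lambda>s. g s \<alpha>) \<longlonglongrightarrow> 0" by (rule LIMSEQ_offset)
      qed
    qed
  qed
  have "AE \<alpha> in lborel. \<forall>t :: int. \<alpha> \<in> {of_int t..of_int t + 1} \<longrightarrow> (\<lambda>s. g s \<alpha>) \<longlonglongrightarrow> 0"
    by (subst AE_all_countable) (use one in blast)
  thus ?thesis
  proof eventually_elim
    case (elim \<alpha>)
    have "\<alpha> \<in> {of_int \<lfloor>\<alpha>\<rfloor>..of_int \<lfloor>\<alpha>\<rfloor> + 1}" by (auto intro: less_imp_le)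
    thus ?case using elim by blast
  qed
qed

section \<open>The number of tuples with distinct entries\<close>

lemma card_distinct_tuples_le: "real (card (distinct_tuples k N)) \<le> real N ^ k"
proof -
  have "card (distinct_tuples k N) \<le> card ({1..k} \<rightarrow>\<^sub>E {1..N})"
    by (intro card_mono finite_PiE) (auto simp: distinct_tuples_def)
  thus ?thesis by (simp add: card_PiE flip: of_nat_power)
qed

text \<open>A union bound over the pairs of positions that may carry equal entries: such a tuple is
  determined by its other \<open>k - 1\<close> entries.\<close>

lemma card_distinct_tuples_ge: "real N ^ k - real (k\<^sup>2) * real N ^ (k - 1) \<le> real (card (distinct_tuples k N))"
proof -
  let ?X = "{1..k} \<rightarrow>\<^sub>E {1..N}"
  define A where "A = (\<lambda>(i, j). {x \<in> ?X. i \<noteq> j \<and> x i = x j})"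
  have finX: "finite ?X" by (intro finite_PiE) auto
  have cA: "card (A p) \<le> N ^ (k - 1)" if "p \<in> {1..k} \<times> {1..k}" for p
  proof -
    obtain i j where p: "p = (i, j)" by (cases p)
    have ij: "i \<in> {1..k}" "j \<in> {1..k}" using that p by auto
    have "inj_on (\<lambda>x. restrict x ({1..k} - {j})) (A p)"
    proof (rule inj_onI)
      fix x y assume xy: "x \<in> A p" "y \<in> A p" and eq: "restrict x ({1..k} - {j}) = restrict y ({1..k} - {j})"
      have r: "x l = y l" if "l \<in> {1..k} - {j}" for l using fun_cong[OF eq, of l] that by simp
      have "x j = x i" "y j = y i" "i \<noteq> j" using xy by (auto simp: A_def p)
      hence "x j = y j" using r[of i] ij by auto
      hence "x l = y l" if "l \<in> {1..k}" for l using r[of l] that by (cases "l = j") auto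
      moreover have "x \<in> extensional {1..k}" "y \<in> extensional {1..k}" using xy by (auto simp: A_def p PiE_def)
      ultimately show "x = y" by (intro extensionalityI)
    qed
    hence "card (A p) = card ((\<lambda>x. restrict x ({1..k} - {j})) ` A p)" by (simp add: card_image)
    also have "\<dots> \<le> card (({1..k} - {j}) \<rightarrow>\<^sub>E {1..N})"
      by (intro card_mono finite_PiE image_subsetI) (auto simp: A_def p dest!: PiE_mem)
    also have "\<dots> = N ^ (k - 1)" using ij by (simp add: card_PiE)
    finally show ?thesis .
  qed
  have "?X \<subseteq> distinct_tuples k N \<union> (\<Union>p\<in>{1..k} \<times> {1..k}. A p)"
    by (auto simp: distinct_tuples_def inj_on_def A_def)
  hence "card ?X \<le> card (distinct_tuples k N \<union> (\<Union>p\<in>{1..k} \<times> {1..k}. A p))"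
    by (intro card_mono) (use finX finite_distinct_tuples in \<open>auto simp: A_def\<close>)
  also have "\<dots> \<le> card (distinct_tuples k N) + card (\<Union>p\<in>{1..k} \<times> {1..k}. A p)" by (rule card_Un_le)
  also have "card (\<Union>p\<in>{1..k} \<times> {1..k}. A p) \<le> (\<Sum>p\<in>{1..k} \<times> {1..k}. card (A p))"
    by (rule card_UN_le) auto
  also have "\<dots> \<le> (\<Sum>p\<in>{1..k} \<times> {1..k}. N ^ (k - 1))" by (intro sum_mono cA)
  also have "\<dots> = k\<^sup>2 * N ^ (k - 1)" by (simp add: power2_eq_square)
  finally have "N ^ k \<le> card (distinct_tuples k N) + k\<^sup>2 * N ^ (k - 1)" by (simp add: card_PiE)
  hence "real (N ^ k) \<le> real (card (distinct_tuples k N) + k\<^sup>2 * N ^ (k - 1))" by (rule of_nat_mono)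
  thus ?thesis by simp
qed

lemma card_distinct_tuples_asymp:
  assumes "k \<ge> 1"
  shows "(\<lambda>N. real (card (distinct_tuples k N)) / real N ^ k) \<longlonglongrightarrow> 1"
proof (rule tendsto_sandwich)
  show "eventually (\<lambda>N. 1 - real (k\<^sup>2) / real N \<le> real (card (distinct_tuples k N)) / real N ^ k) sequentially"
    using eventually_gt_at_top[of 0]
  proof eventually_elim
    case (elim N)
    have "real N ^ k = real N * real N ^ (k - 1)" using assms by (cases k) auto
    hence "(1 - real (k\<^sup>2) / real N) * real N ^ k = real N ^ k - real (k\<^sup>2) * real N ^ (k - 1)"
      using elim by (simp add: field_simps)
    also have "\<dots> \<le> real (card (distinct_tuples k N))" by (rule card_distinct_tuples_ge)
    finally show ?case using elim by (simp add: field_simps)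
  qed
  show "eventually (\<lambda>N. real (card (distinct_tuples k N)) / real N ^ k \<le> 1) sequentially"
    using eventually_gt_at_top[of 0]
  proof eventually_elim
    case (elim N)
    thus ?case using card_distinct_tuples_le[of k N] by (simp add: field_simps)
  qed
  show "(\<lambda>N. 1 - real (k\<^sup>2) / real N) \<longlonglongrightarrow> 1" by real_asymp
qed simp

text \<open>It records whether a translate falls into the interval and not how many do, so it stays
  between 0 and 1 for every \<open>N\<close>; once \<open>N\<close> exceeds the length of the
  interval there is at most one. Half-open intervals allow grid cells to tile a box.\<close>

definition hits :: "real \<Rightarrow> real \<Rightarrow> nat \<Rightarrow> real \<Rightarrow> real" where
  "hits lo hi N y = of_bool (\<exists>m :: int. lo \<le> real N * (of_int m + y) \<and> real N * (of_int m + y) < hi)"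

definition box_correlation ::
    "(nat \<Rightarrow> int) \<Rightarrow> nat \<Rightarrow> (nat \<Rightarrow> real) \<Rightarrow> (nat \<Rightarrow> real) \<Rightarrow> nat \<Rightarrow> real \<Rightarrow> real" where
  "box_correlation a k lo hi N = product_correlation a k N (\<lambda>i. hits (lo i) (hi i) N)"

lemma box_correlation_eq: "box_correlation a k lo hi N \<alpha> = (1 / real N) * (\<Sum>x\<in>distinct_tuples k N.
     \<Prod>i\<in>{1..k - 1}. hits (lo i) (hi i) N (\<alpha> * real_of_int (Delta a k x i)))"
  by (simp add: box_correlation_def product_correlation_def)

lemma hits_bounds: "0 \<le> hits lo hi N y" "hits lo hi N y \<le> 1"
  by (auto simp: hits_def)

text \<open>A margin \<kappa> on the scale of \<open>hits\<close> is a distance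
  \<open>\<kappa> / real N\<close> modulo 1, which is where the tail bound is evaluated.\<close>

lemma hits_le_approx:
  assumes "approx_indicator D (lo / real N) (hi / real N) \<eta> c S" "N > 0" "\<kappa> > 0"
    and "lo + \<kappa> \<le> lo'" "hi' \<le> hi - \<kappa>" "\<eta> (\<kappa> / real N) \<ge> 0"
  shows "hits lo' hi' N y \<le> S y + \<eta> (\<kappa> / real N)"
proof (cases "\<exists>m :: int. lo' \<le> real N * (of_int m + y) \<and> real N * (of_int m + y) < hi'")
  case True
  then obtain m :: int where m: "lo' \<le> real N * (of_int m + y)" "real N * (of_int m + y) < hi'" by blast
  have "lo / real N + \<kappa> / real N = (lo + \<kappa>) / real N" by (simp add: add_divide_distrib)
  also have "\<dots> \<le> y + of_int m" using m assms by (simp add: divide_le_eq mult.commute add.commute)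
  finally have 1: "lo / real N + \<kappa> / real N \<le> y + of_int m" .
  have "y + of_int m \<le> (hi - \<kappa>) / real N" using m assms by (simp add: le_divide_eq mult.commute add.commute)
  also have "\<dots> = hi / real N - \<kappa> / real N" by (simp add: diff_divide_distrib)
  finally have "1 - S y \<le> \<eta> (\<kappa> / real N)" using assms 1 unfolding approx_indicator_def by (metis divide_pos_pos of_nat_0_less_iff)
  thus ?thesis using hits_bounds(2)[of lo' hi' N y] by linarith
next
  case False
  hence "hits lo' hi' N y = 0" by (simp only: hits_def of_bool_def if_False)
  moreover have "0 \<le> S y" using assms(1) by (simp add: approx_indicator_def)
  ultimately show ?thesis using assms(6) by linarith
qed

lemma approx_le_hits:
  assumes "approx_indicator D (lo / real N) (hi / real N) \<eta> c S" "N > 0" "\<kappa> > 0"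
    and "lo' \<le> lo - \<kappa>" "hi + \<kappa> \<le> hi'" "\<eta> (\<kappa> / real N) \<ge> 0"
  shows "S y \<le> hits lo' hi' N y + \<eta> (\<kappa> / real N)"
proof (cases "\<exists>m :: int. lo' \<le> real N * (of_int m + y) \<and> real N * (of_int m + y) < hi'")
  case True
  hence "hits lo' hi' N y = 1" by (simp add: hits_def)
  moreover have "S y \<le> 1" using assms by (simp add: approx_indicator_def)
  ultimately show ?thesis using assms by linarith
next
  case False
  have "y + of_int m \<le> lo / real N - \<kappa> / real N \<or> hi / real N + \<kappa> / real N \<le> y + of_int m" for m :: int
  proof -
    have "real N * (of_int m + y) < lo' \<or> hi' \<le> real N * (of_int m + y)" using False by (meson not_le)
    thus ?thesis
    proof
      assume *: "real N * (of_int m + y) < lo'"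
      have "y + of_int m \<le> (lo - \<kappa>) / real N" using * assms by (simp add: le_divide_eq mult.commute add.commute)
      thus ?thesis by (simp add: diff_divide_distrib)
    next
      assume *: "hi' \<le> real N * (of_int m + y)"
      have "(hi + \<kappa>) / real N \<le> y + of_int m" using * assms by (simp add: divide_le_eq mult.commute add.commute)
      thus ?thesis by (simp add: add_divide_distrib)
    qed
  qed
  hence "S y \<le> \<eta> (\<kappa> / real N)" using assms unfolding approx_indicator_def by (metis divide_pos_pos of_nat_0_less_iff)
  thus ?thesis using hits_bounds(1)[of lo' hi' N y] by linarith
qed

text \<open>The hypothesis is one-sided. Raising each \<open>u i\<close> to
  \<open>max (u i) (v i)\<close> does not decrease the product and makes the comparison with
  \<open>v\<close> two-sided, so the usual telescoping estimate for differences of products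
  applies.\<close>

lemma prod_le_prod_plus:
  fixes u v :: "'i \<Rightarrow> real"
  assumes "\<And>i. i \<in> I \<Longrightarrow> 0 \<le> u i \<and> u i \<le> 1" "\<And>i. i \<in> I \<Longrightarrow> 0 \<le> v i \<and> v i \<le> 1"
    and "\<And>i. i \<in> I \<Longrightarrow> u i \<le> v i + e" "e \<ge> 0"
  shows "(\<Prod>i\<in>I. u i) \<le> (\<Prod>i\<in>I. v i) + real (card I) * e"
proof -
  define w where "w = (\<lambda>i. max (u i) (v i))"
  have w: "0 \<le> w i \<and> w i \<le> 1 \<and> \<bar>w i - v i\<bar> \<le> e \<and> u i \<le> w i" if "i \<in> I" for i
    using assms(1-3)[OF that] assms(4) unfolding w_def by auto
  have "(\<Prod>i\<in>I. u i) \<le> (\<Prod>i\<in>I. w i)" using assms(1) w by (intro prod_mono) auto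
  moreover have "norm ((\<Prod>i\<in>I. w i) - (\<Prod>i\<in>I. v i)) \<le> (\<Sum>i\<in>I. norm (w i - v i))"
    by (rule norm_prod_diff) (use w assms(2) in auto)
  moreover have "(\<Sum>i\<in>I. norm (w i - v i)) \<le> real (card I) * e"
    using w sum_bounded_above[of I "\<lambda>i. norm (w i - v i)" e] by simp
  ultimately show ?thesis by simp
qed


text \<open>The error is simply added up over all tuples. The resulting factor \<open>N ^ k\<close>
  is harmless because the kernel tail decays faster.\<close>

lemma product_correlation_le:
  assumes N: "N > 0" and e: "e \<ge> 0"
    and u: "\<And>i y. i \<in> {1..k - 1} \<Longrightarrow> 0 \<le> u i y \<and> u i y \<le> 1"
    and v: "\<And>i y. i \<in> {1..k - 1} \<Longrightarrow> 0 \<le> v i y \<and> v i y \<le> 1"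
    and uv: "\<And>i y. i \<in> {1..k - 1} \<Longrightarrow> u i y \<le> v i y + e"
  shows "product_correlation a k N u \<alpha> \<le> product_correlation a k N v \<alpha> + real N ^ k * (real k * e)"
proof -
  let ?p = "\<lambda>w x. \<Prod>i\<in>{1..k - 1}. w i (\<alpha> * real_of_int (Delta a k x i))"
  let ?X = "distinct_tuples k N"
  have "?p u x \<le> ?p v x + real k * e" for x
  proof -
    have "?p u x \<le> ?p v x + real (card {1..k - 1}) * e"
      by (rule prod_le_prod_plus) (use u v uv e in auto)
    also have "real (card {1..k - 1}) * e \<le> real k * e" by (intro mult_right_mono e) simp
    finally show ?thesis by simp
  qed
  hence "(\<Sum>x\<in>?X. ?p u x) \<le> (\<Sum>x\<in>?X. ?p v x + real k * e)" by (intro sum_mono)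
  also have "\<dots> = (\<Sum>x\<in>?X. ?p v x) + real (card ?X) * (real k * e)" by (simp add: sum.distrib)
  finally have "product_correlation a k N u \<alpha> \<le> (1 / real N) * ((\<Sum>x\<in>?X. ?p v x) + real (card ?X) * (real k * e))"
    unfolding product_correlation_def by (intro mult_left_mono) auto
  also have "\<dots> = product_correlation a k N v \<alpha> + (1 / real N) * (real (card ?X) * (real k * e))"
    unfolding product_correlation_def by (simp add: distrib_left)
  also have "(1 / real N) * (real (card ?X) * (real k * e)) \<le> 1 * (real N ^ k * (real k * e))"
    using N e card_distinct_tuples_le[of k N] by (intro mult_mono) auto
  finally show ?thesis by simp
qed

lemma box_correlation_sandwich:
  assumes S: "\<And>i. i \<in> {1..k - 1} \<Longrightarrow> approx_indicator D (lo i / real N) (hi i / real N) \<eta> (c i) (S i)"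
    and N: "N > 0" and \<kappa>: "\<kappa> > 0" and \<eta>: "\<eta> (\<kappa> / real N) \<ge> 0"
  shows "(\<And>i. i \<in> {1..k - 1} \<Longrightarrow> lo i + \<kappa> \<le> lo' i \<and> hi' i \<le> hi i - \<kappa>) \<Longrightarrow>
      box_correlation a k lo' hi' N \<alpha> \<le> product_correlation a k N S \<alpha> + real N ^ k * (real k * \<eta> (\<kappa> / real N))"
    and "(\<And>i. i \<in> {1..k - 1} \<Longrightarrow> lo' i \<le> lo i - \<kappa> \<and> hi i + \<kappa> \<le> hi' i) \<Longrightarrow>
      product_correlation a k N S \<alpha> \<le> box_correlation a k lo' hi' N \<alpha> + real N ^ k * (real k * \<eta> (\<kappa> / real N))"
proof -
  have S01: "0 \<le> S i y \<and> S i y \<le> 1" if "i \<in> {1..k - 1}" for i y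
    using S[OF that] by (simp add: approx_indicator_def)
  show "box_correlation a k lo' hi' N \<alpha> \<le> product_correlation a k N S \<alpha> + real N ^ k * (real k * \<eta> (\<kappa> / real N))"
    if "\<And>i. i \<in> {1..k - 1} \<Longrightarrow> lo i + \<kappa> \<le> lo' i \<and> hi' i \<le> hi i - \<kappa>"
    unfolding box_correlation_def
    by (rule product_correlation_le[OF N \<eta>]) (use S01 hits_bounds hits_le_approx[OF S N \<kappa> _ _ \<eta>] that in auto)
  show "product_correlation a k N S \<alpha> \<le> box_correlation a k lo' hi' N \<alpha> + real N ^ k * (real k * \<eta> (\<kappa> / real N))"
    if "\<And>i. i \<in> {1..k - 1} \<Longrightarrow> lo' i \<le> lo i - \<kappa> \<and> hi i + \<kappa> \<le> hi' i"
    unfolding box_correlation_def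
    by (rule product_correlation_le[OF N \<eta>]) (use S01 hits_bounds approx_le_hits[OF S N \<kappa> _ _ \<eta>] that in auto)
qed

text \<open>With \<open>q\<close> the exponent of \<open>s\<close> in the degree, this is what
  permits the gap \<open>G = s\<close>.\<close>

lemma eventually_power_less:
  fixes \<rho> C :: real assumes "\<rho> > 1"
  shows "eventually (\<lambda>s. C * real s ^ q < \<rho> ^ s) sequentially"
proof -
  have "((\<lambda>s. C * real s ^ q / \<rho> ^ s) \<longlonglongrightarrow> 0)" using assms by real_asymp
  hence "eventually (\<lambda>s. C * real s ^ q / \<rho> ^ s < 1) sequentially" by (rule order_tendstoD) simp
  thus ?thesis by eventually_elim (use assms in \<open>simp add: field_simps\<close>)
qed

lemma variance_decay:
  fixes P :: real
  assumes k: "k \<ge> 1" and s: "s \<ge> 1"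
  shows "((1 / real (s ^ (4 * k))) * (P / real (s ^ (4 * k)) ^ (k - 1)))\<^sup>2 *
      real (2 * k * (4 ^ k + x0) * (16 * (r * (2 * s ^ (4 * k + 1))) * (s + 1) * k * (x0 + 1)) ^ (2 * k - 1))
    \<le> P\<^sup>2 * real (2 * k * (4 ^ k + x0)) * real (64 * r * k * (x0 + 1)) ^ (2 * k - 1) / real s ^ 2"
proof -
  let ?X = "(16 * (r * (2 * s ^ (4 * k + 1))) * (s + 1) * k * (x0 + 1)) ^ (2 * k - 1)"
  let ?Q = "real (2 * k * (4 ^ k + x0))"
  let ?A = "64 * r * k * (x0 + 1)"
  have s0: "real s > 0" using s by simp
  have pw: "real ((A * s ^ e) ^ n) = real A ^ n * real s ^ (e * n)" for A e n
    by (simp add: power_mult_distrib power_mult)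
  have "16 * (r * (2 * s ^ (4 * k + 1))) * (s + 1) * k * (x0 + 1) \<le> 16 * (r * (2 * s ^ (4 * k + 1))) * (2 * s) * k * (x0 + 1)"
    using s by (intro mult_right_mono mult_left_mono) auto
  also have "\<dots> = ?A * s ^ (4 * k + 2)" by (simp add: power_add power2_eq_square algebra_simps)
  finally have "real ?X
    \<le> real ((?A * s ^ (4 * k + 2)) ^ (2 * k - 1))"
    by (intro of_nat_mono power_mono) auto
  also have "\<dots> = real ?A ^ (2 * k - 1) * real s ^ ((4 * k + 2) * (2 * k - 1))"
    by (rule pw)
  finally have 1: "real ?X
    \<le> real ?A ^ (2 * k - 1) * real s ^ ((4 * k + 2) * (2 * k - 1))" .
  have 2: "(1 / real (s ^ (4 * k))) * (P / real (s ^ (4 * k)) ^ (k - 1)) = P / real s ^ (4 * k * k)"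
  proof -
    have "real (s ^ (4 * k)) * real (s ^ (4 * k)) ^ (k - 1) = real (s ^ (4 * k)) ^ k"
      using k by (cases k) auto
    also have "\<dots> = real s ^ (4 * k * k)" by (simp add: power_mult)
    finally show ?thesis by simp
  qed
  \<comment> \<open>The right side is the exponent of \<open>s\<close> in \<open>N ^ (2 * k)\<close>
    for \<open>N = s ^ (4 * k)\<close>, and \<open>4 * k + 2\<close> is the exponent in the cost of
    one index; the difference 2 is the decay of the variance.\<close>
  have "(4 * k + 2) * (2 * k - 1) + 2 = 4 * k * k * 2"
  proof -
    obtain l where "k = Suc l" using k by (cases k) auto
    thus ?thesis by (simp add: algebra_simps)
  qed
  hence 3: "real s ^ ((4 * k + 2) * (2 * k - 1)) * real s ^ 2 = (real s ^ (4 * k * k))\<^sup>2"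
    by (simp only: power_add[symmetric] power_mult[symmetric])
  have "((1 / real (s ^ (4 * k))) * (P / real (s ^ (4 * k)) ^ (k - 1)))\<^sup>2 *
      real (2 * k * (4 ^ k + x0) * ?X)
    = (P\<^sup>2 / (real s ^ (4 * k * k))\<^sup>2) * ?Q * real ?X"
    unfolding 2 power_divide of_nat_mult[of "2 * k * (4 ^ k + x0)"] by (rule mult.assoc[symmetric])
  also have "\<dots> \<le> (P\<^sup>2 / (real s ^ (4 * k * k))\<^sup>2) * ?Q * (real ?A ^ (2 * k - 1) * real s ^ ((4 * k + 2) * (2 * k - 1)))"
    by (intro mult_left_mono 1) auto
  also have "\<dots> = P\<^sup>2 * ?Q * real ?A ^ (2 * k - 1) / real s ^ 2"
    unfolding 3[symmetric] using s0 by (simp add: field_simps del: of_nat_mult of_nat_add)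
  finally show ?thesis .
qed

text \<open>The kernel parameter exceeds the scale \<open>s ^ p\<close> by a factor
  \<open>s\<close>, so the tail gains \<open>s ^ (2 * r)\<close>. It has to pay
  \<open>s ^ (p * k)\<close> for the tuples and \<open>s ^ (p + 1)\<close> for the normalisation of
  the kernel; \<open>r = p * (k + 1)\<close> covers both with at least two powers to spare.\<close>

lemma tail_decay:
  assumes k: "k \<ge> 2" and s: "s \<ge> 1" and \<kappa>: "\<kappa> > 0" and p: "p = 4 * k" and r: "r = p * (k + 1)"
  shows "real (s ^ p) ^ k * (real k * jackson_tail (s ^ (p + 1)) r (\<kappa> / real (s ^ p)))
    \<le> real k * (1 / \<kappa>) ^ (2 * r) * real (4 * r + 1) / real s ^ 2"
proof -
  have s0: "real s \<ge> 1" using s by simp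
  have "p + 1 + p * k + 2 \<le> 2 * r"
  proof -
    have "3 \<le> p" using p k by simp
    moreover have "p \<le> p * k" using k by simp
    ultimately have "p + 1 + p * k + 2 \<le> p * k + p * k + p + p" by linarith
    thus ?thesis by (simp add: r algebra_simps)
  qed
  hence le: "real s ^ (p + 1 + p * k + 2) \<le> real s ^ (2 * r)" by (intro power_increasing s0)
  have "real (4 * r * s ^ (p + 1) + 1) \<le> real (4 * r + 1) * real s ^ (p + 1)"
    using one_le_power[OF s0, of "p + 1"] by (simp add: algebra_simps)
  hence "real (s ^ p) ^ k * (real k * jackson_tail (s ^ (p + 1)) r (\<kappa> / real (s ^ p)))
    \<le> real (s ^ p) ^ k * (real k * ((1 / (\<kappa> / real (s ^ p))) ^ (2 * r) * (real (4 * r + 1) * real s ^ (p + 1)) / real (s ^ (p + 1)) ^ (2 * r)))"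
    unfolding jackson_tail_def using \<kappa>
    by (intro mult_left_mono divide_right_mono) (auto simp: of_nat_Suc mult.assoc)
  also have "\<dots> = real k * (1 / \<kappa>) ^ (2 * r) * real (4 * r + 1) * (real s ^ (p + 1 + p * k) / real s ^ (2 * r))"
  proof -
    define A where "A = real (s ^ p) ^ (2 * r)"
    have "real (s ^ (p + 1)) ^ (2 * r) = A * real s ^ (2 * r)"
      by (simp add: power_mult_distrib A_def)
    moreover have "(1 / (\<kappa> / real (s ^ p))) ^ (2 * r) = (1 / \<kappa>) ^ (2 * r) * A"
      by (simp add: power_mult_distrib[symmetric] A_def)
    moreover have "real (s ^ p) ^ k = real s ^ (p * k)" by (simp add: power_mult)
    moreover have "A \<noteq> 0" using s by (simp add: A_def)
    ultimately show ?thesis by (simp add: power_add del: of_nat_power)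
  qed
  also have "\<dots> \<le> real k * (1 / \<kappa>) ^ (2 * r) * real (4 * r + 1) * (1 / real s ^ 2)"
  proof (rule mult_left_mono)
    show "real s ^ (p + 1 + p * k) / real s ^ (2 * r) \<le> 1 / real s ^ 2"
      using le s by (simp add: power_add power2_eq_square field_simps)
  qed (use \<kappa> in auto)
  finally show ?thesis by simp
qed

text \<open>The comparison is with strictly smaller and strictly larger boxes, so that countably many pairs
  \<open>lo, hi\<close> control all boxes.\<close>

definition majorizes_smaller_boxes :: "(nat \<Rightarrow> int) \<Rightarrow> nat \<Rightarrow> (nat \<Rightarrow> real) \<Rightarrow> (nat \<Rightarrow> real) \<Rightarrow> real \<Rightarrow> (nat \<Rightarrow> real) \<Rightarrow> bool" where
  "majorizes_smaller_boxes a k lo hi \<alpha> W \<longleftrightarrow> (\<forall>\<kappa>>0. \<forall>lo' hi'. (\<forall>i\<in>{1..k - 1}. lo i + \<kappa> \<le> lo' i \<and> hi' i \<le> hi i - \<kappa>) \<longrightarrow>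
      eventually (\<lambda>s. box_correlation a k lo' hi' (s ^ (4 * k)) \<alpha> \<le> W s + 1 / real s) sequentially)"

definition minorizes_larger_boxes :: "(nat \<Rightarrow> int) \<Rightarrow> nat \<Rightarrow> (nat \<Rightarrow> real) \<Rightarrow> (nat \<Rightarrow> real) \<Rightarrow> real \<Rightarrow> (nat \<Rightarrow> real) \<Rightarrow> bool" where
  "minorizes_larger_boxes a k lo hi \<alpha> W \<longleftrightarrow> (\<forall>\<kappa>>0. \<forall>lo' hi'. (\<forall>i\<in>{1..k - 1}. lo' i \<le> lo i - \<kappa> \<and> hi i + \<kappa> \<le> hi' i) \<longrightarrow>
      eventually (\<lambda>s. W s \<le> box_correlation a k lo' hi' (s ^ (4 * k)) \<alpha> + 1 / real s) sequentially)"

definition subsequence_approx :: "(nat \<Rightarrow> int) \<Rightarrow> nat \<Rightarrow> (nat \<Rightarrow> real) \<Rightarrow> (nat \<Rightarrow> real) \<Rightarrow> real \<Rightarrow> bool" where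
  "subsequence_approx a k lo hi \<alpha> \<longleftrightarrow> (\<exists>W. W \<longlonglongrightarrow> (\<Prod>i\<in>{1..k - 1}. hi i - lo i) \<and>
    majorizes_smaller_boxes a k lo hi \<alpha> W \<and> minorizes_larger_boxes a k lo hi \<alpha> W)"

text \<open>For the smoothed sums, with \<open>N = s ^ p\<close>, kernel parameter
  \<open>s ^ (p + 1)\<close> and gap \<open>G = s\<close>, the variance is summable in
  \<open>s\<close>; the mean tends to the volume of the box because almost all tuples have distinct
  entries.\<close>

lemma (in lacunary_tail) subsequence_limit:
  assumes k: "k \<ge> 2" and lohi: "\<And>i. i \<in> {1..k - 1} \<Longrightarrow> lo i < hi i"
  shows "AE \<alpha> in lborel. subsequence_approx a k lo hi \<alpha>"
proof -
  let ?I = "{1..k - 1}"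
  define p where "p = 4 * k"
  define r where "r = p * (k + 1)"
  define D where "D = (\<lambda>s. r * (2 * s ^ (p + 1)))"
  define P where "P = (\<Prod>i\<in>?I. hi i - lo i)"
  \<comment> \<open>Smoothing requires intervals shorter than the period 1, which holds after
    scaling once \<open>s ^ p\<close> exceeds all side lengths.\<close>
  define good where "good = (\<lambda>s. s \<ge> 1 \<and> (\<forall>i\<in>?I. hi i - lo i < real (s ^ p)))"
  have p1: "p \<ge> 1" using k by (simp add: p_def)
  have ev_good: "eventually good sequentially"
  proof -
    have "eventually (\<lambda>s. \<forall>i\<in>?I. hi i - lo i < real s) sequentially"
      by (intro eventually_ball_finite ballI eventually_compose_filterlim[OF eventually_gt_at_top filterlim_real_sequentially]) auto
    with eventually_ge_at_top[of 1] show ?thesis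
    proof eventually_elim
      case (elim s)
      have "s ^ 1 \<le> s ^ p" using p1 elim by (intro power_increasing) auto
      hence "real s \<le> real (s ^ p)" by (intro of_nat_mono) simp
      thus ?case using elim by (auto simp: good_def intro: less_le_trans)
    qed
  qed
  have "\<exists>c S. good s \<and> i \<in> ?I \<longrightarrow> approx_indicator (D s) (lo i / real (s ^ p)) (hi i / real (s ^ p)) (jackson_tail (s ^ (p + 1)) r) c S" for s i
  proof (cases "good s \<and> i \<in> ?I")
    case True
    have "real (s ^ p) > 0" using True by (simp add: good_def)
    moreover have "hi i - lo i < real (s ^ p)" "lo i < hi i" using True lohi by (auto simp: good_def)
    ultimately have "hi i / real (s ^ p) - lo i / real (s ^ p) < 1" "lo i / real (s ^ p) < hi i / real (s ^ p)"
      by (simp_all add: diff_divide_distrib[symmetric] divide_strict_right_mono del: of_nat_power)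
    thus ?thesis using smoothed_indicator[of "s ^ (p + 1)" "lo i / real (s ^ p)" "hi i / real (s ^ p)" r] True
      unfolding D_def by (auto simp: good_def simp del: of_nat_power)
  qed blast
  then obtain c S where cS: "\<And>s i. good s \<Longrightarrow> i \<in> ?I \<Longrightarrow>
      approx_indicator (D s) (lo i / real (s ^ p)) (hi i / real (s ^ p)) (jackson_tail (s ^ (p + 1)) r) (c s i) (S s i)"
    by metis
  define mean where "mean = (\<lambda>s. (1 / real (s ^ p)) * real (card (distinct_tuples k (s ^ p))) * (P / real (s ^ p) ^ (k - 1)))"
  define W where "W = (\<lambda>s \<alpha>. product_correlation a k (s ^ p) (S s) \<alpha>)"
  \<comment> \<open>For the finitely many \<open>s\<close> that are not \<open>good\<close> the
    function is set to 0, so that every \<open>g s\<close> is continuous.\<close>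
  define g where "g = (\<lambda>s \<alpha>. if good s then W s \<alpha> - mean s else 0)"
  have prod_eq: "(\<Prod>i\<in>?I. hi i / real (s ^ p) - lo i / real (s ^ p)) = P / real (s ^ p) ^ (k - 1)" for s
    unfolding P_def by (simp add: diff_divide_distrib[symmetric] prod_dividef)
  have cont: "continuous_on UNIV (g s)" for s
  proof (cases "good s")
    case True
    have "S s i y = Re (trig_poly (D s) (c s i) y)" if "i \<in> ?I" for i y
      using cS[OF True that] unfolding approx_indicator_def by (metis Re_complex_of_real)
    hence "g s = (\<lambda>\<alpha>. (1 / real (s ^ p)) * (\<Sum>x\<in>distinct_tuples k (s ^ p).
        \<Prod>i\<in>?I. Re (trig_poly (D s) (c s i) (\<alpha> * real_of_int (Delta a k x i)))) - mean s)"
      using True by (simp add: g_def W_def product_correlation_def fun_eq_iff)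
    thus ?thesis by (simp only:) (intro continuous_intros)
  qed (simp add: g_def)
  define C where "C = P\<^sup>2 * real (2 * k * (4 ^ k + x0)) * real (64 * r * k * (x0 + 1)) ^ (2 * k - 1)"
  have r1: "r \<ge> 1" using p1 by (simp add: r_def)
  have "eventually (\<lambda>s. (16 * real k * (2 * real r)) * real s ^ (p + 1) < \<rho> ^ s) sequentially"
    by (rule eventually_power_less[OF rho])
  with ev_good have var: "eventually (\<lambda>s. \<forall>t. integral {t..t + 1} (\<lambda>\<alpha>. (g s \<alpha>)\<^sup>2) \<le> C / real s ^ 2) sequentially"
  proof eventually_elim
    case (elim s)
    have s: "s \<ge> 1" using elim by (simp add: good_def)
    show ?case
    proof
      fix t
      have "s ^ p \<le> s ^ (p + 1)" using s by (intro power_increasing) auto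
      also have "\<dots> \<le> (2 * (r * 2)) * s ^ (p + 1)" using r1 by (simp add: Suc_le_eq)
      also have "\<dots> = 2 * D s" by (simp add: D_def mult_ac)
      finally have ND: "s ^ p \<le> 2 * D s" .
      have "integral {t..t + 1} (\<lambda>\<alpha>. (product_correlation a k (s ^ p) (S s) \<alpha>
          - (1 / real (s ^ p)) * real (card (distinct_tuples k (s ^ p))) * (\<Prod>i\<in>?I. hi i / real (s ^ p) - lo i / real (s ^ p)))\<^sup>2)
        \<le> ((1 / real (s ^ p)) * (\<Prod>i\<in>?I. hi i / real (s ^ p) - lo i / real (s ^ p)))\<^sup>2 *
          real (2 * k * (4 ^ k + x0) * (16 * D s * (s + 1) * k * (x0 + 1)) ^ (2 * k - 1))"
      proof (rule product_correlation_variance[OF k _ ND])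
        show "1 \<le> s ^ p" using s by simp
        show "16 * real k * real (D s) < \<rho> ^ s" using elim(2) by (simp add: D_def mult_ac)
        show "lo i / real (s ^ p) \<le> hi i / real (s ^ p)" if "i \<in> ?I" for i
          using lohi[OF that] by (intro divide_right_mono) auto
      qed (rule cS[OF elim(1)])
      also have "\<dots> \<le> C / real s ^ 2"
        unfolding prod_eq unfolding C_def D_def p_def by (rule variance_decay) (use k s in auto)
      finally show "integral {t..t + 1} (\<lambda>\<alpha>. (g s \<alpha>)\<^sup>2) \<le> C / real s ^ 2"
        unfolding prod_eq using elim(1) by (simp only: g_def W_def mean_def if_True)
    qed
  qed
  have mean: "mean \<longlonglongrightarrow> P"
  proof -
    have "filterlim (\<lambda>s :: nat. s ^ p) at_top sequentially"
    proof (rule filterlim_at_top_mono[OF filterlim_ident])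
      show "eventually (\<lambda>s :: nat. s \<le> s ^ p) sequentially"
        using eventually_ge_at_top[of 1]
      proof eventually_elim
        case (elim s)
        have "s ^ 1 \<le> s ^ p" using p1 elim by (intro power_increasing) auto
        thus ?case by simp
      qed
    qed
    hence "(\<lambda>s. real (card (distinct_tuples k (s ^ p))) / real (s ^ p) ^ k) \<longlonglongrightarrow> 1"
      using k by (intro filterlim_compose[OF card_distinct_tuples_asymp]) auto
    hence "(\<lambda>s. P * (real (card (distinct_tuples k (s ^ p))) / real (s ^ p) ^ k)) \<longlonglongrightarrow> P * 1"
      by (intro tendsto_mult tendsto_const)
    moreover have "mean = (\<lambda>s. P * (real (card (distinct_tuples k (s ^ p))) / real (s ^ p) ^ k))"
    proof
      fix s
      have "real (s ^ p) ^ k = real (s ^ p) * real (s ^ p) ^ (k - 1)" using k by (cases k) auto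
      thus "mean s = P * (real (card (distinct_tuples k (s ^ p))) / real (s ^ p) ^ k)"
        by (simp add: mean_def)
    qed
    ultimately show ?thesis by simp
  qed
  have err: "eventually (\<lambda>s. real (s ^ p) ^ k * (real k * jackson_tail (s ^ (p + 1)) r (\<kappa> / real (s ^ p))) \<le> 1 / real s) sequentially"
    if "\<kappa> > 0" for \<kappa>
  proof -
    \<comment> \<open>This constant depends on \<kappa>. One of the two powers of \<open>s\<close>
      absorbs it, which leaves the error \<open>1 / real s\<close> for every margin.\<close>
    define c where "c = real k * (1 / \<kappa>) ^ (2 * r) * real (4 * r + 1)"
    have "eventually (\<lambda>s. c < real s) sequentially"
      by (rule eventually_compose_filterlim[OF eventually_gt_at_top filterlim_real_sequentially])
    with eventually_ge_at_top[of 1] show ?thesis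
    proof eventually_elim
      case (elim s)
      have "real (s ^ p) ^ k * (real k * jackson_tail (s ^ (p + 1)) r (\<kappa> / real (s ^ p))) \<le> c / real s ^ 2"
        unfolding c_def by (rule tail_decay[OF k elim(1) that p_def r_def])
      also have "\<dots> \<le> real s / real s ^ 2" using elim by (intro divide_right_mono) auto
      also have "\<dots> = 1 / real s" by (simp add: power2_eq_square)
      finally show ?case .
    qed
  qed
  have tail_nonneg: "jackson_tail (s ^ (p + 1)) r (\<kappa> / real (s ^ p)) \<ge> 0" if "\<kappa> > 0" for s \<kappa>
    using that by (simp add: jackson_tail_def)
  have "AE \<alpha> in lborel. (\<lambda>s. g s \<alpha>) \<longlonglongrightarrow> 0"
    by (rule AE_tendsto_0_of_mean_square[OF cont var])
  thus ?thesis
  proof eventually_elim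
    case (elim \<alpha>)
    show ?case
      unfolding subsequence_approx_def majorizes_smaller_boxes_def minorizes_larger_boxes_def p_def[symmetric]
    proof (intro exI[of _ "\<lambda>s. W s \<alpha>"] conjI allI impI)
      have "(\<lambda>s. g s \<alpha> + mean s) \<longlonglongrightarrow> 0 + P" by (intro tendsto_add elim mean)
      moreover have "eventually (\<lambda>s. g s \<alpha> + mean s = W s \<alpha>) sequentially"
        using ev_good by eventually_elim (simp add: g_def)
      ultimately show "(\<lambda>s. W s \<alpha>) \<longlonglongrightarrow> (\<Prod>i\<in>?I. hi i - lo i)"
        unfolding P_def[symmetric] using tendsto_cong by fastforce
    next
      fix \<kappa> :: real and lo' hi' :: "nat \<Rightarrow> real"
      assume \<kappa>: "\<kappa> > 0" and *: "\<forall>i\<in>?I. lo i + \<kappa> \<le> lo' i \<and> hi' i \<le> hi i - \<kappa>"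
      show "eventually (\<lambda>s. box_correlation a k lo' hi' (s ^ p) \<alpha> \<le> W s \<alpha> + 1 / real s) sequentially"
        using ev_good err[OF \<kappa>]
      proof eventually_elim
        case (elim s)
        have "box_correlation a k lo' hi' (s ^ p) \<alpha> \<le> product_correlation a k (s ^ p) (S s) \<alpha>
            + real (s ^ p) ^ k * (real k * jackson_tail (s ^ (p + 1)) r (\<kappa> / real (s ^ p)))"
          by (rule box_correlation_sandwich(1)[OF cS[OF elim(1)] _ \<kappa> tail_nonneg[OF \<kappa>]])
            (use * elim(1) in \<open>auto simp: good_def\<close>)
        thus ?case using elim(2) unfolding W_def by linarith
      qed
    next
      fix \<kappa> :: real and lo' hi' :: "nat \<Rightarrow> real"
      assume \<kappa>: "\<kappa> > 0" and *: "\<forall>i\<in>?I. lo' i \<le> lo i - \<kappa> \<and> hi i + \<kappa> \<le> hi' i"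
      show "eventually (\<lambda>s. W s \<alpha> \<le> box_correlation a k lo' hi' (s ^ p) \<alpha> + 1 / real s) sequentially"
        using ev_good err[OF \<kappa>]
      proof eventually_elim
        case (elim s)
        have "product_correlation a k (s ^ p) (S s) \<alpha> \<le> box_correlation a k lo' hi' (s ^ p) \<alpha>
            + real (s ^ p) ^ k * (real k * jackson_tail (s ^ (p + 1)) r (\<kappa> / real (s ^ p)))"
          by (rule box_correlation_sandwich(2)[OF cS[OF elim(1)] _ \<kappa> tail_nonneg[OF \<kappa>]])
            (use * elim(1) in \<open>auto simp: good_def\<close>)
        thus ?case using elim(2) unfolding W_def by linarith
      qed
    qed
  qed
qed

section \<open>From the subsequence to all integers\<close>

lemma box_correlation_nonneg: "0 \<le> box_correlation a k lo hi N \<alpha>"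
  unfolding box_correlation_eq by (intro mult_nonneg_nonneg sum_nonneg prod_nonneg) (auto simp: hits_bounds)

text \<open>Replacing \<open>N\<close> by \<open>N'\<close> dilates the point by
  \<open>N' / N\<close>, which shifts the end points by at most \<delta>.\<close>

lemma hits_rescale:
  assumes N: "0 < N" "N \<le> N'"
    and d: "(real N' / real N - 1) * \<bar>lo\<bar> \<le> \<delta>" "(real N' / real N - 1) * \<bar>hi\<bar> \<le> \<delta>"
  shows "hits lo hi N y \<le> hits (lo - \<delta>) (hi + \<delta>) N' y"
proof (cases "\<exists>m :: int. lo \<le> real N * (of_int m + y) \<and> real N * (of_int m + y) < hi")
  case True
  then obtain m :: int where m: "lo \<le> real N * (of_int m + y)" "real N * (of_int m + y) < hi" by blast
  define l where "l = real N' / real N"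
  have l: "l > 0" "l - 1 \<ge> 0" "l * real N = real N'" using N by (auto simp: l_def field_simps)
  have "l * lo \<le> l * (real N * (of_int m + y))" "l * (real N * (of_int m + y)) < l * hi"
    using m l by auto
  hence 1: "l * lo \<le> real N' * (of_int m + y)" "real N' * (of_int m + y) < l * hi"
    using l(3) by (simp_all add: mult.assoc[symmetric])
  have "\<bar>(l - 1) * lo\<bar> \<le> \<delta>" "\<bar>(l - 1) * hi\<bar> \<le> \<delta>" using d l by (simp_all add: abs_mult l_def)
  hence "lo - \<delta> \<le> l * lo" "l * hi \<le> hi + \<delta>" by (simp_all add: left_diff_distrib)
  hence "lo - \<delta> \<le> real N' * (of_int m + y) \<and> real N' * (of_int m + y) < hi + \<delta>" using 1 by linarith
  hence "hits (lo - \<delta>) (hi + \<delta>) N' y = 1" unfolding hits_def by auto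
  thus ?thesis using hits_bounds by simp
next
  case False
  hence "hits lo hi N y = 0" by (simp only: hits_def of_bool_def if_False)
  thus ?thesis using hits_bounds by simp
qed

text \<open>Indicators of boxes make the sums monotone: a larger range adds only nonnegative terms,
  and the normalisation changes by the factor \<open>N' / N\<close>.\<close>

lemma box_correlation_rescale:
  assumes N: "0 < N" "N \<le> N'"
    and d: "\<And>i. i \<in> {1..k - 1} \<Longrightarrow> (real N' / real N - 1) * \<bar>lo i\<bar> \<le> \<delta>"
      "\<And>i. i \<in> {1..k - 1} \<Longrightarrow> (real N' / real N - 1) * \<bar>hi i\<bar> \<le> \<delta>"
  shows "box_correlation a k lo hi N \<alpha>
    \<le> (real N' / real N) * box_correlation a k (\<lambda>i. lo i - \<delta>) (\<lambda>i. hi i + \<delta>) N' \<alpha>"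
proof -
  have "(\<Sum>x\<in>distinct_tuples k N. \<Prod>i\<in>{1..k - 1}. hits (lo i) (hi i) N (\<alpha> * real_of_int (Delta a k x i)))
    \<le> (\<Sum>x\<in>distinct_tuples k N. \<Prod>i\<in>{1..k - 1}. hits (lo i - \<delta>) (hi i + \<delta>) N' (\<alpha> * real_of_int (Delta a k x i)))"
    by (intro sum_mono prod_mono conjI hits_bounds hits_rescale N d)
  also have "\<dots> \<le> (\<Sum>x\<in>distinct_tuples k N'. \<Prod>i\<in>{1..k - 1}. hits (lo i - \<delta>) (hi i + \<delta>) N' (\<alpha> * real_of_int (Delta a k x i)))"
  proof (rule sum_mono2[OF finite_distinct_tuples])
    show "distinct_tuples k N \<subseteq> distinct_tuples k N'"
    proof
      fix x assume "x \<in> distinct_tuples k N"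
      hence x: "x \<in> {1..k} \<rightarrow>\<^sub>E {1..N}" "inj_on x {1..k}" by (auto simp: distinct_tuples_def)
      have "{1..k} \<rightarrow>\<^sub>E {1..N} \<subseteq> {1..k} \<rightarrow>\<^sub>E {1..N'}" by (rule PiE_mono) (use N in auto)
      thus "x \<in> distinct_tuples k N'" using x by (auto simp: distinct_tuples_def)
    qed
  qed (auto intro!: prod_nonneg hits_bounds)
  finally show ?thesis unfolding box_correlation_eq using N by (simp add: divide_right_mono)
qed

definition generic :: "(nat \<Rightarrow> int) \<Rightarrow> nat \<Rightarrow> real \<Rightarrow> bool" where
  "generic a k \<alpha> \<longleftrightarrow> (\<forall>lo\<in>{1..k - 1} \<rightarrow>\<^sub>E \<rat>. \<forall>hi\<in>{1..k - 1} \<rightarrow>\<^sub>E \<rat>.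
     (\<forall>i\<in>{1..k - 1}. lo i < hi i) \<longrightarrow> subsequence_approx a k lo hi \<alpha>)"

lemma (in lacunary_tail) AE_generic: "AE \<alpha> in lborel. \<forall>k\<ge>2. generic a k \<alpha>"
proof -
  have "AE \<alpha> in lborel. generic a k \<alpha>" if k: "k \<ge> 2" for k
  proof -
    have c: "countable ({1..k - 1} \<rightarrow>\<^sub>E (\<rat> :: real set))" by (intro countable_PiE) (auto simp: countable_rat)
    have "AE \<alpha> in lborel. (\<forall>i\<in>{1..k - 1}. lo i < hi i) \<longrightarrow> subsequence_approx a k lo hi \<alpha>" for lo hi
    proof (cases "\<forall>i\<in>{1..k - 1}. lo i < hi i")
      case True
      thus ?thesis using subsequence_limit[OF k, of lo hi] by auto
    qed (simp only: simp_thms, simp)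
    thus ?thesis unfolding generic_def AE_ball_countable[OF c] by blast
  qed
  hence "AE \<alpha> in lborel. k \<ge> 2 \<longrightarrow> generic a k \<alpha>" for k by (cases "k \<ge> 2") auto
  thus ?thesis by (subst AE_all_countable) blast
qed

lemma rational_tuple_between:
  fixes u v :: "'i \<Rightarrow> real"
  assumes "\<And>i. i \<in> I \<Longrightarrow> u i < v i"
  obtains l where "l \<in> I \<rightarrow>\<^sub>E \<rat>" "\<And>i. i \<in> I \<Longrightarrow> u i < l i \<and> l i < v i"
proof -
  have "\<forall>i\<in>I. \<exists>r\<in>\<rat>. u i < r \<and> r < v i" using assms Rats_dense_in_real by blast
  then obtain l where "\<forall>i\<in>I. l i \<in> \<rat> \<and> u i < l i \<and> l i < v i" by metis
  thus ?thesis by (intro that[of "restrict l I"]) auto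
qed

text \<open>Rational corners are placed between \<open>2 * d\<close> and \<open>4 * d\<close>
  outside the box. One \<open>d\<close> is the enlargement in the conclusion, the second is the
  margin \<kappa> of \<open>majorizes_smaller_boxes\<close>, and the bound \<open>4 * d\<close>
  keeps the volume within \<open>e / 2\<close>.\<close>

lemma generic_upper:
  assumes g: "generic a k \<alpha>" and lohi: "\<And>i. i \<in> {1..k - 1} \<Longrightarrow> lo i < hi i" and e: "e > 0"
  shows "\<exists>\<delta>>0. eventually (\<lambda>s. box_correlation a k (\<lambda>i. lo i - \<delta>) (\<lambda>i. hi i + \<delta>) (s ^ (4 * k)) \<alpha>
    \<le> (\<Prod>i\<in>{1..k - 1}. hi i - lo i) + e) sequentially"
proof -
  let ?I = "{1..k - 1}"
  let ?P = "\<Prod>i\<in>?I. hi i - lo i"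
  have "((\<lambda>d. \<Prod>i\<in>?I. (hi i + 4 * d) - (lo i - 4 * d)) \<longlongrightarrow> (\<Prod>i\<in>?I. (hi i + 4 * 0) - (lo i - 4 * 0))) (at_right 0)"
    by (intro tendsto_intros)
  hence "eventually (\<lambda>d. (\<Prod>i\<in>?I. (hi i + 4 * d) - (lo i - 4 * d)) < ?P + e / 2) (at_right 0)"
    by (rule order_tendstoD) (use e in simp)
  moreover have "eventually (\<lambda>d :: real. d > 0) (at_right 0)" by (rule eventually_at_right_less)
  ultimately have "eventually (\<lambda>d. d > 0 \<and> (\<Prod>i\<in>?I. (hi i + 4 * d) - (lo i - 4 * d)) < ?P + e / 2) (at_right 0)"
    by eventually_elim simp
  then obtain d where d: "d > 0" "(\<Prod>i\<in>?I. (hi i + 4 * d) - (lo i - 4 * d)) < ?P + e / 2"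
    using eventually_happens'[OF trivial_limit_at_right_real] by blast
  obtain l where l: "l \<in> ?I \<rightarrow>\<^sub>E \<rat>" "\<And>i. i \<in> ?I \<Longrightarrow> lo i - 4 * d < l i \<and> l i < lo i - 2 * d"
    by (rule rational_tuple_between[of ?I "\<lambda>i. lo i - 4 * d" "\<lambda>i. lo i - 2 * d"]) (use d(1) in auto)
  obtain h where h: "h \<in> ?I \<rightarrow>\<^sub>E \<rat>" "\<And>i. i \<in> ?I \<Longrightarrow> hi i + 2 * d < h i \<and> h i < hi i + 4 * d"
    by (rule rational_tuple_between[of ?I "\<lambda>i. hi i + 2 * d" "\<lambda>i. hi i + 4 * d"]) (use d(1) in auto)
  have "subsequence_approx a k l h \<alpha>"
  proof -
    have "l i < h i" if "i \<in> ?I" for i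
      using l(2)[OF that] h(2)[OF that] lohi[OF that] d(1) by linarith
    thus ?thesis using g l(1) h(1) unfolding generic_def by blast
  qed
  then obtain W where W: "W \<longlonglongrightarrow> (\<Prod>i\<in>?I. h i - l i)"
    and up: "majorizes_smaller_boxes a k (l) (h) \<alpha> W"
    unfolding subsequence_approx_def by blast
  have "(\<Prod>i\<in>?I. h i - l i) \<le> (\<Prod>i\<in>?I. (hi i + 4 * d) - (lo i - 4 * d))"
  proof (rule prod_mono)
    fix i assume i: "i \<in> ?I"
    show "0 \<le> h i - l i \<and> h i - l i \<le> (hi i + 4 * d) - (lo i - 4 * d)"
      using l(2)[OF i] h(2)[OF i] lohi[OF i] d(1) by simp
  qed
  hence lim: "(\<Prod>i\<in>?I. h i - l i) < ?P + e / 2" using d(2) by linarith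
  have "(\<lambda>s. W s + 1 / real s) \<longlonglongrightarrow> (\<Prod>i\<in>?I. h i - l i) + 0"
    by (intro tendsto_add W lim_1_over_n)
  hence "eventually (\<lambda>s. W s + 1 / real s < ?P + e / 2) sequentially"
    by (rule order_tendstoD) (use lim in simp)
  moreover have "eventually (\<lambda>s. box_correlation a k (\<lambda>i. lo i - d) (\<lambda>i. hi i + d) (s ^ (4 * k)) \<alpha> \<le> W s + 1 / real s) sequentially"
  proof (rule up[unfolded majorizes_smaller_boxes_def, rule_format, OF d(1)])
    fix i assume i: "i \<in> ?I"
    show "l i + d \<le> lo i - d \<and> hi i + d \<le> h i - d" using l(2)[OF i] h(2)[OF i] by simp
  qed
  ultimately have "eventually (\<lambda>s. box_correlation a k (\<lambda>i. lo i - d) (\<lambda>i. hi i + d) (s ^ (4 * k)) \<alpha> \<le> ?P + e) sequentially"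
    by eventually_elim (use e in simp)
  thus ?thesis using d(1) by blast
qed

lemma generic_lower:
  assumes g: "generic a k \<alpha>" and lohi: "\<And>i. i \<in> {1..k - 1} \<Longrightarrow> lo i < hi i" and e: "e > 0"
  shows "\<exists>\<delta>>0. eventually (\<lambda>s. (\<Prod>i\<in>{1..k - 1}. hi i - lo i) - e
    \<le> box_correlation a k (\<lambda>i. lo i + \<delta>) (\<lambda>i. hi i - \<delta>) (s ^ (4 * k)) \<alpha>) sequentially"
proof -
  let ?I = "{1..k - 1}"
  let ?P = "\<Prod>i\<in>?I. hi i - lo i"
  have "((\<lambda>d. \<Prod>i\<in>?I. (hi i - 4 * d) - (lo i + 4 * d)) \<longlongrightarrow> (\<Prod>i\<in>?I. (hi i - 4 * 0) - (lo i + 4 * 0))) (at_right 0)"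
    by (intro tendsto_intros)
  hence "eventually (\<lambda>d. ?P - e / 2 < (\<Prod>i\<in>?I. (hi i - 4 * d) - (lo i + 4 * d))) (at_right 0)"
    by (rule order_tendstoD) (use e in simp)
  \<comment> \<open>Both corners move inwards by up to \<open>4 * d\<close>; this keeps the rational
    box nondegenerate and the factors of the products nonnegative.\<close>
  moreover have "eventually (\<lambda>d. \<forall>i\<in>?I. 8 * d < hi i - lo i) (at_right 0)"
  proof (intro eventually_ball_finite ballI)
    fix i assume i: "i \<in> ?I"
    have "((\<lambda>d. 8 * d) \<longlongrightarrow> 8 * (0 :: real)) (at_right 0)" by (intro tendsto_intros)
    thus "eventually (\<lambda>d. 8 * d < hi i - lo i) (at_right 0)"
      by (rule order_tendstoD) (use lohi[OF i] in simp)
  qed simp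
  moreover have "eventually (\<lambda>d :: real. d > 0) (at_right 0)" by (rule eventually_at_right_less)
  ultimately have "eventually (\<lambda>d. d > 0 \<and> (\<forall>i\<in>?I. 8 * d < hi i - lo i) \<and>
      ?P - e / 2 < (\<Prod>i\<in>?I. (hi i - 4 * d) - (lo i + 4 * d))) (at_right 0)"
    by eventually_elim simp
  then obtain d where d: "d > 0" "\<forall>i\<in>?I. 8 * d < hi i - lo i" "?P - e / 2 < (\<Prod>i\<in>?I. (hi i - 4 * d) - (lo i + 4 * d))"
    using eventually_happens'[OF trivial_limit_at_right_real] by blast
  obtain l where l: "l \<in> ?I \<rightarrow>\<^sub>E \<rat>" "\<And>i. i \<in> ?I \<Longrightarrow> lo i + 2 * d < l i \<and> l i < lo i + 4 * d"
    by (rule rational_tuple_between[of ?I "\<lambda>i. lo i + 2 * d" "\<lambda>i. lo i + 4 * d"]) (use d(1) in auto)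
  obtain h where h: "h \<in> ?I \<rightarrow>\<^sub>E \<rat>" "\<And>i. i \<in> ?I \<Longrightarrow> hi i - 4 * d < h i \<and> h i < hi i - 2 * d"
    by (rule rational_tuple_between[of ?I "\<lambda>i. hi i - 4 * d" "\<lambda>i. hi i - 2 * d"]) (use d(1) in auto)
  have "subsequence_approx a k l h \<alpha>"
  proof -
    have "l i < h i" if "i \<in> ?I" for i
    proof -
      have "8 * d < hi i - lo i" using d(2) that by blast
      thus ?thesis using l(2)[OF that] h(2)[OF that] by linarith
    qed
    thus ?thesis using g l(1) h(1) unfolding generic_def by blast
  qed
  then obtain W where W: "W \<longlonglongrightarrow> (\<Prod>i\<in>?I. h i - l i)"
    and low: "minorizes_larger_boxes a k (l) (h) \<alpha> W"
    unfolding subsequence_approx_def by blast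
  have "(\<Prod>i\<in>?I. (hi i - 4 * d) - (lo i + 4 * d)) \<le> (\<Prod>i\<in>?I. h i - l i)"
  proof (rule prod_mono)
    fix i assume i: "i \<in> ?I"
    have "8 * d < hi i - lo i" using d(2) i by blast
    thus "0 \<le> (hi i - 4 * d) - (lo i + 4 * d) \<and> (hi i - 4 * d) - (lo i + 4 * d) \<le> h i - l i"
      using l(2)[OF i] h(2)[OF i] by simp
  qed
  hence lim: "?P - e / 2 < (\<Prod>i\<in>?I. h i - l i)" using d(3) by linarith
  have "(\<lambda>s. W s - 1 / real s) \<longlonglongrightarrow> (\<Prod>i\<in>?I. h i - l i) - 0"
    by (intro tendsto_diff W lim_1_over_n)
  hence "eventually (\<lambda>s. ?P - e / 2 < W s - 1 / real s) sequentially"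
    by (rule order_tendstoD) (use lim in simp)
  moreover have "eventually (\<lambda>s. W s \<le> box_correlation a k (\<lambda>i. lo i + d) (\<lambda>i. hi i - d) (s ^ (4 * k)) \<alpha> + 1 / real s) sequentially"
  proof (rule low[unfolded minorizes_larger_boxes_def, rule_format, OF d(1)])
    fix i assume i: "i \<in> ?I"
    show "lo i + d \<le> l i - d \<and> h i + d \<le> hi i - d" using l(2)[OF i] h(2)[OF i] by simp
  qed
  ultimately have "eventually (\<lambda>s. ?P - e \<le> box_correlation a k (\<lambda>i. lo i + d) (\<lambda>i. hi i - d) (s ^ (4 * k)) \<alpha>) sequentially"
    by eventually_elim (use e in simp)
  thus ?thesis using d(1) by blast
qed

section \<open>Interpolation between consecutive powers\<close>

definition floor_root :: "nat \<Rightarrow> nat \<Rightarrow> nat" where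
  "floor_root p N = nat \<lfloor>root p (real N)\<rfloor>"

lemma floor_root:
  assumes "p \<ge> 1"
  shows "floor_root p N ^ p \<le> N" "N \<le> (floor_root p N + 1) ^ p"
proof -
  have r0: "0 \<le> root p (real N)" using assms by simp
  have "real (floor_root p N) \<le> root p (real N)" using r0 by (simp add: floor_root_def)
  hence "real (floor_root p N) ^ p \<le> root p (real N) ^ p" by (intro power_mono) auto
  also have "\<dots> = real N" using assms by simp
  finally show "floor_root p N ^ p \<le> N" by (simp flip: of_nat_power)
  have "root p (real N) \<le> real (floor_root p N + 1)" using r0 by (simp add: floor_root_def) linarith
  hence "root p (real N) ^ p \<le> real (floor_root p N + 1) ^ p" using r0 by (intro power_mono) auto
  hence "real N \<le> real (floor_root p N + 1) ^ p" using assms by simp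
  thus "N \<le> (floor_root p N + 1) ^ p" by (simp only: of_nat_power[symmetric] of_nat_le_iff)
qed

lemma filterlim_floor_root:
  assumes "p \<ge> 1" shows "filterlim (floor_root p) at_top sequentially"
  unfolding filterlim_at_top
proof
  fix Z :: nat
  show "eventually (\<lambda>N. Z \<le> floor_root p N) sequentially"
    using eventually_ge_at_top[of "Suc Z ^ p"]
  proof eventually_elim
    case (elim N)
    have "Suc Z ^ p \<le> (floor_root p N + 1) ^ p" using elim floor_root(2)[OF assms, of N] by linarith
    hence "Suc Z \<le> floor_root p N + 1" using assms by (simp add: power_mono_iff)
    thus ?case by simp
  qed
qed

text \<open>\<open>N\<close> lies between the consecutive powers \<open>\<sigma> N ^ p\<close> and
  \<open>(\<sigma> N + 1) ^ p\<close>, whose ratio \<open>R N\<close> tends to 1. The larger power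
  gives the upper bound and the smaller one the lower bound; eventually the dilation moves the
  corners by no more than the room \<delta> provided by \<open>generic_upper\<close> and
  \<open>generic_lower\<close>.\<close>

lemma generic_imp_box_limit:
  assumes g: "generic a k \<alpha>" and k: "k \<ge> 2" and lohi: "\<And>i. i \<in> {1..k - 1} \<Longrightarrow> lo i < hi i"
  shows "(\<lambda>N. box_correlation a k lo hi N \<alpha>) \<longlonglongrightarrow> (\<Prod>i\<in>{1..k - 1}. hi i - lo i)"
proof -
  let ?I = "{1..k - 1}"
  let ?P = "\<Prod>i\<in>?I. hi i - lo i"
  let ?B = "\<lambda>N. box_correlation a k lo hi N \<alpha>"
  define p where "p = 4 * k"
  have p: "p \<ge> 1" using k by (simp add: p_def)
  define \<sigma> where "\<sigma> = floor_root p"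
  have \<sigma>: "filterlim \<sigma> at_top sequentially" unfolding \<sigma>_def by (rule filterlim_floor_root[OF p])
  define R where "R = (\<lambda>N. (1 + 1 / real (\<sigma> N)) ^ p)"
  have "(\<lambda>s. (1 + 1 / real s) ^ p) \<longlonglongrightarrow> (1 + 0) ^ p" by (intro tendsto_intros lim_1_over_n)
  hence R: "R \<longlonglongrightarrow> 1" unfolding R_def using filterlim_compose[OF _ \<sigma>] by fastforce
  have P0: "?P \<ge> 0" using lohi by (intro prod_nonneg) (auto intro: less_imp_le)
  have ev1: "eventually (\<lambda>N. \<sigma> N \<ge> 1) sequentially" using \<sigma> unfolding filterlim_at_top by blast
  have ratio: "real ((\<sigma> N + 1) ^ p) / real (\<sigma> N ^ p) = R N" if "\<sigma> N \<ge> 1" for N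
    using that by (simp add: R_def power_divide[symmetric] add_divide_distrib add.commute)
  have small: "eventually (\<lambda>N. \<forall>i\<in>?I. (R N - 1) * \<bar>c i\<bar> \<le> \<delta>) sequentially" if "\<delta> > 0" for c \<delta>
  proof (intro eventually_ball_finite ballI)
    fix i
    have "(\<lambda>N. (R N - 1) * \<bar>c i\<bar>) \<longlonglongrightarrow> (1 - 1) * \<bar>c i\<bar>" by (intro tendsto_intros R)
    hence "eventually (\<lambda>N. (R N - 1) * \<bar>c i\<bar> < \<delta>) sequentially" by (rule order_tendstoD) (use that in simp)
    thus "eventually (\<lambda>N. (R N - 1) * \<bar>c i\<bar> \<le> \<delta>) sequentially" by eventually_elim simp
  qed simp
  have upper: "eventually (\<lambda>N. ?B N < u) sequentially" if "?P < u" for u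
  proof -
    define e where "e = (u - ?P) / 2"
    have e: "e > 0" "?P + e < u" using that by (auto simp: e_def field_simps)
    obtain \<delta> where \<delta>: "\<delta> > 0" and ev: "eventually (\<lambda>s. box_correlation a k (\<lambda>i. lo i - \<delta>) (\<lambda>i. hi i + \<delta>) (s ^ p) \<alpha> \<le> ?P + e) sequentially"
      using generic_upper[of a k \<alpha> lo hi e, OF g lohi e(1)] unfolding p_def by blast
    have "filterlim (\<lambda>N. \<sigma> N + 1) at_top sequentially"
      by (rule filterlim_at_top_mono[OF \<sigma>]) auto
    hence ev': "eventually (\<lambda>N. box_correlation a k (\<lambda>i. lo i - \<delta>) (\<lambda>i. hi i + \<delta>) ((\<sigma> N + 1) ^ p) \<alpha> \<le> ?P + e) sequentially"
      by (rule eventually_compose_filterlim[OF ev])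
    have "(\<lambda>N. R N * (?P + e)) \<longlonglongrightarrow> 1 * (?P + e)" by (intro tendsto_intros R)
    hence "eventually (\<lambda>N. R N * (?P + e) < u) sequentially" by (rule order_tendstoD) (use e in simp)
    with ev' ev1 small[OF \<delta>, of lo] small[OF \<delta>, of hi] show ?thesis
    proof eventually_elim
      case (elim N)
      have N0: "N > 0" using floor_root(1)[OF p, of N] elim(2) unfolding \<sigma>_def[symmetric]
        by (metis gr0I le_zero_eq not_one_le_zero power_eq_0_iff)
      have N': "N \<le> (\<sigma> N + 1) ^ p" unfolding \<sigma>_def by (rule floor_root(2)[OF p])
      have q: "real ((\<sigma> N + 1) ^ p) / real N \<le> R N"
        unfolding ratio[OF elim(2), symmetric] using floor_root(1)[OF p, of N] elim(2) N0
        by (intro divide_left_mono) (auto simp: \<sigma>_def simp del: of_nat_power intro!: mult_pos_pos)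
      have q1: "(real ((\<sigma> N + 1) ^ p) / real N - 1) * \<bar>x\<bar> \<le> (R N - 1) * \<bar>x\<bar>" for x
        using q by (intro mult_right_mono) auto
      have "?B N \<le> real ((\<sigma> N + 1) ^ p) / real N * box_correlation a k (\<lambda>i. lo i - \<delta>) (\<lambda>i. hi i + \<delta>) ((\<sigma> N + 1) ^ p) \<alpha>"
        by (rule box_correlation_rescale[OF N0 N']) (use elim(3,4) order_trans[OF q1] in blast)+
      also have "\<dots> \<le> R N * (?P + e)"
        by (intro mult_mono q elim(1) box_correlation_nonneg) (use q in \<open>auto intro: order_trans[OF _ q]\<close>)
      finally show ?case using elim(5) by linarith
    qed
  qed
  have lower: "eventually (\<lambda>N. l < ?B N) sequentially" if "l < ?P" for l
  proof -
    define e where "e = (?P - l) / 2"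
    have e: "e > 0" "l < ?P - e" using that by (auto simp: e_def field_simps)
    obtain \<delta> where \<delta>: "\<delta> > 0" and ev: "eventually (\<lambda>s. ?P - e \<le> box_correlation a k (\<lambda>i. lo i + \<delta>) (\<lambda>i. hi i - \<delta>) (s ^ p) \<alpha>) sequentially"
      using generic_lower[of a k \<alpha> lo hi e, OF g lohi e(1)] unfolding p_def by blast
    have ev': "eventually (\<lambda>N. ?P - e \<le> box_correlation a k (\<lambda>i. lo i + \<delta>) (\<lambda>i. hi i - \<delta>) (\<sigma> N ^ p) \<alpha>) sequentially"
      by (rule eventually_compose_filterlim[OF ev \<sigma>])
    have "(\<lambda>N. (?P - e) / R N) \<longlonglongrightarrow> (?P - e) / 1" by (intro tendsto_intros R) simp
    hence "eventually (\<lambda>N. l < (?P - e) / R N) sequentially" by (rule order_tendstoD) (use e in simp)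
    with ev' ev1 small[OF \<delta>, of "\<lambda>i. lo i + \<delta>"] small[OF \<delta>, of "\<lambda>i. hi i - \<delta>"] show ?thesis
    proof eventually_elim
      case (elim N)
      have s0: "\<sigma> N ^ p > 0" using elim(2) by simp
      have N': "\<sigma> N ^ p \<le> N" unfolding \<sigma>_def by (rule floor_root(1)[OF p])
      have R0: "R N > 0" using elim(2) by (simp add: R_def add_pos_nonneg)
      have q: "real N / real (\<sigma> N ^ p) \<le> R N"
        unfolding ratio[OF elim(2), symmetric] using floor_root(2)[OF p, of N]
        by (intro divide_right_mono of_nat_mono) (auto simp: \<sigma>_def)
      have q1: "(real N / real (\<sigma> N ^ p) - 1) * \<bar>x\<bar> \<le> (R N - 1) * \<bar>x\<bar>" for x
        using q by (intro mult_right_mono) auto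
      have "?P - e \<le> box_correlation a k (\<lambda>i. lo i + \<delta>) (\<lambda>i. hi i - \<delta>) (\<sigma> N ^ p) \<alpha>" by (rule elim(1))
      \<comment> \<open>The box was shrunk by \<delta> beforehand, so the enlargement caused by
        rescaling restores exactly the original one.\<close>
      also have "\<dots> \<le> real N / real (\<sigma> N ^ p) * box_correlation a k (\<lambda>i. lo i + \<delta> - \<delta>) (\<lambda>i. hi i - \<delta> + \<delta>) N \<alpha>"
        by (rule box_correlation_rescale[OF s0 N']) (use elim(3,4) order_trans[OF q1] in blast)+
      also have "\<dots> = real N / real (\<sigma> N ^ p) * ?B N" by simp
      also have "\<dots> \<le> R N * ?B N" by (intro mult_right_mono q box_correlation_nonneg)
      finally have "(?P - e) / R N \<le> ?B N" using R0 by (simp add: divide_le_eq mult.commute)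
      thus ?case using elim(5) by linarith
    qed
  qed
  show ?thesis by (rule order_tendstoI) (use upper lower in auto)
qed

section \<open>From boxes to test functions\<close>

text \<open>The metric on functions is a sum over all coordinates with weights
  \<open>(1 / 2) ^ n\<close>, whose total is 2. The estimate turns closeness in each coordinate into
  closeness for uniform continuity.\<close>

lemma dist_fun_le:
  fixes x y :: "nat \<Rightarrow> real"
  assumes "\<And>i. \<bar>x i - y i\<bar> \<le> d"
  shows "dist x y \<le> 2 * d"
proof -
  have s: "summable (\<lambda>n. (1 / 2 :: real) ^ n * d)" by (intro summable_mult2 summable_geometric) simp
  have le: "(1 / 2) ^ n * min (dist (x (from_nat n)) (y (from_nat n))) 1 \<le> (1 / 2 :: real) ^ n * d" for n
    using assms[of "from_nat n"] by (intro mult_left_mono) (auto simp: dist_real_def min_le_iff_disj)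
  have "dist x y = (\<Sum>n. (1 / 2) ^ n * min (dist (x (from_nat n)) (y (from_nat n))) 1)" by (rule dist_fun_def)
  also have "\<dots> \<le> (\<Sum>n. (1 / 2 :: real) ^ n * d)"
  proof (rule suminf_le[OF le _ s])
    show "summable (\<lambda>n. (1 / 2) ^ n * min (dist (x (from_nat n)) (y (from_nat n))) 1)"
      by (rule summable_comparison_test'[OF s, of 0]) (use le in auto)
  qed
  also have "\<dots> = 2 * d" by (subst suminf_mult2[symmetric]) (auto simp: suminf_geometric intro: summable_geometric)
  finally show ?thesis .
qed

definition supported_in :: "nat \<Rightarrow> nat \<Rightarrow> ((nat \<Rightarrow> real) \<Rightarrow> real) \<Rightarrow> bool" where
  "supported_in n A f \<longleftrightarrow> (\<forall>x\<in>Rn n. f x \<noteq> 0 \<longrightarrow> (\<forall>i\<in>{1..n}. \<bar>x i\<bar> < real A))"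

definition osc_le :: "nat \<Rightarrow> real \<Rightarrow> real \<Rightarrow> ((nat \<Rightarrow> real) \<Rightarrow> real) \<Rightarrow> bool" where
  "osc_le n d e f \<longleftrightarrow> (\<forall>x\<in>Rn n. \<forall>y\<in>Rn n. (\<forall>i\<in>{1..n}. \<bar>x i - y i\<bar> \<le> d) \<longrightarrow> \<bar>f x - f y\<bar> \<le> e)"

lemma supported_inD: "supported_in n A f \<Longrightarrow> x \<in> Rn n \<Longrightarrow> f x \<noteq> 0 \<Longrightarrow> i \<in> {1..n} \<Longrightarrow> \<bar>x i\<bar> < real A"
  by (simp add: supported_in_def)

lemma osc_leD:
  "osc_le n d e f \<Longrightarrow> x \<in> Rn n \<Longrightarrow> y \<in> Rn n \<Longrightarrow> (\<And>i. i \<in> {1..n} \<Longrightarrow> \<bar>x i - y i\<bar> \<le> d) \<Longrightarrow> \<bar>f x - f y\<bar> \<le> e"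
  by (simp add: osc_le_def)

lemma test_function_support:
  assumes "f \<in> test_functions n"
  obtains A :: nat where "A > 0" "supported_in n A f"
proof -
  let ?K = "closure {x \<in> Rn n. f x \<noteq> 0}"
  have K: "compact ?K" using assms by (simp add: test_functions_def compactly_supported_def)
  have "\<exists>b. \<forall>x\<in>?K. \<bar>x i\<bar> \<le> b" for i
  proof -
    have "compact ((\<lambda>x. x i) ` ?K)"
      by (intro compact_continuous_image K continuous_on_subset[OF continuous_on_product_coordinates]) auto
    hence "bounded ((\<lambda>x. x i) ` ?K)" by (rule compact_imp_bounded)
    thus ?thesis by (auto simp: bounded_iff)
  qed
  hence "\<forall>i. \<exists>b. \<forall>x\<in>?K. \<bar>x i\<bar> \<le> b" by blast
  from choice[OF this] obtain b where b: "\<forall>i. \<forall>x\<in>?K. \<bar>x i\<bar> \<le> b i" by (elim exE)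
  obtain A :: nat where A: "(\<Sum>i\<in>{1..n}. \<bar>b i\<bar>) < real A" using reals_Archimedean2 by blast
  show ?thesis
  proof
    have "0 \<le> (\<Sum>i\<in>{1..n}. \<bar>b i\<bar>)" by (intro sum_nonneg) auto
    hence "0 < real A" using A by linarith
    thus "A > 0" by simp
    have "\<bar>x i\<bar> < real A" if x: "x \<in> Rn n" "f x \<noteq> 0" and i: "i \<in> {1..n}" for x i
    proof -
    have "x \<in> ?K" by (rule subsetD[OF closure_subset]) (use x in simp)
    hence "\<bar>x i\<bar> \<le> \<bar>b i\<bar>" using b[THEN spec, of i, THEN bspec, OF \<open>x \<in> ?K\<close>] by linarith
    also have "\<dots> \<le> (\<Sum>i\<in>{1..n}. \<bar>b i\<bar>)" using i by (intro member_le_sum) auto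
      finally show ?thesis using A by linarith
    qed
    thus "supported_in n A f" by (simp add: supported_in_def)
  qed
qed

text \<open>Coordinates outside \<open>{1..n}\<close> range over the single point
  \<open>undefined\<close>, so the box is a full product of compact sets and Tychonoff's theorem
  applies.\<close>

lemma compact_box: "compact {x \<in> Rn n. \<forall>i\<in>{1..n}. \<bar>x i\<bar> \<le> b}"
proof -
  let ?S = "\<lambda>i. if i \<in> {1..n} then {t. \<bar>t\<bar> \<le> b} else {undefined :: real}"
  have "{t. \<bar>t\<bar> \<le> b} = {- b..b}" by auto
  hence "compact {t. \<bar>t\<bar> \<le> b}" by simp
  hence "compactin (product_topology (\<lambda>i. euclidean) UNIV) (PiE UNIV ?S)"
    unfolding compactin_PiE by auto
  hence "compact (PiE UNIV ?S)" unfolding euclidean_product_topology by simp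
  moreover have "PiE UNIV ?S = {x \<in> Rn n. \<forall>i\<in>{1..n}. \<bar>x i\<bar> \<le> b}"
    by (auto simp: Rn_def PiE_iff extensional_def split: if_splits)
  ultimately show ?thesis by simp
qed

lemma test_function_uniform:
  assumes f: "f \<in> test_functions n"
    and A: "supported_in n A f" and e: "e > 0"
  obtains d where "d > 0"
    "osc_le n d e f"
proof -
  \<comment> \<open>The box exceeds the support by 1 and \<open>d\<close> will be at most 1, so two
    close points both lie in it as soon as \<open>f\<close> is nonzero at one of them.\<close>
  let ?B = "{x \<in> Rn n. \<forall>i\<in>{1..n}. \<bar>x i\<bar> \<le> real A + 1}"
  have "C_k 0 n f" using f by (auto simp: test_functions_def smooth_def)
  hence "continuous_on (Rn n) f" by simp
  hence "continuous_on ?B f" by (rule continuous_on_subset) auto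
  hence "uniformly_continuous_on ?B f" by (rule compact_uniformly_continuous[OF _ compact_box])
  from this[unfolded uniformly_continuous_on_def, THEN spec, THEN mp, OF e]
  obtain \<delta> where \<delta>: "\<delta> > 0" "\<forall>x\<in>?B. \<forall>y\<in>?B. dist y x < \<delta> \<longrightarrow> dist (f y) (f x) < e"
    by (elim exE conjE)
  define d where "d = min 1 (\<delta> / 3)"
  have d: "0 < d" "d \<le> 1" "2 * d < \<delta>" using \<delta>(1) by (auto simp: d_def min_def)
  have main: "\<bar>f x - f y\<bar> \<le> e"
    if xy: "x \<in> Rn n" "y \<in> Rn n" and close: "\<And>i. i \<in> {1..n} \<Longrightarrow> \<bar>x i - y i\<bar> \<le> d" and fx: "f x \<noteq> 0" for x y
  proof -
    have xB: "x \<in> ?B"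
    proof -
      have "\<bar>x i\<bar> \<le> real A + 1" if "i \<in> {1..n}" for i using supported_inD[OF A xy(1) fx that] by linarith
      thus ?thesis using xy(1) by blast
    qed
    have yB: "y \<in> ?B"
    proof -
      have "\<bar>y i\<bar> \<le> real A + 1" if "i \<in> {1..n}" for i
        using supported_inD[OF A xy(1) fx that] close[OF that] d(2) by linarith
      thus ?thesis using xy(2) by blast
    qed
    have "dist x y \<le> 2 * d"
    proof (rule dist_fun_le)
      fix i show "\<bar>x i - y i\<bar> \<le> d"
      proof (cases "i \<in> {1..n}")
        case False
        hence "x i = undefined" "y i = undefined"
          using PiE_arb[OF xy(1)[unfolded Rn_def]] PiE_arb[OF xy(2)[unfolded Rn_def]] by blast+
        thus ?thesis using d by simp
      qed (rule close)
    qed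
    hence dd: "dist x y < \<delta>" using d(3) by linarith
    have "dist (f x) (f y) < e"
      by (rule \<delta>(2)[THEN bspec, OF yB, THEN bspec, OF xB, THEN mp, OF dd])
    thus ?thesis by (simp add: dist_real_def)
  qed
  show ?thesis
  proof (rule that[OF d(1)], unfold osc_le_def, intro ballI impI)
    fix x y assume xy: "x \<in> Rn n" "y \<in> Rn n" and close: "\<forall>i\<in>{1..n}. \<bar>x i - y i\<bar> \<le> d"
    show "\<bar>f x - f y\<bar> \<le> e"
    proof (cases "f x = 0")
      case False
      show ?thesis by (rule main[OF xy _ False]) (use close in blast)
    next
      case True
      show ?thesis
      proof (cases "f y = 0")
        case False
        have "\<bar>f y - f x\<bar> \<le> e" by (rule main[OF xy(2,1) _ False]) (use close in \<open>simp add: abs_minus_commute\<close>)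
        thus ?thesis by simp
      qed (use True e in simp)
    qed
  qed
qed

section \<open>Step functions on a grid\<close>

definition ico :: "real \<Rightarrow> real \<Rightarrow> real \<Rightarrow> real" where
  "ico lo hi t = of_bool (lo \<le> t \<and> t < hi)"

definition grid :: "nat \<Rightarrow> nat \<Rightarrow> nat \<Rightarrow> (nat \<Rightarrow> int) set" where
  "grid n A q = {1..n} \<rightarrow>\<^sub>E {- int (A * q)..<int (A * q)}"

definition grid_point :: "nat \<Rightarrow> nat \<Rightarrow> (nat \<Rightarrow> int) \<Rightarrow> nat \<Rightarrow> real" where
  "grid_point n q j = (\<lambda>i\<in>{1..n}. of_int (j i) / real q)"

abbreviation cell_lo :: "nat \<Rightarrow> (nat \<Rightarrow> int) \<Rightarrow> nat \<Rightarrow> real" where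
  "cell_lo q j \<equiv> \<lambda>i. of_int (j i) / real q"

abbreviation cell_hi :: "nat \<Rightarrow> (nat \<Rightarrow> int) \<Rightarrow> nat \<Rightarrow> real" where
  "cell_hi q j \<equiv> \<lambda>i. (of_int (j i) + 1) / real q"

definition step_fun :: "nat \<Rightarrow> nat \<Rightarrow> nat \<Rightarrow> ((nat \<Rightarrow> real) \<Rightarrow> real) \<Rightarrow> (nat \<Rightarrow> real) \<Rightarrow> real" where
  "step_fun n A q f x = (\<Sum>j\<in>grid n A q. f (grid_point n q j) *
     (\<Prod>i\<in>{1..n}. ico (cell_lo q j i) (cell_hi q j i) (x i)))"

lemma finite_grid: "finite (grid n A q)"
  unfolding grid_def by (intro finite_PiE) auto

lemma ico_cell:
  assumes "q > 0"
  shows "ico (of_int j / real q) ((of_int j + 1) / real q) t = of_bool (j = \<lfloor>real q * t\<rfloor>)"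
proof -
  have "of_int j / real q \<le> t \<and> t < (of_int j + 1) / real q \<longleftrightarrow> of_int j \<le> real q * t \<and> real q * t < of_int j + 1"
    using assms by (simp add: divide_le_eq less_divide_eq mult.commute)
  also have "\<dots> \<longleftrightarrow> j = \<lfloor>real q * t\<rfloor>" by linarith
  finally show ?thesis by (simp add: ico_def)
qed

lemma grid_cell:
  assumes "j \<in> grid n A q" "i \<in> {1..n}" "q > 0"
  shows "- real A \<le> of_int (j i) / real q" "(of_int (j i) + 1) / real q \<le> real A"
proof -
  have "- int (A * q) \<le> j i" "j i + 1 \<le> int (A * q)" using assms(1,2) by (auto simp: grid_def dest!: PiE_mem)
  hence "- real (A * q) \<le> of_int (j i)" "of_int (j i) + 1 \<le> real (A * q)" by linarith+
  thus "- real A \<le> of_int (j i) / real q" "(of_int (j i) + 1) / real q \<le> real A"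
    using assms(3) by (simp_all add: field_simps)
qed

lemma prod_of_bool: "finite I \<Longrightarrow> (\<Prod>i\<in>I. of_bool (P i)) = (of_bool (\<forall>i\<in>I. P i) :: real)"
  by (induction I rule: finite_induct) auto

lemma step_fun_eq:
  assumes q: "q > 0" and x: "\<And>i. i \<in> {1..n} \<Longrightarrow> - real A \<le> x i \<and> x i < real A"
  shows "step_fun n A q f x = f (grid_point n q (\<lambda>i\<in>{1..n}. \<lfloor>real q * x i\<rfloor>))"
proof -
  let ?j = "\<lambda>i\<in>{1..n}. \<lfloor>real q * x i\<rfloor>"
  have mem: "?j \<in> grid n A q"
  proof -
    have "- int (A * q) \<le> \<lfloor>real q * x i\<rfloor> \<and> \<lfloor>real q * x i\<rfloor> < int (A * q)" if "i \<in> {1..n}" for i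
    proof -
      have "real q * (- real A) \<le> real q * x i" "real q * x i < real q * real A"
        using x[OF that] q by (intro mult_left_mono mult_strict_left_mono; simp)+
      thus ?thesis by (simp add: le_floor_iff floor_less_iff mult.commute)
    qed
    thus ?thesis by (auto simp: grid_def)
  qed
  have "(\<Prod>i\<in>{1..n}. ico (cell_lo q j i) (cell_hi q j i) (x i)) = of_bool (j = ?j)"
    if "j \<in> grid n A q" for j
  proof -
    have "(\<forall>i\<in>{1..n}. j i = \<lfloor>real q * x i\<rfloor>) \<longleftrightarrow> j = ?j"
    proof
      assume "\<forall>i\<in>{1..n}. j i = \<lfloor>real q * x i\<rfloor>"
      thus "j = ?j" using that by (intro extensionalityI[of _ "{1..n}"]) (auto simp: grid_def PiE_def)
    qed auto
    thus ?thesis unfolding ico_cell[OF q] by (subst prod_of_bool) auto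
  qed
  hence "step_fun n A q f x = (\<Sum>j\<in>grid n A q. if j = ?j then f (grid_point n q j) else 0)"
    unfolding step_fun_def by (intro sum.cong) auto
  thus ?thesis using mem finite_grid by simp
qed

text \<open>The error carries the indicator of the bounding box. After periodisation this is again a
  box correlation and so stays bounded, whereas a constant error would be summed over all tuples and
  diverge.\<close>

lemma step_fun_approx:
  assumes q: "q > 0" "1 / real q \<le> d" and e: "e \<ge> 0"
    and A: "supported_in n A f"
    and d: "osc_le n d e f"
    and x: "x \<in> Rn n"
  shows "\<bar>f x - step_fun n A q f x\<bar> \<le> e * (\<Prod>i\<in>{1..n}. ico (- real A) (real A) (x i))"
proof (cases "\<forall>i\<in>{1..n}. - real A \<le> x i \<and> x i < real A")
  case True
  have "\<bar>f x - f (grid_point n q (\<lambda>i\<in>{1..n}. \<lfloor>real q * x i\<rfloor>))\<bar> \<le> e"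
  proof (rule osc_leD[OF d x])
    fix i assume i: "i \<in> {1..n}"
    have "\<bar>real q * x i - of_int \<lfloor>real q * x i\<rfloor>\<bar> \<le> 1" by linarith
    hence "\<bar>(real q * x i - of_int \<lfloor>real q * x i\<rfloor>) / real q\<bar> \<le> 1 / real q"
      using q by (simp add: abs_divide divide_right_mono)
    moreover have "(real q * x i - of_int \<lfloor>real q * x i\<rfloor>) / real q = x i - of_int \<lfloor>real q * x i\<rfloor> / real q"
      using q by (simp add: diff_divide_distrib)
    ultimately show "\<bar>x i - grid_point n q (\<lambda>i\<in>{1..n}. \<lfloor>real q * x i\<rfloor>) i\<bar> \<le> d"
      using q i by (simp add: grid_point_def)
  qed (auto simp: grid_point_def Rn_def)
  thus ?thesis using True step_fun_eq[OF q(1), of n A x f] by (simp add: ico_def)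
next
  case False
  then obtain i where i: "i \<in> {1..n}" "\<not> (- real A \<le> x i \<and> x i < real A)" by blast
  have "f x = 0" using supported_inD[OF A x _ i(1)] i(2) by fastforce
  moreover have "step_fun n A q f x = 0"
    unfolding step_fun_def
  proof (rule sum.neutral, rule ballI)
    fix j assume j: "j \<in> grid n A q"
    hence "ico (cell_lo q j i) (cell_hi q j i) (x i) = 0"
      using i(2) grid_cell[OF j i(1) q(1)] unfolding ico_def by auto
    thus "f (grid_point n q j) * (\<Prod>i\<in>{1..n}. ico (cell_lo q j i) (cell_hi q j i) (x i)) = 0"
      using i(1) by (auto simp: prod_zero_iff)
  qed
  moreover have "0 \<le> e * (\<Prod>i\<in>{1..n}. ico (- real A) (real A) (x i))"
    using e by (intro mult_nonneg_nonneg prod_nonneg) (auto simp: ico_def)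
  ultimately show ?thesis by simp
qed

text \<open>For \<open>N > 2 * A\<close> at most one translate per coordinate meets
  \<open>[- A, A]\<close>. If every coordinate has one in the half-open interval, the periodisation
  is the value of \<open>f\<close> at a single point, and \<open>hits\<close> agrees there with
  \<open>ico\<close>; otherwise all terms vanish.\<close>

lemma periodization_approx:
  assumes q: "q > 0" "1 / real q \<le> d" and e: "e \<ge> 0"
    and A: "supported_in n A f"
    and d: "osc_le n d e f"
    and N: "2 * A < N"
  shows "\<bar>periodization n f N y - (\<Sum>j\<in>grid n A q. f (grid_point n q j) *
      (\<Prod>i\<in>{1..n}. hits (cell_lo q j i) (cell_hi q j i) N (y i)))\<bar>
    \<le> e * (\<Prod>i\<in>{1..n}. hits (- real A) (real A) N (y i))"
proof (cases "\<forall>i\<in>{1..n}. \<exists>m :: int. - real A \<le> real N * (of_int m + y i) \<and> real N * (of_int m + y i) < real A")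
  case True
  then obtain m0 :: "nat \<Rightarrow> int" where m0: "\<And>i. i \<in> {1..n} \<Longrightarrow> - real A \<le> real N * (of_int (m0 i) + y i) \<and> real N * (of_int (m0 i) + y i) < real A"
    by metis
  define m where "m = restrict m0 {1..n}"
  define x where "x = (\<lambda>i\<in>{1..n}. real N * (real_of_int (m i) + y i))"
  have x: "x \<in> Rn n" by (auto simp: x_def Rn_def)
  have xA: "- real A \<le> x i \<and> x i < real A" if "i \<in> {1..n}" for i
    using m0[OF that] that by (simp add: x_def m_def)
  have uniq: "m' = m i"
    if i: "i \<in> {1..n}" and m': "- real A \<le> real N * (of_int m' + y i)" "real N * (of_int m' + y i) \<le> real A" for m' i
  proof -
    have "real N * of_int m' - real N * of_int (m i) = real N * (of_int m' + y i) - x i"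
      using i by (simp add: x_def algebra_simps)
    hence "\<bar>real N * of_int m' - real N * of_int (m i)\<bar> \<le> 2 * real A" using m' xA[OF i] by linarith
    hence "real N * \<bar>of_int (m' - m i)\<bar> \<le> 2 * real A"
      by (simp add: abs_mult[symmetric] right_diff_distrib[symmetric] abs_of_nonneg flip: of_int_diff)
    also have "\<dots> < real N * 1" using N by simp
    finally have "\<bar>real_of_int (m' - m i)\<bar> < 1"
      using N by (simp add: mult_less_cancel_left_pos of_nat_0_less_iff)
    thus ?thesis by linarith
  qed
  have hits_eq: "hits lo hi N (y i) = ico lo hi (x i)"
    if i: "i \<in> {1..n}" and "- real A \<le> lo" "hi \<le> real A" for lo hi i
  proof -
    have "(\<exists>m' :: int. lo \<le> real N * (of_int m' + y i) \<and> real N * (of_int m' + y i) < hi) \<longleftrightarrow> lo \<le> x i \<and> x i < hi"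
    proof
      assume "\<exists>m' :: int. lo \<le> real N * (of_int m' + y i) \<and> real N * (of_int m' + y i) < hi"
      then obtain m' :: int where m': "lo \<le> real N * (of_int m' + y i)" "real N * (of_int m' + y i) < hi" by blast
      have "m' = m i" by (rule uniq[OF i]) (use m' that in linarith)+
      thus "lo \<le> x i \<and> x i < hi" using m' i by (simp add: x_def)
    next
      assume "lo \<le> x i \<and> x i < hi"
      thus "\<exists>m' :: int. lo \<le> real N * (of_int m' + y i) \<and> real N * (of_int m' + y i) < hi"
        using i by (auto simp: x_def)
    qed
    thus ?thesis by (simp only: hits_def ico_def)
  qed
  have per: "periodization n f N y = f x"
  proof -
    have mZ: "m \<in> Zn n" by (auto simp: m_def Zn_def)
    have "periodization n f N y = (\<Sum>\<^sub>\<infinity>m\<in>{m}. f (\<lambda>i\<in>{1..n}. real N * (real_of_int (m i) + y i)))"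
      unfolding periodization_def
    proof (rule infsum_cong_neutral)
      fix m' assume m': "m' \<in> Zn n - {m}"
      show "f (\<lambda>i\<in>{1..n}. real N * (real_of_int (m' i) + y i)) = 0"
      proof (rule ccontr)
        assume nz: "f (\<lambda>i\<in>{1..n}. real N * (real_of_int (m' i) + y i)) \<noteq> 0"
        have "m' i = m i" if i: "i \<in> {1..n}" for i
        proof -
          have "\<bar>(\<lambda>i\<in>{1..n}. real N * (real_of_int (m' i) + y i)) i\<bar> < real A"
            by (rule supported_inD[OF A _ nz i]) (auto simp: Rn_def)
          hence "\<bar>real N * (real_of_int (m' i) + y i)\<bar> < real A" using i by simp
          thus ?thesis by (intro uniq[OF i]) linarith+
        qed
        hence "m' = m" using m' mZ by (intro extensionalityI[of _ "{1..n}"]) (auto simp: Zn_def PiE_def)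
        thus False using m' by simp
      qed
    qed (use mZ in auto)
    thus ?thesis by (simp add: x_def)
  qed
  have "(\<Sum>j\<in>grid n A q. f (grid_point n q j) *
      (\<Prod>i\<in>{1..n}. hits (cell_lo q j i) (cell_hi q j i) N (y i))) = step_fun n A q f x"
    unfolding step_fun_def
  proof (intro sum.cong refl arg_cong2[where f = "(*)"] prod.cong)
    fix j i assume "j \<in> grid n A q" "i \<in> {1..n}"
    thus "hits (cell_lo q j i) (cell_hi q j i) N (y i)
      = ico (cell_lo q j i) (cell_hi q j i) (x i)"
      using grid_cell[OF _ _ q(1)] by (intro hits_eq)
  qed
  moreover have "(\<Prod>i\<in>{1..n}. hits (- real A) (real A) N (y i)) = (\<Prod>i\<in>{1..n}. ico (- real A) (real A) (x i))"
    by (intro prod.cong refl hits_eq) auto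
  ultimately show ?thesis using step_fun_approx[OF q e A d x] per by simp
next
  case False
  then obtain i where i: "i \<in> {1..n}"
    and no: "\<And>m :: int. \<not> (- real A \<le> real N * (of_int m + y i) \<and> real N * (of_int m + y i) < real A)" by blast
  have "periodization n f N y = 0"
    unfolding periodization_def
  proof (rule infsum_0)
    fix m assume "m \<in> Zn n"
    show "f (\<lambda>i\<in>{1..n}. real N * (real_of_int (m i) + y i)) = 0"
    proof (rule ccontr)
      assume nz: "f (\<lambda>i\<in>{1..n}. real N * (real_of_int (m i) + y i)) \<noteq> 0"
      have "\<bar>(\<lambda>i\<in>{1..n}. real N * (real_of_int (m i) + y i)) i\<bar> < real A"
        by (rule supported_inD[OF A _ nz i]) (auto simp: Rn_def)
      thus False using no[of "m i"] i by auto
    qed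
  qed
  moreover have "(\<Sum>j\<in>grid n A q. f (grid_point n q j) *
      (\<Prod>i\<in>{1..n}. hits (cell_lo q j i) (cell_hi q j i) N (y i))) = 0"
  proof (rule sum.neutral, rule ballI)
    fix j assume j: "j \<in> grid n A q"
    have "\<not> (\<exists>m :: int. cell_lo q j i \<le> real N * (of_int m + y i) \<and> real N * (of_int m + y i) < (of_int (j i) + 1) / real q)"
      using no grid_cell[OF j i(1) q(1)] by (meson less_le_trans order_trans)
    hence "hits (cell_lo q j i) (cell_hi q j i) N (y i) = 0"
      by (simp only: hits_def of_bool_def if_False)
    thus "f (grid_point n q j) * (\<Prod>i\<in>{1..n}. hits (cell_lo q j i) (cell_hi q j i) N (y i)) = 0"
      using i(1) by (auto simp: prod_zero_iff)
  qed
  moreover have "0 \<le> e * (\<Prod>i\<in>{1..n}. hits (- real A) (real A) N (y i))"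
    using e by (intro mult_nonneg_nonneg prod_nonneg) (auto simp: hits_bounds)
  ultimately show ?thesis by simp
qed

lemma correlation_sum_approx:
  assumes q: "q > 0" "1 / real q \<le> d" and e: "e \<ge> 0"
    and A: "supported_in (k - 1) A f"
    and d: "osc_le (k - 1) d e f"
    and N: "2 * A < N"
  shows "\<bar>correlation_sum a k f N \<alpha> - (\<Sum>j\<in>grid (k - 1) A q. f (grid_point (k - 1) q j) *
      box_correlation a k (cell_lo q j) (cell_hi q j) N \<alpha>)\<bar>
    \<le> e * box_correlation a k (\<lambda>i. - real A) (\<lambda>i. real A) N \<alpha>"
proof -
  let ?I = "{1..k - 1}"
  let ?X = "distinct_tuples k N"
  let ?y = "\<lambda>x i. \<alpha> * real_of_int (Delta a k x i)"
  let ?p = "\<lambda>x. periodization (k - 1) f N (\<lambda>i\<in>?I. ?y x i)"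
  let ?h = "\<lambda>j x. \<Prod>i\<in>?I. hits (cell_lo q j i) (cell_hi q j i) N (?y x i)"
  let ?b = "\<lambda>x. \<Prod>i\<in>?I. hits (- real A) (real A) N (?y x i)"
  let ?f = "\<lambda>j. f (grid_point (k - 1) q j)"
  have one: "\<bar>?p x - (\<Sum>j\<in>grid (k - 1) A q. ?f j * ?h j x)\<bar> \<le> e * ?b x" for x
  proof -
    have h: "(\<Prod>i\<in>?I. hits (g i) (g' i) N ((\<lambda>i\<in>?I. ?y x i) i)) = (\<Prod>i\<in>?I. hits (g i) (g' i) N (?y x i))" for g g'
      by (intro prod.cong) auto
    show ?thesis using periodization_approx[OF q e A d N, of "\<lambda>i\<in>?I. ?y x i"] unfolding h .
  qed
  have "(\<Sum>j\<in>grid (k - 1) A q. ?f j * box_correlation a k (cell_lo q j) (cell_hi q j) N \<alpha>)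
    = (1 / real N) * (\<Sum>j\<in>grid (k - 1) A q. \<Sum>x\<in>?X. ?f j * ?h j x)"
    unfolding box_correlation_eq by (simp add: sum_distrib_left mult_ac)
  also have "\<dots> = (1 / real N) * (\<Sum>x\<in>?X. \<Sum>j\<in>grid (k - 1) A q. ?f j * ?h j x)"
    by (subst sum.swap) (rule refl)
  finally have "correlation_sum a k f N \<alpha> - (\<Sum>j\<in>grid (k - 1) A q. ?f j *
      box_correlation a k (cell_lo q j) (cell_hi q j) N \<alpha>)
    = (1 / real N) * (\<Sum>x\<in>?X. ?p x - (\<Sum>j\<in>grid (k - 1) A q. ?f j * ?h j x))"
    unfolding correlation_sum_def by (simp only: sum_subtractf right_diff_distrib)
  hence "\<bar>correlation_sum a k f N \<alpha> - (\<Sum>j\<in>grid (k - 1) A q. ?f j *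
      box_correlation a k (cell_lo q j) (cell_hi q j) N \<alpha>)\<bar>
    = (1 / real N) * \<bar>\<Sum>x\<in>?X. ?p x - (\<Sum>j\<in>grid (k - 1) A q. ?f j * ?h j x)\<bar>"
    by (simp only: abs_mult) simp
  also have "\<dots> \<le> (1 / real N) * (\<Sum>x\<in>?X. e * ?b x)"
    by (intro mult_left_mono order_trans[OF sum_abs] sum_mono one) simp
  also have "\<dots> = e * box_correlation a k (\<lambda>i. - real A) (\<lambda>i. real A) N \<alpha>"
    unfolding box_correlation_eq by (simp add: sum_distrib_left)
  finally show ?thesis .
qed

section \<open>Integrals of step functions and of test functions\<close>

lemma integral_ico:
  assumes "lo \<le> hi"
  shows "integrable lborel (ico lo hi)" "(\<integral>t. ico lo hi t \<partial>lborel) = hi - lo"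
proof -
  have eq: "ico lo hi = indicator {lo..<hi}" by (auto simp: ico_def indicator_def fun_eq_iff)
  show "integrable lborel (ico lo hi)" unfolding eq using assms by (intro integrable_real_indicator) auto
  show "(\<integral>t. ico lo hi t \<partial>lborel) = hi - lo" unfolding eq using assms by simp
qed

interpretation lborel_product: product_sigma_finite "\<lambda>_ :: nat. lborel :: real measure"
  by standard

lemma integral_box:
  assumes "\<And>i. i \<in> {1..n} \<Longrightarrow> lo i \<le> hi i"
  shows "integrable (lborel_Rn n) (\<lambda>x. \<Prod>i\<in>{1..n}. ico (lo i) (hi i) (x i))"
    "(\<integral>x. (\<Prod>i\<in>{1..n}. ico (lo i) (hi i) (x i)) \<partial>lborel_Rn n) = (\<Prod>i\<in>{1..n}. hi i - lo i)"
proof -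
  show "integrable (lborel_Rn n) (\<lambda>x. \<Prod>i\<in>{1..n}. ico (lo i) (hi i) (x i))"
    unfolding lborel_Rn_def
    by (rule lborel_product.product_integrable_prod) (use assms integral_ico in auto)
  have "(\<integral>x. (\<Prod>i\<in>{1..n}. ico (lo i) (hi i) (x i)) \<partial>lborel_Rn n)
    = (\<Prod>i\<in>{1..n}. \<integral>t. ico (lo i) (hi i) t \<partial>lborel)"
    unfolding lborel_Rn_def
    by (rule lborel_product.product_integral_prod) (use assms integral_ico in auto)
  also have "\<dots> = (\<Prod>i\<in>{1..n}. hi i - lo i)" by (intro prod.cong refl integral_ico assms)
  finally show "(\<integral>x. (\<Prod>i\<in>{1..n}. ico (lo i) (hi i) (x i)) \<partial>lborel_Rn n) = (\<Prod>i\<in>{1..n}. hi i - lo i)" .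
qed

lemma integrable_step_fun:
  assumes "q > 0"
  shows "integrable (lborel_Rn n) (step_fun n A q f)"
    "(\<integral>x. step_fun n A q f x \<partial>lborel_Rn n)
      = (\<Sum>j\<in>grid n A q. f (grid_point n q j) * (\<Prod>i\<in>{1..n}. cell_hi q j i - cell_lo q j i))"
proof -
  have le: "of_int j / real q \<le> (of_int j + 1) / real q" for j :: int
    by (intro divide_right_mono) auto
  have eq: "step_fun n A q f = (\<lambda>x. \<Sum>j\<in>grid n A q. f (grid_point n q j) *
     (\<Prod>i\<in>{1..n}. ico (cell_lo q j i) (cell_hi q j i) (x i)))"
    by (simp add: step_fun_def fun_eq_iff)
  have int: "integrable (lborel_Rn n) (\<lambda>x. f (grid_point n q j) *
     (\<Prod>i\<in>{1..n}. ico (cell_lo q j i) (cell_hi q j i) (x i)))" for j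
    by (intro integrable_mult_right integral_box le)
  show "integrable (lborel_Rn n) (step_fun n A q f)"
    unfolding eq by (intro Bochner_Integration.integrable_sum int)
  show "(\<integral>x. step_fun n A q f x \<partial>lborel_Rn n)
      = (\<Sum>j\<in>grid n A q. f (grid_point n q j) * (\<Prod>i\<in>{1..n}. cell_hi q j i - cell_lo q j i))"
    unfolding eq by (subst Bochner_Integration.integral_sum[OF int]) (simp only: integral_mult_right_zero integral_box(2)[OF le])
qed

lemma space_lborel_Rn: "space (lborel_Rn n) = Rn n"
  by (simp add: lborel_Rn_def space_PiM Rn_def)

lemma test_function_integral_approx:
  assumes f: "f \<in> test_functions n"
    and A: "supported_in n A f"
    and q: "q > 0" "1 / real q \<le> d" and e: "e \<ge> 0"
    and d: "osc_le n d e f"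
  shows "\<bar>(\<integral>x. f x \<partial>lborel_Rn n)
      - (\<Sum>j\<in>grid n A q. f (grid_point n q j) * (\<Prod>i\<in>{1..n}. cell_hi q j i - cell_lo q j i))\<bar>
    \<le> e * (\<Prod>i\<in>{1..n}. real A - - real A)"
proof -
  let ?M = "lborel_Rn n"
  let ?b = "\<lambda>x. \<Prod>i\<in>{1..n}. ico (- real A) (real A) (x i)"
  have b: "integrable ?M ?b" "(\<integral>x. ?b x \<partial>?M) = (\<Prod>i\<in>{1..n}. real A - - real A)"
    using integral_box[of n "\<lambda>_. - real A" "\<lambda>_. real A"] by auto
  have b1: "0 \<le> ?b x" "?b x \<le> 1" for x
    by (auto intro!: prod_nonneg prod_le_1 simp: ico_def)
  \<comment> \<open>Measurability for the product measure is inherited from step functions, which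
    converge to \<open>f\<close> pointwise on \<open>Rn n\<close> as the mesh
    \<open>1 / Suc m\<close> tends to 0.\<close>
  have meas: "f \<in> borel_measurable ?M"
  proof (rule borel_measurable_LIMSEQ_real)
    show "step_fun n A (Suc m) f \<in> borel_measurable ?M" for m
      using integrable_step_fun(1)[of "Suc m"] by auto
    fix x assume "x \<in> space ?M"
    hence x: "x \<in> Rn n" by (simp add: space_lborel_Rn)
    show "(\<lambda>m. step_fun n A (Suc m) f x) \<longlonglongrightarrow> f x"
    proof (rule LIMSEQ_I)
      fix r :: real assume r: "r > 0"
      obtain c where c: "c > 0" "osc_le n c (r / 2) f"
        by (rule test_function_uniform[where e = "r / 2", OF f A]) (use r in auto)
      obtain m0 where m0: "inverse (real (Suc m0)) < c" using reals_Archimedean[OF c(1)] by blast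
      show "\<exists>m0. \<forall>m\<ge>m0. norm (step_fun n A (Suc m) f x - f x) < r"
      proof (intro exI[of _ m0] allI impI)
        fix m assume "m \<ge> m0"
        hence "1 / real (Suc m) \<le> inverse (real (Suc m0))" by (simp add: field_simps)
        hence "1 / real (Suc m) \<le> c" using m0 by linarith
        hence "\<bar>f x - step_fun n A (Suc m) f x\<bar> \<le> r / 2 * ?b x"
          by (intro step_fun_approx[OF _ _ _ A c(2) x]) (use r in auto)
        also have "\<dots> \<le> r / 2 * 1" using r b1[of x] by (intro mult_left_mono) auto
        finally show "norm (step_fun n A (Suc m) f x - f x) < r" using r unfolding real_norm_def by linarith
      qed
    qed
  qed
  have diff: "\<bar>f x - step_fun n A q f x\<bar> \<le> e * ?b x" if "x \<in> Rn n" for x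
    by (rule step_fun_approx[OF q e A d that])
  have bound: "integrable ?M (\<lambda>x. e * ?b x)" using b(1) by simp
  have int_diff: "integrable ?M (\<lambda>x. f x - step_fun n A q f x)"
  proof (rule Bochner_Integration.integrable_bound[OF bound])
    show "(\<lambda>x. f x - step_fun n A q f x) \<in> borel_measurable ?M"
      using meas integrable_step_fun(1)[OF q(1), of n A f] by auto
    show "AE x in ?M. norm (f x - step_fun n A q f x) \<le> norm (e * ?b x)"
      by (rule AE_I2) (use diff b1 e in \<open>simp add: space_lborel_Rn\<close>)
  qed
  have "integrable ?M (\<lambda>x. (f x - step_fun n A q f x) + step_fun n A q f x)"
    by (rule Bochner_Integration.integrable_add[OF int_diff integrable_step_fun(1)[OF q(1)]])
  hence "(\<integral>x. f x - step_fun n A q f x \<partial>?M) = (\<integral>x. f x \<partial>?M) - (\<integral>x. step_fun n A q f x \<partial>?M)"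
    using integrable_step_fun(1)[OF q(1), of n A f] by simp
  hence "\<bar>(\<integral>x. f x \<partial>?M) - (\<integral>x. step_fun n A q f x \<partial>?M)\<bar> = norm (\<integral>x. f x - step_fun n A q f x \<partial>?M)" by simp
  also have "\<dots> \<le> (\<integral>x. e * ?b x \<partial>?M)"
  proof (rule order_trans[OF Bochner_Integration.integral_norm_bound Bochner_Integration.integral_mono])
    show "integrable ?M (\<lambda>x. norm (f x - step_fun n A q f x))" using int_diff by (rule integrable_norm)
    show "norm (f x - step_fun n A q f x) \<le> e * ?b x" if "x \<in> space ?M" for x
      using diff that by (simp add: space_lborel_Rn)
  qed (rule bound)
  also have "\<dots> = e * (\<Prod>i\<in>{1..n}. real A - - real A)" using b(2) by simp
  finally show ?thesis unfolding integrable_step_fun(2)[OF q(1)] .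
qed

lemma correlation_sum_limit:
  assumes f: "f \<in> test_functions (k - 1)"
    and box: "\<And>lo hi. (\<And>i. i \<in> {1..k - 1} \<Longrightarrow> lo i < hi i) \<Longrightarrow>
      (\<lambda>N. box_correlation a k lo hi N \<alpha>) \<longlonglongrightarrow> (\<Prod>i\<in>{1..k - 1}. hi i - lo i)"
  shows "(\<lambda>N. correlation_sum a k f N \<alpha>) \<longlonglongrightarrow> (\<integral>x. f x \<partial>lborel_Rn (k - 1))"
proof -
  let ?n = "k - 1"
  let ?L = "\<integral>x. f x \<partial>lborel_Rn ?n"
  obtain A :: nat where A0: "A > 0"
    and A: "supported_in ?n A f"
    by (rule test_function_support[OF f])
  define V where "V = (\<Prod>i\<in>{1..?n}. real A - - real A)"
  have V: "V \<ge> 0" unfolding V_def by (intro prod_nonneg) auto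
  have "eventually (\<lambda>N. dist (correlation_sum a k f N \<alpha>) ?L < r) sequentially" if r: "r > 0" for r
  proof -
    \<comment> \<open>Two errors \<open>e * V\<close> survive in the limit, one from the correlation
      of the bounding box, which tends to \<open>V\<close>, and one from the integral. The summand 1
      keeps the denominator positive and the inequality strict.\<close>
    define e where "e = r / (2 * V + 1)"
    have e: "e > 0" using r V by (simp add: e_def)
    have "e * V + e * V < e * (2 * V + 1)" using e by (simp add: algebra_simps)
    also have "\<dots> = r" using V by (simp add: e_def)
    finally have er: "e * V + e * V < r" .
    obtain d where d: "d > 0" "osc_le ?n d e f"
      by (rule test_function_uniform[OF f A e])
    obtain m where "inverse (real (Suc m)) < d" using reals_Archimedean[OF d(1)] by blast
    then obtain q where q: "q > 0" "1 / real q \<le> d" by (intro that[of "Suc m"]) (auto simp: inverse_eq_divide)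
    let ?f = "\<lambda>j. f (grid_point ?n q j)"
    let ?v = "\<lambda>j :: nat \<Rightarrow> int. \<Prod>i\<in>{1..?n}. cell_hi q j i - cell_lo q j i"
    let ?G = "\<lambda>N. \<Sum>j\<in>grid ?n A q. ?f j * box_correlation a k (cell_lo q j) (cell_hi q j) N \<alpha>"
    let ?H = "\<Sum>j\<in>grid ?n A q. ?f j * ?v j"
    let ?E = "\<lambda>N. e * box_correlation a k (\<lambda>i. - real A) (\<lambda>i. real A) N \<alpha> + \<bar>?G N - ?H\<bar> + e * V"
    have G: "?G \<longlonglongrightarrow> ?H"
      by (intro tendsto_sum tendsto_mult tendsto_const box) (use q in \<open>simp add: divide_strict_right_mono\<close>)
    have "?E \<longlonglongrightarrow> e * V + \<bar>?H - ?H\<bar> + e * V"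
      unfolding V_def by (intro tendsto_add tendsto_mult tendsto_const tendsto_rabs tendsto_diff G box) (use A0 in simp)
    hence "eventually (\<lambda>N. ?E N < r) sequentially" by (rule order_tendstoD) (use er in simp)
    with eventually_gt_at_top[of "2 * A"] show ?thesis
    proof eventually_elim
      case (elim N)
      have "\<bar>correlation_sum a k f N \<alpha> - ?G N\<bar> \<le> e * box_correlation a k (\<lambda>i. - real A) (\<lambda>i. real A) N \<alpha>"
        by (rule correlation_sum_approx[OF q _ A d(2) elim(1)]) (use e in simp)
      moreover have "\<bar>?L - ?H\<bar> \<le> e * V"
        unfolding V_def by (rule test_function_integral_approx[OF f A q _ d(2)]) (use e in simp)
      ultimately show ?case using elim(2) unfolding dist_real_def by linarith
    qed
  qed
  thus ?thesis by (rule tendstoI)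
qed

section \<open>Eventual growth and the set of full measure\<close>

lemma lacunary_imp_tail:
  assumes "lacunary a"
  obtains x0 \<rho> where "lacunary_tail a x0 \<rho>"
proof -
  let ?q = "\<lambda>x. real_of_int (a (x + 1)) / real_of_int (a x)"
  have "1 < liminf (\<lambda>x. ereal (?q x))" using assms by (simp add: lacunary_def)
  then obtain \<rho> where \<rho>: "1 < ereal \<rho>" "ereal \<rho> < liminf (\<lambda>x. ereal (?q x))"
    using ereal_dense2 by blast
  from less_LiminfD[OF \<rho>(2)] obtain x0 where x0: "\<And>x. x \<ge> x0 \<Longrightarrow> ereal \<rho> < ereal (?q x)"
    unfolding eventually_sequentially by blast
  have q: "\<rho> < ?q x" if "x \<ge> x0" for x using x0[OF that] by simp
  have \<rho>1: "\<rho> > 1" using \<rho>(1) by simp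
  \<comment> \<open>At a zero of \<open>a\<close> the quotient would be 0 and could not exceed
    \<rho>.\<close>
  have nz: "a x \<noteq> 0" if "x \<ge> x0" for x using q[OF that] \<rho>1 by auto
  have "lacunary_tail a x0 \<rho>"
  proof
    fix x assume x: "x \<ge> x0"
    have "\<bar>?q x\<bar> = \<bar>real_of_int (a (Suc x))\<bar> / \<bar>real_of_int (a x)\<bar>" by (simp add: abs_divide)
    hence "\<rho> < \<bar>real_of_int (a (Suc x))\<bar> / \<bar>real_of_int (a x)\<bar>" using q[OF x] by linarith
    thus "\<rho> * \<bar>real_of_int (a x)\<bar> \<le> \<bar>real_of_int (a (Suc x))\<bar>"
      using nz[OF x] by (simp add: less_divide_eq)
  qed (use \<rho>1 nz in auto)
  thus ?thesis by (rule that)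
qed

theorem theorem1p2:
  fixes a :: "nat \<Rightarrow> int"
  assumes "lacunary a"
  shows "\<exists>S :: real set. - S \<in> null_sets lebesgue \<and>
    (\<forall>\<alpha>\<in>S. \<forall>k\<ge>2. \<forall>f\<in>test_functions (k - 1).
       (\<lambda>N. correlation_sum a k f N \<alpha>) \<longlonglongrightarrow> (\<integral>x. f x \<partial>(lborel_Rn (k - 1))))"
proof -
  obtain x0 \<rho> where "lacunary_tail a x0 \<rho>" using lacunary_imp_tail[OF assms] .
  then interpret lacunary_tail a x0 \<rho> .
  from AE_generic obtain M where M: "{\<alpha> \<in> space lborel. \<not> (\<forall>k\<ge>2. generic a k \<alpha>)} \<subseteq> M" "emeasure lborel M = 0" "M \<in> sets lborel"
    by (rule AE_E)
  define S where "S = {\<alpha>. \<forall>k\<ge>2. generic a k \<alpha>}"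
  have "- S \<subseteq> M" using M(1) by (auto simp: S_def)
  \<comment> \<open>The complement of \<open>S\<close> is known only to lie inside a Borel null set;
    completeness of Lebesgue measure makes it a null set itself.\<close>
  hence "- S \<in> null_sets lebesgue" using null_setsI[OF M(2,3)] unfolding null_sets_completion_iff2 by blast
  moreover have "(\<lambda>N. correlation_sum a k f N \<alpha>) \<longlonglongrightarrow> (\<integral>x. f x \<partial>(lborel_Rn (k - 1)))"
    if "\<alpha> \<in> S" "k \<ge> 2" "f \<in> test_functions (k - 1)" for \<alpha> k f
  proof (rule correlation_sum_limit[OF that(3)])
    show "(\<lambda>N. box_correlation a k lo hi N \<alpha>) \<longlonglongrightarrow> (\<Prod>i\<in>{1..k - 1}. hi i - lo i)"
      if "\<And>i. i \<in> {1..k - 1} \<Longrightarrow> lo i < hi i" for lo hi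
      using \<open>\<alpha> \<in> S\<close> \<open>k \<ge> 2\<close> that by (intro generic_imp_box_limit) (auto simp: S_def)
  qed
  ultimately show ?thesis by blast
qed

end
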